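(* Let $\Gamma$ be a weakly totally torsion free profinite group. Let $\mathfrak{V}$ denote the set of all closed normal subgroups $K$ of $\Gamma$ for which $\Gamma/K$ is in $\mathfrak{B}$. Then the natural homomorphism $$\varphi:\Gamma\longrightarrow\prod_{K\in\mathfrak{V}}\Gamma/K$$ is injective, and $\Gamma$ is isomorphic as a topological group, via $\varphi$, to the image of $\varphi$ (with the subspace topology from the product topology). Equivalently, $\Gamma$ is isomorphic (as a topological group, via the natural map) to the inverse limit of the partially ordered set of quotients $\Gamma/K$, $K\in\mathfrak{V}$.
   Context: A Hausdorff topological group is called weakly totally torsion free if every closed subgroup of finite index has torsion free abelianization, where the abelianization of a closed subgroup $K$ means the quotient of $K$ by the closure of its commutator subgroup. A profinite group is called virtually finitely generated abelian if it contains a closed topologically finitely generated abelian subgroup of finite index. $\mathfrak{B}$ denotes the family of all torsion free, virtually finitely generated abelian profinite groups. The quotients $\Gamma/K$ carry the quotient topology; they are ordered by the natural projections $\Gamma/K\to\Gamma/K'$ for $K\subseteq K'$. *)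

theory Defs
  imports "HOL-Analysis.Analysis" "HOL-Algebra.Product_Groups"
begin

section \<open>Topological groups\<close>

locale topological_group = group G
  for G :: "('a, 'b) monoid_scheme" (structure) and T :: "'a topology" +
  assumes topspace_eq: "topspace T = carrier G"
    and continuous_mult: "continuous_map (prod_topology T T) T (\<lambda>(x, y). x \<otimes> y)"
    and continuous_inv: "continuous_map T T (\<lambda>x. inv x)"

definition closed_subgroup :: "'a set \<Rightarrow> ('a, 'b) monoid_scheme \<Rightarrow> 'a topology \<Rightarrow> bool" where
  "closed_subgroup H G T \<longleftrightarrow> subgroup H G \<and> closedin T H"

definition finite_index :: "'a set \<Rightarrow> ('a, 'b) monoid_scheme \<Rightarrow> bool" where
  "finite_index H G \<longleftrightarrow> finite (rcosets\<^bsub>G\<^esub> H)"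

definition torsion_free :: "('a, 'b) monoid_scheme \<Rightarrow> bool" where
  "torsion_free G \<longleftrightarrow>
     (\<forall>x \<in> carrier G. \<forall>n :: nat. n > 0 \<and> x [^]\<^bsub>G\<^esub> n = \<one>\<^bsub>G\<^esub> \<longrightarrow> x = \<one>\<^bsub>G\<^esub>)"

definition top_finitely_generated :: "('a, 'b) monoid_scheme \<Rightarrow> 'a topology \<Rightarrow> bool" where
  "top_finitely_generated G T \<longleftrightarrow>
     (\<exists>S \<subseteq> carrier G. finite S \<and> T closure_of (generate G S) = carrier G)"

definition top_abelianization ::
  "('a, 'b) monoid_scheme \<Rightarrow> 'a topology \<Rightarrow> 'a set monoid" where
  "top_abelianization G T = G Mod (T closure_of (derived G (carrier G)))"

definition weakly_totally_torsion_free :: "('a, 'b) monoid_scheme \<Rightarrow> 'a topology \<Rightarrow> bool" where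
  "weakly_totally_torsion_free G T \<longleftrightarrow>
     topological_group G T \<and> Hausdorff_space T \<and>
     (\<forall>K. closed_subgroup K G T \<and> finite_index K G \<longrightarrow>
        torsion_free (top_abelianization (G\<lparr>carrier := K\<rparr>) (subtopology T K)))"

definition top_group_iso ::
  "('a, 'b) monoid_scheme \<Rightarrow> 'a topology \<Rightarrow> ('c, 'd) monoid_scheme \<Rightarrow> 'c topology
     \<Rightarrow> ('a \<Rightarrow> 'c) \<Rightarrow> bool" where
  "top_group_iso G T H S f \<longleftrightarrow> f \<in> iso G H \<and> homeomorphic_map T S f"


section \<open>Profinite groups\<close>

definition profinite_group :: "('a, 'b) monoid_scheme \<Rightarrow> 'a topology \<Rightarrow> bool" where
  "profinite_group G T \<longleftrightarrow>
     topological_group G T \<and> compact_space T \<and> Hausdorff_space T \<and>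
     (\<forall>x \<in> topspace T. connected_component_of_set T x = {x})"

definition virtually_fg_abelian :: "('a, 'b) monoid_scheme \<Rightarrow> 'a topology \<Rightarrow> bool" where
  "virtually_fg_abelian G T \<longleftrightarrow>
     (\<exists>H. closed_subgroup H G T \<and> finite_index H G \<and>
        comm_group (G\<lparr>carrier := H\<rparr>) \<and>
        top_finitely_generated (G\<lparr>carrier := H\<rparr>) (subtopology T H))"

text \<open>Membership in the family \<open>\<BB>\<close>.\<close>

definition in_frakB :: "('a, 'b) monoid_scheme \<Rightarrow> 'a topology \<Rightarrow> bool" where
  "in_frakB G T \<longleftrightarrow> profinite_group G T \<and> torsion_free G \<and> virtually_fg_abelian G T"


section \<open>Quotients\<close>

definition quotient_topology :: "'a topology \<Rightarrow> ('a \<Rightarrow> 'b) \<Rightarrow> 'b topology" where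
  "quotient_topology X f =
     topology (\<lambda>U. U \<subseteq> f ` topspace X \<and> openin X {x \<in> topspace X. f x \<in> U})"

lemma openin_quotient_topology:
  "openin (quotient_topology X f) U \<longleftrightarrow>
     U \<subseteq> f ` topspace X \<and> openin X {x \<in> topspace X. f x \<in> U}"
proof -
  have "istopology (\<lambda>U. U \<subseteq> f ` topspace X \<and> openin X {x \<in> topspace X. f x \<in> U})"
    unfolding istopology_def
  proof (intro conjI allI impI)
    fix S U
    assume S: "S \<subseteq> f ` topspace X \<and> openin X {x \<in> topspace X. f x \<in> S}"
      and U: "U \<subseteq> f ` topspace X \<and> openin X {x \<in> topspace X. f x \<in> U}"
    show "S \<inter> U \<subseteq> f ` topspace X" using S by blast
    have "{x \<in> topspace X. f x \<in> S \<inter> U} =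
        {x \<in> topspace X. f x \<in> S} \<inter> {x \<in> topspace X. f x \<in> U}" by blast
    then show "openin X {x \<in> topspace X. f x \<in> S \<inter> U}" using S U by (simp add: openin_Int)
  next
    fix \<K>
    assume K: "\<forall>S\<in>\<K>. S \<subseteq> f ` topspace X \<and> openin X {x \<in> topspace X. f x \<in> S}"
    show "\<Union>\<K> \<subseteq> f ` topspace X" using K by blast
    have "{x \<in> topspace X. f x \<in> \<Union>\<K>} = (\<Union>S\<in>\<K>. {x \<in> topspace X. f x \<in> S})" by blast
    then show "openin X {x \<in> topspace X. f x \<in> \<Union>\<K>}" using K by auto
  qed
  then show ?thesis
    unfolding quotient_topology_def by (simp add: topology_inverse')
qed

lemma topspace_quotient_topology [simp]: "topspace (quotient_topology X f) = f ` topspace X"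
proof
  show "topspace (quotient_topology X f) \<subseteq> f ` topspace X"
    using openin_topspace[of "quotient_topology X f"] unfolding openin_quotient_topology by blast
  have "{x \<in> topspace X. f x \<in> f ` topspace X} = topspace X" by blast
  then have "openin (quotient_topology X f) (f ` topspace X)"
    by (simp add: openin_quotient_topology)
  then show "f ` topspace X \<subseteq> topspace (quotient_topology X f)"
    by (rule openin_subset)
qed

lemma quotient_map_quotient_topology: "quotient_map X (quotient_topology X f) f"
  by (simp add: quotient_map_def openin_quotient_topology)

definition quotient_group_topology ::
  "('a, 'b) monoid_scheme \<Rightarrow> 'a topology \<Rightarrow> 'a set \<Rightarrow> 'a set topology" where
  "quotient_group_topology G T K = quotient_topology T (\<lambda>x. K #>\<^bsub>G\<^esub> x)"


section \<open>The quotients in \<open>\<BB>\<close>, their product and their inverse limit\<close>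

definition frakV :: "('a, 'b) monoid_scheme \<Rightarrow> 'a topology \<Rightarrow> 'a set set" where
  "frakV G T =
     {K. K \<lhd> G \<and> closedin T K \<and> in_frakB (G Mod K) (quotient_group_topology G T K)}"

definition frakV_product :: "('a, 'b) monoid_scheme \<Rightarrow> 'a topology \<Rightarrow> ('a set \<Rightarrow> 'a set) monoid" where
  "frakV_product G T = product_group (frakV G T) (\<lambda>K. G Mod K)"

definition frakV_product_topology ::
  "('a, 'b) monoid_scheme \<Rightarrow> 'a topology \<Rightarrow> ('a set \<Rightarrow> 'a set) topology" where
  "frakV_product_topology G T = product_topology (quotient_group_topology G T) (frakV G T)"

definition natural_hom :: "('a, 'b) monoid_scheme \<Rightarrow> 'a topology \<Rightarrow> 'a \<Rightarrow> 'a set \<Rightarrow> 'a set" where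
  "natural_hom G T x = (\<lambda>K \<in> frakV G T. K #>\<^bsub>G\<^esub> x)"

text \<open>
  For \<open>K \<subseteq> K'\<close> the natural projection \<open>G / K \<rightarrow> G / K'\<close> maps a coset \<open>C = K x\<close>
  to \<open>K' C = K' x\<close>.
\<close>

definition quotient_projection ::
  "('a, 'b) monoid_scheme \<Rightarrow> 'a set \<Rightarrow> 'a set \<Rightarrow> 'a set" where
  "quotient_projection G K' C = K' <#>\<^bsub>G\<^esub> C"

lemma (in group) quotient_projection_coset:
  assumes "subgroup K G" "subgroup K' G" "K \<subseteq> K'" "x \<in> carrier G"
  shows "quotient_projection G K' (K #> x) = K' #> x"
proof -
  have "K' <#> K = K'"
  proof
    show "K' <#> K \<subseteq> K'"
      unfolding set_mult_def using assms(2,3) by (auto intro: subgroup.m_closed)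
    show "K' \<subseteq> K' <#> K"
    proof
      fix y assume y: "y \<in> K'"
      then have "y = y \<otimes> \<one>"
        using subgroup.mem_carrier[OF assms(2)] by simp
      then show "y \<in> K' <#> K"
        unfolding set_mult_def using y subgroup.one_closed[OF assms(1)] by blast
    qed
  qed
  moreover have "K' <#> (K #> x) = (K' <#> K) #> x"
    by (rule setmult_rcos_assoc[OF subgroup.subset[OF assms(2)] subgroup.subset[OF assms(1)] assms(4)])
  ultimately show ?thesis
    by (simp add: quotient_projection_def)
qed

definition frakV_inverse_limit_carrier ::
  "('a, 'b) monoid_scheme \<Rightarrow> 'a topology \<Rightarrow> ('a set \<Rightarrow> 'a set) set" where
  "frakV_inverse_limit_carrier G T =
     {f \<in> carrier (frakV_product G T).
        \<forall>K \<in> frakV G T. \<forall>K' \<in> frakV G T.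
          K \<subseteq> K' \<longrightarrow> quotient_projection G K' (f K) = f K'}"

definition frakV_inverse_limit ::
  "('a, 'b) monoid_scheme \<Rightarrow> 'a topology \<Rightarrow> ('a set \<Rightarrow> 'a set) monoid" where
  "frakV_inverse_limit G T =
     (frakV_product G T)\<lparr>carrier := frakV_inverse_limit_carrier G T\<rparr>"

definition frakV_inverse_limit_topology ::
  "('a, 'b) monoid_scheme \<Rightarrow> 'a topology \<Rightarrow> ('a set \<Rightarrow> 'a set) topology" where
  "frakV_inverse_limit_topology G T =
     subtopology (frakV_product_topology G T) (frakV_inverse_limit_carrier G T)"

end

theory Submission
  imports Defs "HOL-Number_Theory.Cong" "HOL-Computational_Algebra.Primes"
    "HOL-Algebra.SndIsomorphismGrp" "HOL-Algebra.Multiplicative_Group"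
begin

text \<open>
  Write \<open>D N\<close> for the closure of the commutator subgroup of \<open>N\<close>. The main point is that the kernels
  in \<open>frakV\<close> are arbitrarily small: every open normal subgroup \<open>N\<close> of \<open>\<Gamma>\<close> contains a
  \<open>K \<in> frakV\<close>.

  The group \<open>\<Gamma>/D N\<close> is torsion free. For \<open>y \<in> N\<close> this is the hypothesis on \<open>N\<close>. If \<open>y \<notin> N\<close> and
  \<open>y\<^sup>n \<in> D N\<close>, consider the open subgroup \<open>H\<close> generated by \<open>y\<close> and \<open>N\<close>: the element \<open>y\<close> is torsion in
  the abelianization of \<open>H\<close>, so \<open>y \<in> D H\<close>, and \<open>D H \<subseteq> N\<close> because \<open>H/N\<close> is cyclic; this is absurd.
  But \<open>N/D N\<close> is in general not finitely generated, so \<open>D N\<close> has to be enlarged without creating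
  torsion (\<open>ex_virtual_kernel\<close>).

  A torsion free abelian profinite group has enough continuous homomorphisms to the \<open>p\<close>-adic
  integers: every point outside \<open>D N\<close> is outside the kernel of such a homomorphism on \<open>N\<close>, for
  some prime \<open>p\<close> (\<open>ex_tf_fg_kernel\<close>). Dually, torsion freeness makes the group of continuous characters
  divisible, so a character with values in \<open>\<int>/p\<^sup>k\<close> can be lifted step by step
  (\<open>character_mod_lift\<close>). The kernel \<open>X\<close> of a \<open>p\<close>-adic homomorphism has a torsion free procyclic quotient
  \<open>N/X\<close>. With \<open>m\<close> the index of \<open>N\<close>, the compact set of all \<open>y\<^sup>m\<close> with \<open>y \<notin> N\<close> does not meet
  \<open>D N\<close>, so finitely many kernels \<open>X\<close> suffice to avoid it; intersecting them and their finitely many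
  conjugates gives a normal subgroup \<open>K\<close> of \<open>\<Gamma>\<close>. The quotient \<open>N/K\<close> is torsion free, and it is
  finitely generated because closed subgroups of finitely generated abelian profinite groups are
  (\<open>closed_subgroup_fg\<close>). An element \<open>y \<notin> N\<close> is not torsion modulo \<open>K\<close> because \<open>y\<^sup>m \<in> N - K\<close>. Hence
  \<open>K \<in> frakV\<close>.

  So \<open>frakV\<close> has trivial intersection and the natural map is injective; a continuous injection of
  a compact space into a Hausdorff space is a homeomorphism onto its image. By \<open>closed_subgroup_fg\<close>
  again, \<open>frakV\<close> is closed under binary intersections (\<open>virtual_kernel_Int\<close>). Therefore the cosets in
  a compatible family are a directed family of compact sets and have a common point, so the image is the whole
  inverse limit.

  All quotients of \<open>\<Gamma>\<close> that occur are described by subgroups of \<open>\<Gamma>\<close> itself: an abelian quotient by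
  a subgroup that contains all commutators, a finitely generated one by generators modulo that subgroup.
\<close>

section \<open>Additive functions modulo prime powers on finite abelian groups\<close>

text \<open>
  Homomorphisms from a subgroup \<open>H\<close> to the cyclic group \<open>\<int>/q\<close>, represented by integer valued functions
  so that different moduli can be compared.
\<close>

definition additive_mod :: "int \<Rightarrow> ('a, 'b) monoid_scheme \<Rightarrow> 'a set \<Rightarrow> ('a \<Rightarrow> int) \<Rightarrow> bool" where
  "additive_mod q G H f \<longleftrightarrow> (\<forall>x\<in>H. \<forall>y\<in>H. [f (x \<otimes>\<^bsub>G\<^esub> y) = f x + f y] (mod q))"

context group
begin

lemma additive_mod_one:
  assumes "additive_mod q G H f" "subgroup H G"
  shows "[f \<one> = 0] (mod q)"
proof -
  have "[f (\<one> \<otimes> \<one>) = f \<one> + f \<one>] (mod q)"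
    using assms subgroup.one_closed unfolding additive_mod_def by blast
  then have "[0 + f \<one> = f \<one> + f \<one>] (mod q)" by (simp only: l_one one_closed add_0)
  then have "[0 = f \<one>] (mod q)" by (simp only: cong_add_rcancel)
  then show ?thesis by (rule cong_sym)
qed

lemma additive_mod_inv:
  assumes "additive_mod q G H f" "subgroup H G" "x \<in> H"
  shows "[f (inv x) = - f x] (mod q)"
proof -
  have "[f (x \<otimes> inv x) = f x + f (inv x)] (mod q)"
    using assms(1,3) subgroup.m_inv_closed[OF assms(2,3)] unfolding additive_mod_def by simp
  moreover have "x \<otimes> inv x = \<one>" using subgroup.mem_carrier[OF assms(2,3)] by simp
  ultimately have "[f \<one> = f x + f (inv x)] (mod q)" by simp
  from cong_trans[OF cong_sym[OF this] additive_mod_one[OF assms(1,2)]]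
  have "[f x + f (inv x) = 0] (mod q)" .
  then have "[f x + f (inv x) - f x = 0 - f x] (mod q)"
    by (rule cong_diff[OF _ cong_refl])
  then show ?thesis by simp
qed

lemma additive_mod_nat_pow:
  assumes "additive_mod q G H f" "subgroup H G" "x \<in> H"
  shows "[f (x [^] (n::nat)) = int n * f x] (mod q)"
proof (induction n)
  case 0
  then show ?case using additive_mod_one[OF assms(1,2)] by simp
next
  case (Suc n)
  have "x [^] n \<in> H"
    using subgroup_int_pow_closed[OF assms(2,3), of "int n"] by (simp add: int_pow_int)
  then have "[f (x [^] Suc n) = f (x [^] n) + f x] (mod q)"
    using assms(1,3) unfolding additive_mod_def by simp
  also have "[f (x [^] n) + f x = int n * f x + f x] (mod q)"
    using Suc by (simp add: cong_add)
  finally show ?case by (simp add: algebra_simps)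
qed

lemma additive_mod_int_pow:
  assumes "additive_mod q G H f" "subgroup H G" "x \<in> H"
  shows "[f (x [^] (n::int)) = n * f x] (mod q)"
proof (cases n rule: int_cases2)
  case (nonneg m)
  then show ?thesis using additive_mod_nat_pow[OF assms] by (simp add: int_pow_int)
next
  case (nonpos m)
  have x: "x \<in> carrier G" by (rule subgroup.mem_carrier[OF assms(2,3)])
  have xm: "x [^] m \<in> H"
    using subgroup_int_pow_closed[OF assms(2,3), of "int m"] by (simp add: int_pow_int)
  have "[f (inv (x [^] m)) = - f (x [^] m)] (mod q)"
    by (rule additive_mod_inv[OF assms(1,2) xm])
  also have "[- f (x [^] m) = - (int m * f x)] (mod q)"
    using additive_mod_nat_pow[OF assms] by (simp add: cong_minus_minus_iff)
  finally have "[f (inv (x [^] m)) = - int m * f x] (mod q)" by simp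
  moreover have "x [^] n = inv (x [^] m)" using nonpos x int_pow_neg_int by metis
  ultimately show ?thesis using nonpos by metis
qed

lemma additive_mod_diff:
  assumes "additive_mod q G H f" "subgroup H G" "x \<in> H" "y \<in> H"
  shows "[f (x \<otimes> inv y) = f x - f y] (mod q)"
proof -
  have "[f (x \<otimes> inv y) = f x + f (inv y)] (mod q)"
    using assms(1,3) subgroup.m_inv_closed[OF assms(2,4)] unfolding additive_mod_def by simp
  also have "[f x + f (inv y) = f x + - f y] (mod q)"
    by (rule cong_add[OF cong_refl additive_mod_inv[OF assms(1,2,4)]])
  finally show ?thesis by simp
qed

end

context comm_group
begin

text \<open>
  An element \<open>a\<close> outside \<open>H\<close> with \<open>a\<^sup>p \<in> H\<close> can be given every value \<open>v\<close> for which \<open>p v\<close> is the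
  value at \<open>a\<^sup>p\<close>: the relation \<open>a\<^sup>p \<in> H\<close> generates all relations between \<open>a\<close> and \<open>H\<close>, since \<open>p\<close>
  is prime.
\<close>

lemma additive_mod_extend_step:
  assumes H: "subgroup H G" and psi: "additive_mod q G H psi"
    and a: "a \<in> carrier G" "a \<notin> H" and p: "prime p" and ap: "a [^] (p::nat) \<in> H"
    and v: "[int p * v = psi (a [^] p)] (mod q)"
  obtains H' psi' where "subgroup H' G" "insert a H \<subseteq> H'" "additive_mod q G H' psi'"
    "\<And>x. x \<in> H \<Longrightarrow> [psi' x = psi x] (mod q)" "[psi' a = v] (mod q)"
proof -
  \<comment> \<open>the exponent \<open>i\<close> is determined modulo \<open>p\<close> only; \<open>key\<close> says that its choice does not matter\<close>
  define H' where "H' = {x \<in> carrier G. \<exists>i::int. x \<otimes> a [^] i \<in> H}"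
  define psi' where "psi' x = (let i = (SOME i::int. x \<otimes> a [^] i \<in> H) in psi (x \<otimes> a [^] i) - i * v)" for x
  have pdvd: "int p dvd i" if "a [^] i \<in> H" for i :: int
  proof (rule ccontr)
    assume "\<not> int p dvd i"
    then have "coprime (int p) i" using p by (simp add: prime_imp_coprime)
    then obtain u w where uw: "u * int p + w * i = 1"
      using bezout_int[of "int p" i] by auto
    have "a = a [^] (u * int p + w * i)" using a uw by simp
    also have "\<dots> = (a [^] p) [^] u \<otimes> (a [^] i) [^] w"
      using a by (simp add: int_pow_mult int_pow_pow mult.commute flip: int_pow_int)
    also have "\<dots> \<in> H"
      by (intro subgroup.m_closed[OF H] subgroup_int_pow_closed[OF H] ap that)
    finally show False using a by simp
  qed
  have key: "[psi' x = psi (x \<otimes> a [^] i) - i * v] (mod q)"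
    if x: "x \<in> carrier G" and xi: "x \<otimes> a [^] i \<in> H" for x and i :: int
  proof -
    define j where "j = (SOME i::int. x \<otimes> a [^] i \<in> H)"
    have xj: "x \<otimes> a [^] j \<in> H" unfolding j_def using xi by (rule someI)
    have "a [^] (j - i) = (x \<otimes> a [^] j) \<otimes> inv (x \<otimes> a [^] i)"
      using a x by (simp add: int_pow_diff inv_mult m_ac) (simp add: m_assoc[symmetric])
    also have "\<dots> \<in> H" by (intro subgroup.m_closed[OF H] subgroup.m_inv_closed[OF H] xi xj)
    finally obtain t where t: "j - i = int p * t" using pdvd by (meson dvdE)
    have ji: "j = i + int p * t" using t by simp
    have eq: "x \<otimes> a [^] j = (x \<otimes> a [^] i) \<otimes> (a [^] p) [^] t"
      using a x unfolding ji by (simp add: int_pow_mult int_pow_pow m_assoc flip: int_pow_int)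
    have "[psi (x \<otimes> a [^] j) = psi (x \<otimes> a [^] i) + psi ((a [^] p) [^] t)] (mod q)"
      unfolding eq using psi xi subgroup_int_pow_closed[OF H ap] unfolding additive_mod_def by simp
    also have "[psi (x \<otimes> a [^] i) + psi ((a [^] p) [^] t) = psi (x \<otimes> a [^] i) + t * psi (a [^] p)] (mod q)"
      by (rule cong_add[OF cong_refl additive_mod_int_pow[OF psi H ap]])
    also have "[psi (x \<otimes> a [^] i) + t * psi (a [^] p) = psi (x \<otimes> a [^] i) + t * (int p * v)] (mod q)"
      by (rule cong_add[OF cong_refl cong_scalar_left[OF cong_sym[OF v]]])
    finally have "[psi (x \<otimes> a [^] j) - j * v = psi (x \<otimes> a [^] i) + t * (int p * v) - j * v] (mod q)"
      by (simp add: cong_diff)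
    then show ?thesis unfolding psi'_def Let_def j_def[symmetric]
      by (simp add: ji algebra_simps)
  qed
  have sub: "subgroup H' G"
  proof (rule subgroupI)
    show "H' \<subseteq> carrier G" unfolding H'_def by blast
    have "\<one> \<otimes> a [^] (0::int) \<in> H" using H subgroup.one_closed by simp
    then show "H' \<noteq> {}" unfolding H'_def using one_closed by blast
    fix x assume "x \<in> H'"
    then obtain i where x: "x \<in> carrier G" "x \<otimes> a [^] (i::int) \<in> H" unfolding H'_def by blast
    have "inv x \<otimes> a [^] (- i) = inv (x \<otimes> a [^] i)"
      using x a by (simp add: inv_mult int_pow_neg)
    then have "inv x \<otimes> a [^] (- i) \<in> H" using x H by (simp add: subgroup.m_inv_closed)
    then show "inv x \<in> H'" unfolding H'_def using x by blast
    fix y assume "y \<in> H'"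
    then obtain j where y: "y \<in> carrier G" "y \<otimes> a [^] (j::int) \<in> H" unfolding H'_def by blast
    have "(x \<otimes> y) \<otimes> a [^] (i + j) = (x \<otimes> a [^] i) \<otimes> (y \<otimes> a [^] j)"
      using x y a by (simp add: int_pow_mult m_ac)
    then have "(x \<otimes> y) \<otimes> a [^] (i + j) \<in> H" using x y H by (simp add: subgroup.m_closed)
    then show "x \<otimes> y \<in> H'" unfolding H'_def using x y by blast
  qed
  have add: "additive_mod q G H' psi'"
    unfolding additive_mod_def
  proof (intro ballI)
    fix x y assume "x \<in> H'" "y \<in> H'"
    then obtain i j where x: "x \<in> carrier G" "x \<otimes> a [^] (i::int) \<in> H"
      and y: "y \<in> carrier G" "y \<otimes> a [^] (j::int) \<in> H" unfolding H'_def by blast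
    have eq: "(x \<otimes> y) \<otimes> a [^] (i + j) = (x \<otimes> a [^] i) \<otimes> (y \<otimes> a [^] j)"
      using x y a by (simp add: int_pow_mult m_ac)
    then have xy: "(x \<otimes> y) \<otimes> a [^] (i + j) \<in> H" using x y H by (simp add: subgroup.m_closed)
    have "[psi' (x \<otimes> y) = psi ((x \<otimes> y) \<otimes> a [^] (i + j)) - (i + j) * v] (mod q)"
      using key[of "x \<otimes> y" "i + j"] x y xy by blast
    also have "[psi ((x \<otimes> y) \<otimes> a [^] (i + j)) - (i + j) * v
        = (psi (x \<otimes> a [^] i) + psi (y \<otimes> a [^] j)) - (i + j) * v] (mod q)"
      unfolding eq using psi x y unfolding additive_mod_def by (intro cong_diff cong_refl) simp
    also have "(psi (x \<otimes> a [^] i) + psi (y \<otimes> a [^] j)) - (i + j) * v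
        = (psi (x \<otimes> a [^] i) - i * v) + (psi (y \<otimes> a [^] j) - j * v)" by (simp add: algebra_simps)
    also have "[\<dots> = psi' x + psi' y] (mod q)"
      by (rule cong_sym[OF cong_add[OF key[OF x] key[OF y]]])
    finally show "[psi' (x \<otimes> y) = psi' x + psi' y] (mod q)" .
  qed
  have ext: "[psi' x = psi x] (mod q)" if "x \<in> H" for x
    using key[of x 0] that subgroup.mem_carrier[OF H that] by simp
  have "[psi' a = psi \<one> - (-1) * v] (mod q)"
    using key[of a "-1"] a H subgroup.one_closed[OF H] by (simp add: int_pow_neg)
  also have "[psi \<one> - (-1) * v = 0 - (-1) * v] (mod q)"
    by (rule cong_diff[OF additive_mod_one[OF psi H] cong_refl])
  finally have va: "[psi' a = v] (mod q)" by simp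
  have "insert a H \<subseteq> H'"
  proof -
    have "a \<otimes> a [^] (-1 :: int) \<in> H" using a H subgroup.one_closed[OF H] by (simp add: int_pow_neg)
    moreover have "x \<otimes> a [^] (0::int) \<in> H" if "x \<in> H" for x
      using that subgroup.mem_carrier[OF H that] by simp
    ultimately show ?thesis unfolding H'_def using a subgroup.mem_carrier[OF H] by blast
  qed
  then show thesis using that sub add ext va by blast
qed

text \<open>
  If \<open>H\<close> contains all \<open>p\<close>-th powers, the extension step applies to every element outside \<open>H\<close>, as
  long as a candidate for its value is available; the function \<open>chi\<close> provides the candidates.
\<close>

lemma additive_mod_extend:
  assumes fin: "finite (carrier G)" and p: "prime (p::nat)"
    and H: "subgroup H G" "\<And>x. x \<in> carrier G \<Longrightarrow> x [^] p \<in> H" and psi: "additive_mod q G H psi"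
    and chi: "\<And>x. x \<in> carrier G \<Longrightarrow> [int p * chi x = psi (x [^] p)] (mod q)"
  obtains psi' where "additive_mod q G (carrier G) psi'"
    "\<And>x. x \<in> H \<Longrightarrow> [psi' x = psi x] (mod q)"
proof -
  have "\<exists>psi'. additive_mod q G (carrier G) psi' \<and> (\<forall>x\<in>H. [psi' x = psi x] (mod q))"
    using H psi chi
  proof (induction "card (carrier G - H)" arbitrary: H psi rule: less_induct)
    case less
    show ?case
    proof (cases "H = carrier G")
      case True
      then show ?thesis using less.prems(3) cong_refl by blast
    next
      case False
      then obtain a where a: "a \<in> carrier G" "a \<notin> H"
        using subgroup.subset[OF less.prems(1)] by blast
      obtain H' psi' where H': "subgroup H' G" "insert a H \<subseteq> H'" "additive_mod q G H' psi'"
        and ext: "\<And>x. x \<in> H \<Longrightarrow> [psi' x = psi x] (mod q)"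
        using additive_mod_extend_step[OF less.prems(1,3) a p less.prems(2)[OF a(1)] less.prems(4)[OF a(1)]]
        by metis
      have lt: "card (carrier G - H') < card (carrier G - H)"
        using a H'(2) fin by (intro psubset_card_mono) auto
      have "\<exists>psi''. additive_mod q G (carrier G) psi'' \<and> (\<forall>x\<in>H'. [psi'' x = psi' x] (mod q))"
      proof (rule less.hyps[OF lt H'(1) _ H'(3)])
        show "x [^] p \<in> H'" if "x \<in> carrier G" for x using less.prems(2)[OF that] H'(2) by blast
        show "[int p * chi x = psi' (x [^] p)] (mod q)" if "x \<in> carrier G" for x
          using less.prems(4)[OF that] ext[OF less.prems(2)[OF that]] by (rule cong_trans[OF _ cong_sym])
      qed
      then obtain psi'' where psi'': "additive_mod q G (carrier G) psi''"
        "\<And>x. x \<in> H' \<Longrightarrow> [psi'' x = psi' x] (mod q)" by blast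
      have "[psi'' x = psi x] (mod q)" if "x \<in> H" for x
        using cong_trans[OF psi''(2) ext[OF that]] H'(2) that by blast
      then show ?thesis using psi''(1) by blast
    qed
  qed
  then show thesis using that by blast
qed

lemma subgroup_pow_image: "subgroup ((\<lambda>x. x [^] (n::nat)) ` carrier G) G"
proof (rule subgroupI)
  fix a assume "a \<in> (\<lambda>x. x [^] n) ` carrier G"
  then obtain x where x: "x \<in> carrier G" "a = x [^] n" by blast
  then have "inv a = (inv x) [^] n" by (simp add: nat_pow_inv)
  then show "inv a \<in> (\<lambda>x. x [^] n) ` carrier G" using x by blast
  fix b assume "b \<in> (\<lambda>x. x [^] n) ` carrier G"
  then obtain y where y: "y \<in> carrier G" "b = y [^] n" by blast
  then have "a \<otimes> b = (x \<otimes> y) [^] n" using x by (simp add: nat_pow_distrib)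
  then show "a \<otimes> b \<in> (\<lambda>x. x [^] n) ` carrier G" using x y by blast
qed auto

text \<open>
  A homomorphism to \<open>\<int>/p\<^sup>k\<close> which vanishes on the \<open>p\<close>-torsion lifts to \<open>\<int>/p\<^bsup>k+1\<^esup>\<close>: the lift is forced
  on \<open>p\<close>-th powers to be \<open>x\<^sup>p \<mapsto> p chi(x)\<close>, which is well defined by the condition on the torsion, and
  any extension to the whole group is a lift, because multiplication by \<open>p\<close> maps \<open>\<int>/p\<^sup>k\<close> injectively
  to \<open>\<int>/p\<^bsup>k+1\<^esup>\<close>.
\<close>

lemma additive_mod_lift:
  assumes fin: "finite (carrier G)" and p: "prime (p::nat)"
    and chi: "additive_mod (int p ^ k) G (carrier G) chi"
    and tors: "\<And>x. \<lbrakk>x \<in> carrier G; x [^] p = \<one>\<rbrakk> \<Longrightarrow> int p ^ k dvd chi x"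
  obtains psi where "additive_mod (int p ^ Suc k) G (carrier G) psi"
    "\<And>x. x \<in> carrier G \<Longrightarrow> [psi x = chi x] (mod int p ^ k)"
proof -
  have p0: "int p \<noteq> 0" using p by auto
  define H where "H = (\<lambda>x. x [^] p) ` carrier G"
  have H: "subgroup H G" unfolding H_def by (rule subgroup_pow_image)
  have pw: "x [^] p \<in> H" if "x \<in> carrier G" for x using that unfolding H_def by blast
  define psi0 where "psi0 y = int p * chi (SOME x. x \<in> carrier G \<and> x [^] p = y)" for y
  have scale: "[int p * i = int p * j] (mod int p ^ Suc k) \<longleftrightarrow> [i = j] (mod int p ^ k)" for i j
  proof -
    have "int p * i - int p * j = int p * (i - j)" by (simp add: algebra_simps)
    then show ?thesis using p0 by (simp add: cong_iff_dvd_diff)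
  qed
  have psi0: "[psi0 (x [^] p) = int p * chi x] (mod int p ^ Suc k)" if x: "x \<in> carrier G" for x
  proof -
    define y where "y = (SOME y. y \<in> carrier G \<and> y [^] p = x [^] p)"
    have y: "y \<in> carrier G" "y [^] p = x [^] p"
      using someI[of "\<lambda>y. y \<in> carrier G \<and> y [^] p = x [^] p" x] x unfolding y_def by auto
    have "(y \<otimes> inv x) [^] p = \<one>" using x y by (simp add: nat_pow_distrib nat_pow_inv)
    then have "int p ^ k dvd chi (y \<otimes> inv x)" using tors[of "y \<otimes> inv x"] x y by simp
    then have "[chi (y \<otimes> inv x) = 0] (mod int p ^ k)" by (simp add: cong_0_iff)
    moreover have "[chi (y \<otimes> inv x) = chi y - chi x] (mod int p ^ k)"
      using additive_mod_diff[OF chi subgroup_self y(1) x] .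
    ultimately have "[chi y - chi x = 0] (mod int p ^ k)"
      by (rule cong_trans[OF cong_sym, rotated])
    then have "[chi y = chi x] (mod int p ^ k)" by (simp add: cong_diff_iff_cong_0)
    then show ?thesis unfolding psi0_def y_def[symmetric] using scale by blast
  qed
  have "additive_mod (int p ^ Suc k) G H psi0"
    unfolding additive_mod_def
  proof (intro ballI)
    fix a b assume "a \<in> H" "b \<in> H"
    then obtain x y where x: "x \<in> carrier G" "a = x [^] p" and y: "y \<in> carrier G" "b = y [^] p"
      unfolding H_def by blast
    have "a \<otimes> b = (x \<otimes> y) [^] p" using x y by (simp add: nat_pow_distrib)
    then have "[psi0 (a \<otimes> b) = int p * chi (x \<otimes> y)] (mod int p ^ Suc k)"
      using psi0[of "x \<otimes> y"] x y by simp
    also have "[int p * chi (x \<otimes> y) = int p * (chi x + chi y)] (mod int p ^ Suc k)"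
      using chi x y scale unfolding additive_mod_def by blast
    also have "int p * (chi x + chi y) = int p * chi x + int p * chi y" by (simp add: algebra_simps)
    also have "[\<dots> = psi0 a + psi0 b] (mod int p ^ Suc k)"
      unfolding x(2) y(2) by (rule cong_sym[OF cong_add[OF psi0[OF x(1)] psi0[OF y(1)]]])
    finally show "[psi0 (a \<otimes> b) = psi0 a + psi0 b] (mod int p ^ Suc k)" .
  qed
  then obtain psi where psi: "additive_mod (int p ^ Suc k) G (carrier G) psi"
    and ext: "\<And>x. x \<in> H \<Longrightarrow> [psi x = psi0 x] (mod int p ^ Suc k)"
    using additive_mod_extend[OF fin p H pw, of "int p ^ Suc k" psi0 chi] cong_sym[OF psi0]
    by metis
  have "[psi x = chi x] (mod int p ^ k)" if x: "x \<in> carrier G" for x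
  proof -
    have "[int p * psi x = psi (x [^] p)] (mod int p ^ Suc k)"
      by (rule cong_sym[OF additive_mod_nat_pow[OF psi subgroup_self x]])
    also have "[psi (x [^] p) = psi0 (x [^] p)] (mod int p ^ Suc k)" using ext x H_def by blast
    also have "[psi0 (x [^] p) = int p * chi x] (mod int p ^ Suc k)" by (rule psi0[OF x])
    finally show ?thesis using scale by blast
  qed
  then show thesis using that psi by blast
qed

text \<open>
  The zero function on the \<open>p\<close>-th powers is first extended by the value \<open>1\<close> at \<open>z\<close>.
\<close>

lemma additive_mod_separate:
  assumes fin: "finite (carrier G)" and p: "prime (p::nat)"
    and z: "z \<in> carrier G" "\<And>x. x \<in> carrier G \<Longrightarrow> x [^] p \<noteq> z"
  obtains psi where "additive_mod (int p) G (carrier G) psi" "\<not> int p dvd psi z"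
proof -
  define H where "H = (\<lambda>x. x [^] p) ` carrier G"
  have H: "subgroup H G" unfolding H_def by (rule subgroup_pow_image)
  have "z \<notin> H" using z unfolding H_def by blast
  moreover have "z [^] p \<in> H" unfolding H_def using z by blast
  moreover have "additive_mod (int p) G H (\<lambda>_. 0)" by (simp add: additive_mod_def)
  moreover have "[int p * 1 = 0] (mod int p)" by (simp add: cong_0_iff)
  ultimately obtain H' psi' where H': "subgroup H' G" "insert z H \<subseteq> H'" "additive_mod (int p) G H' psi'"
    and ext: "\<And>x. x \<in> H \<Longrightarrow> [psi' x = 0] (mod int p)" and one: "[psi' z = 1] (mod int p)"
    using additive_mod_extend_step[OF H, of "int p" "\<lambda>_. 0" z p 1] z p by metis
  have pw: "x [^] p \<in> H'" "[int p * 0 = psi' (x [^] p)] (mod int p)" if "x \<in> carrier G" for x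
    using that H'(2) ext[of "x [^] p"] unfolding H_def by (auto intro: cong_sym)
  obtain psi where psi: "additive_mod (int p) G (carrier G) psi"
    "\<And>x. x \<in> H' \<Longrightarrow> [psi x = psi' x] (mod int p)"
    using additive_mod_extend[OF fin p H'(1) pw(1) H'(3) pw(2)] by metis
  have "[psi z = 1] (mod int p)" using cong_trans[OF psi(2) one] H'(2) by blast
  then have "\<not> int p dvd psi z"
    using prime_gt_1_nat[OF p] by (simp add: cong_dvd_iff)
  then show thesis using that psi by blast
qed

end

section \<open>Compact and profinite groups\<close>

lemma (in group) inv_mult_cancel_left [simp]:
  assumes "x \<in> carrier G" "y \<in> carrier G"
  shows "inv x \<otimes> (x \<otimes> y) = y" "x \<otimes> (inv x \<otimes> y) = y"
  using assms by (simp_all flip: m_assoc)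

lemma directed_closed_Inter_nonempty:
  assumes "compact_space X" "\<F> \<noteq> {}"
    and closed: "\<And>C. C \<in> \<F> \<Longrightarrow> closedin X C" and ne: "\<And>C. C \<in> \<F> \<Longrightarrow> C \<noteq> {}"
    and dir: "\<And>A B. \<lbrakk>A \<in> \<F>; B \<in> \<F>\<rbrakk> \<Longrightarrow> \<exists>C\<in>\<F>. C \<subseteq> A \<inter> B"
  shows "\<Inter>\<F> \<noteq> {}"
proof -
  have "\<exists>C\<in>\<F>. C \<subseteq> \<Inter>\<G>" if "finite \<G>" "\<G> \<subseteq> \<F>" for \<G>
    using that
  proof (induction rule: finite_induct)
    case empty
    then show ?case using assms(2) by auto
  next
    case (insert A \<G>)
    then obtain C where "C \<in> \<F>" "C \<subseteq> \<Inter>\<G>" by auto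
    then obtain B where "B \<in> \<F>" "B \<subseteq> A \<inter> C" using dir[of A C] insert.prems by auto
    then show ?case using \<open>C \<subseteq> \<Inter>\<G>\<close> by blast
  qed
  then have "\<Inter>\<G> \<noteq> {}" if "finite \<G>" "\<G> \<subseteq> \<F>" for \<G>
    using that ne by (metis subset_empty)
  moreover have "(\<forall>C\<in>\<F>. closedin X C) \<and> (\<forall>\<G>. finite \<G> \<and> \<G> \<subseteq> \<F> \<longrightarrow> \<Inter>\<G> \<noteq> {}) \<longrightarrow> \<Inter>\<F> \<noteq> {}"
    using assms(1) unfolding compact_space_fip by (rule spec)
  ultimately show ?thesis using closed by simp
qed

text \<open>
  The complement is the projection of a closed set along the compact factor.
\<close>

lemma openin_Collect_ball_closed:
  assumes "compact_space X" and f: "continuous_map (prod_topology X Y) Z (\<lambda>(x, y). f x y)"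
    and C: "closedin X C" and U: "openin Z U"
  shows "openin Y {y \<in> topspace Y. \<forall>c\<in>C. f c y \<in> U}"
proof -
  define B where "B = {p \<in> topspace (prod_topology X Y). (\<lambda>(x, y). f x y) p \<in> topspace Z - U}
    \<inter> (C \<times> topspace Y)"
  have "closedin (prod_topology X Y) B"
    unfolding B_def
    by (intro closedin_Int closedin_continuous_map_preimage[OF f])
      (auto simp: closedin_prod_Times_iff C U)
  then have "closedin Y (snd ` B)"
    using closed_map_snd[OF assms(1), of Y] by (simp add: closed_map_def)
  then have "openin Y (topspace Y - snd ` B)" by blast
  moreover have "topspace Y - snd ` B = {y \<in> topspace Y. \<forall>c\<in>C. f c y \<in> U}"
  proof -
    have fZ: "f c y \<in> topspace Z" if "c \<in> C" "y \<in> topspace Y" for c y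
    proof -
      have "(c, y) \<in> topspace (prod_topology X Y)" using that closedin_subset[OF C] by auto
      from continuous_map_funspace[OF f, THEN funcset_mem, OF this] show ?thesis by simp
    qed
    have "snd ` B = {y \<in> topspace Y. \<exists>c\<in>C. f c y \<notin> U}"
    proof (intro equalityI subsetI)
      fix y assume "y \<in> snd ` B"
      then show "y \<in> {y \<in> topspace Y. \<exists>c\<in>C. f c y \<notin> U}" unfolding B_def by auto
    next
      fix y assume "y \<in> {y \<in> topspace Y. \<exists>c\<in>C. f c y \<notin> U}"
      then obtain c where "c \<in> C" "y \<in> topspace Y" "f c y \<notin> U" by blast
      then have "(c, y) \<in> B" using closedin_subset[OF C] fZ unfolding B_def by auto
      then show "y \<in> snd ` B" by force
    qed
    then show ?thesis by blast
  qed
  ultimately show ?thesis by simp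
qed

context topological_group
begin

lemma continuous_map_mult [continuous_intros]:
  assumes "continuous_map X T f" "continuous_map X T g"
  shows "continuous_map X T (\<lambda>x. f x \<otimes> g x)"
proof -
  have "continuous_map X (prod_topology T T) (\<lambda>x. (f x, g x))"
    using assms by (simp add: continuous_map_pairedI)
  from continuous_map_compose[OF this continuous_mult] show ?thesis by (simp add: o_def)
qed

lemma continuous_map_inverse [continuous_intros]:
  assumes "continuous_map X T f"
  shows "continuous_map X T (\<lambda>x. inv (f x))"
  using continuous_map_compose[OF assms continuous_inv] by (simp add: o_def)

lemma continuous_map_nat_pow [continuous_intros]:
  assumes "continuous_map X T f"
  shows "continuous_map X T (\<lambda>x. f x [^] (n::nat))"
proof (induction n)
  case 0
  then show ?case by (simp add: topspace_eq)
next
  case (Suc n)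
  then show ?case using continuous_map_mult[OF Suc assms] by simp
qed

lemma continuous_map_const_carrier [continuous_intros]:
  "a \<in> carrier G \<Longrightarrow> continuous_map X T (\<lambda>x. a)"
  by (simp add: topspace_eq)

lemma continuous_map_self [continuous_intros]: "continuous_map T T (\<lambda>x. x)"
  using continuous_map_id[of T] by (simp add: id_def)

lemma openin_preimage:
  assumes "continuous_map T T f" "openin T U"
  shows "openin T {x \<in> carrier G. f x \<in> U}"
  using openin_continuous_map_preimage[OF assms] by (simp add: topspace_eq)

lemma closedin_preimage:
  assumes "continuous_map T T f" "closedin T U"
  shows "closedin T {x \<in> carrier G. f x \<in> U}"
  using closedin_continuous_map_preimage[OF assms] by (simp add: topspace_eq)

lemma openin_subgroup_if_openin:
  assumes H: "subgroup H G" and U: "openin T U" "\<one> \<in> U" "U \<subseteq> H"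
  shows "openin T H"
proof (subst openin_subopen, intro ballI)
  fix h assume h: "h \<in> H"
  have hc: "h \<in> carrier G" by (rule subgroup.mem_carrier[OF H h])
  let ?V = "{x \<in> carrier G. x \<otimes> inv h \<in> U}"
  have "openin T ?V"
    using hc by (intro openin_preimage U continuous_intros) auto
  moreover have "h \<in> ?V" using hc U by simp
  moreover have "?V \<subseteq> H"
  proof
    fix x assume x: "x \<in> ?V"
    then have "(x \<otimes> inv h) \<otimes> h \<in> H" using U h by (auto intro!: subgroup.m_closed[OF H, of "x \<otimes> inv h"])
    then show "x \<in> H" using x hc by (simp add: m_assoc)
  qed
  ultimately show "\<exists>V. openin T V \<and> h \<in> V \<and> V \<subseteq> H" by blast
qed

lemma closedin_open_subgroup:
  assumes H: "subgroup H G" and "openin T H"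
  shows "closedin T H"
proof -
  have "openin T (carrier G - H)"
  proof (subst openin_subopen, intro ballI)
    fix x assume x: "x \<in> carrier G - H"
    let ?V = "{y \<in> carrier G. y \<otimes> inv x \<in> H}"
    have "openin T ?V" using x by (intro openin_preimage assms continuous_intros) auto
    moreover have "x \<in> ?V" using x subgroup.one_closed[OF H] by simp
    moreover have "y \<notin> H" if y: "y \<in> ?V" for y
    proof
      assume "y \<in> H"
      then have "inv (y \<otimes> inv x) \<otimes> y \<in> H"
        using y \<open>y \<in> H\<close> by (auto intro!: subgroup.m_closed[OF H, of "inv (y \<otimes> inv x)"] subgroup.m_inv_closed[OF H, of "y \<otimes> inv x"])
      then show False using x y by (simp add: inv_mult_group m_assoc)
    qed
    ultimately show "\<exists>V. openin T V \<and> x \<in> V \<and> V \<subseteq> carrier G - H" by blast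
  qed
  then show ?thesis
    using subgroup.subset[OF H] by (simp add: closedin_def topspace_eq)
qed

lemma closure_of_subgroup:
  assumes H: "subgroup H G"
  shows "subgroup (T closure_of H) G"
proof -
  have sub: "H \<subseteq> T closure_of H"
    using closure_of_subset[of H T] subgroup.subset[OF H] by (simp add: topspace_eq)
  show ?thesis
  proof (rule subgroupI)
    show "T closure_of H \<subseteq> carrier G"
      using closure_of_subset_topspace[of T H] by (simp add: topspace_eq)
    show "T closure_of H \<noteq> {}" using sub subgroup.one_closed[OF H] by blast
    fix x assume x: "x \<in> T closure_of H"
    have "(\<lambda>x. inv x) ` (T closure_of H) \<subseteq> T closure_of ((\<lambda>x. inv x) ` H)"
      by (rule continuous_map_image_closure_subset[OF continuous_inv])
    moreover have "(\<lambda>x. inv x) ` H \<subseteq> H" using subgroup.m_inv_closed[OF H] by blast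
    ultimately show "inv x \<in> T closure_of H"
      using x closure_of_mono[of "(\<lambda>x. inv x) ` H" H T] by blast
    fix y assume y: "y \<in> T closure_of H"
    have "(\<lambda>(x, y). x \<otimes> y) ` (prod_topology T T closure_of (H \<times> H))
        \<subseteq> T closure_of ((\<lambda>(x, y). x \<otimes> y) ` (H \<times> H))"
      by (rule continuous_map_image_closure_subset[OF continuous_mult])
    moreover have "(\<lambda>(x, y). x \<otimes> y) ` (H \<times> H) \<subseteq> H" using subgroup.m_closed[OF H] by auto
    moreover have "(x, y) \<in> prod_topology T T closure_of (H \<times> H)"
      using x y by (simp add: closure_of_Times)
    ultimately show "x \<otimes> y \<in> T closure_of H"
      using closure_of_mono[of "(\<lambda>(x, y). x \<otimes> y) ` (H \<times> H)" H T] by force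
  qed
qed

definition topgen :: "'a set \<Rightarrow> 'a set" where
  "topgen S = T closure_of (generate G S)"

lemma closedin_topgen: "closedin T (topgen S)"
  by (simp add: topgen_def)

lemma subgroup_topgen: "S \<subseteq> carrier G \<Longrightarrow> subgroup (topgen S) G"
  unfolding topgen_def by (intro closure_of_subgroup generate_is_subgroup)

lemma topgen_incl: assumes "S \<subseteq> carrier G" shows "S \<subseteq> topgen S"
proof -
  have "S \<subseteq> generate G S" by (auto intro: generate.incl)
  also have "\<dots> \<subseteq> topgen S"
    unfolding topgen_def using generate_incl[OF assms] by (intro closure_of_subset) (simp add: topspace_eq)
  finally show ?thesis .
qed

lemma topgen_minimal:
  assumes "S \<subseteq> C" "subgroup C G" "closedin T C"
  shows "topgen S \<subseteq> C"
  unfolding topgen_def using generate_subgroup_incl[OF assms(1,2)] assms(3) by (rule closure_of_minimal)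

lemma topgen_mono: "S \<subseteq> S' \<Longrightarrow> topgen S \<subseteq> topgen S'"
  unfolding topgen_def by (intro closure_of_mono mono_generate)

lemma topgen_Un_topgen:
  assumes "A \<subseteq> carrier G" "B \<subseteq> carrier G"
  shows "topgen (topgen A \<union> B) = topgen (A \<union> B)"
proof
  have AB: "A \<union> B \<subseteq> carrier G" using assms by blast
  have "topgen A \<union> B \<subseteq> topgen (A \<union> B)"
    using topgen_mono[of A "A \<union> B"] topgen_incl[OF AB] by blast
  then show "topgen (topgen A \<union> B) \<subseteq> topgen (A \<union> B)"
    by (rule topgen_minimal[OF _ subgroup_topgen[OF AB] closedin_topgen])
  show "topgen (A \<union> B) \<subseteq> topgen (topgen A \<union> B)"
    by (rule topgen_mono) (use topgen_incl[OF assms(1)] in blast)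
qed

end

locale compact_group = topological_group +
  assumes compact: "compact_space T" and Hausdorff: "Hausdorff_space T"
begin

lemma closedin_one: "closedin T {\<one>}"
  using Hausdorff by (simp add: closedin_Hausdorff_singleton topspace_eq)

lemma closedin_set_mult:
  assumes "closedin T A" "closedin T B"
  shows "closedin T (A <#> B)"
proof -
  have "compactin (prod_topology T T) (A \<times> B)"
    using assms closedin_compact_space[OF compact] by (simp add: compactin_Times)
  then have "compactin T ((\<lambda>(x, y). x \<otimes> y) ` (A \<times> B))"
    by (rule image_compactin[OF _ continuous_mult])
  moreover have "(\<lambda>(x, y). x \<otimes> y) ` (A \<times> B) = A <#> B"
    unfolding set_mult_def by auto
  ultimately show ?thesis using compactin_imp_closedin[OF Hausdorff] by metis
qed

lemma closedin_image:
  assumes "continuous_map T T f" "closedin T A"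
  shows "closedin T (f ` A)"
  by (rule compactin_imp_closedin[OF Hausdorff image_compactin[OF closedin_compact_space[OF compact assms(2)] assms(1)]])

lemma finite_rcosets_open:
  assumes H: "subgroup H G" and "openin T H"
  shows "finite (rcosets H)"
proof -
  have op: "openin T C" if C: "C \<in> rcosets H" for C
  proof -
    obtain a where a: "a \<in> carrier G" "C = H #> a" using C unfolding RCOSETS_def by blast
    have "C = {x \<in> carrier G. x \<otimes> inv a \<in> H}"
      using subgroup.rcos_module[OF H is_group a(1)] a r_coset_subset_G[OF subgroup.subset[OF H] a(1)] by blast
    then show ?thesis
      using a by simp (intro openin_preimage assms continuous_intros, auto)
  qed
  have "topspace T \<subseteq> \<Union>(rcosets H)" using rcosets_part_G[OF H] by (simp add: topspace_eq)
  then obtain \<F> where \<F>: "finite \<F>" "\<F> \<subseteq> rcosets H" "topspace T \<subseteq> \<Union>\<F>"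
    using compactinD[of T "topspace T" "rcosets H"] compact op unfolding compact_space_def by blast
  have "rcosets H \<subseteq> \<F>"
  proof
    fix C assume C: "C \<in> rcosets H"
    then obtain a where a: "a \<in> carrier G" "C = H #> a" unfolding RCOSETS_def by blast
    then have "a \<in> C" using rcos_self[OF a(1) H] by simp
    moreover obtain D where D: "D \<in> \<F>" "a \<in> D" using \<F>(3) a(1) topspace_eq by auto
    ultimately have "C = D"
      using rcos_disjoint[OF H] C \<F>(2) unfolding pairwise_def disjnt_def by blast
    then show "C \<in> \<F>" using D by simp
  qed
  then show ?thesis using \<F>(1) finite_subset by blast
qed

text \<open>
  By compactness, a point that lies in the product of \<open>A\<close> with each member of a directed family of
  closed sets has factorizations whose first factors accumulate; a limit factorization has its second factor
  in the intersection.
\<close>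

lemma mem_set_mult_Inter:
  assumes A: "closedin T A" and "\<U> \<noteq> {}" and closed: "\<And>U. U \<in> \<U> \<Longrightarrow> closedin T U"
    and dir: "\<And>U V. \<lbrakk>U \<in> \<U>; V \<in> \<U>\<rbrakk> \<Longrightarrow> \<exists>W\<in>\<U>. W \<subseteq> U \<inter> V"
    and x: "\<And>U. U \<in> \<U> \<Longrightarrow> x \<in> A <#> U"
  shows "x \<in> A <#> \<Inter>\<U>"
proof -
  have Ac: "A \<subseteq> carrier G" using closedin_subset[OF A] by (simp add: topspace_eq)
  have Uc: "U \<subseteq> carrier G" if "U \<in> \<U>" for U using closedin_subset[OF closed[OF that]] by (simp add: topspace_eq)
  obtain U0 where U0: "U0 \<in> \<U>" using assms(2) by blast
  have xc: "x \<in> carrier G" using x[OF U0] Ac Uc[OF U0] unfolding set_mult_def by auto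
  define F where "F U = A \<inter> {a \<in> carrier G. inv a \<otimes> x \<in> U}" for U
  have "\<Inter>(F ` \<U>) \<noteq> {}"
  proof (rule directed_closed_Inter_nonempty[OF compact])
    show "F ` \<U> \<noteq> {}" using assms(2) by blast
    show "closedin T C" if "C \<in> F ` \<U>" for C
      using that xc A closed unfolding F_def by (auto intro!: closedin_Int closedin_preimage continuous_intros)
    show "C \<noteq> {}" if C: "C \<in> F ` \<U>" for C
    proof -
      obtain U where U: "U \<in> \<U>" "C = F U" using C by blast
      obtain a u where au: "a \<in> A" "u \<in> U" "x = a \<otimes> u" using x[OF U(1)] unfolding set_mult_def by auto
      have "inv a \<otimes> x = u" using au Ac Uc[OF U(1)] by (simp add: subset_iff m_assoc[symmetric])
      then show ?thesis using U(2) au Ac unfolding F_def by blast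
    qed
    show "\<exists>C\<in>F ` \<U>. C \<subseteq> B \<inter> D" if BD: "B \<in> F ` \<U>" "D \<in> F ` \<U>" for B D
    proof -
      obtain U V where "U \<in> \<U>" "V \<in> \<U>" "B = F U" "D = F V" using BD by blast
      moreover from this obtain W where "W \<in> \<U>" "W \<subseteq> U \<inter> V" using dir by blast
      ultimately show ?thesis unfolding F_def by (intro bexI[of _ "F W"]) (auto simp: F_def)
    qed
  qed
  then obtain a where a: "\<And>U. U \<in> \<U> \<Longrightarrow> a \<in> F U" by blast
  have "a \<in> A" "a \<in> carrier G" using a[OF U0] unfolding F_def by auto
  moreover have "inv a \<otimes> x \<in> \<Inter>\<U>" using a unfolding F_def by blast
  moreover have "x = a \<otimes> (inv a \<otimes> x)" using \<open>a \<in> carrier G\<close> xc by (simp add: m_assoc[symmetric])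
  ultimately show ?thesis unfolding set_mult_def by blast
qed

end

text \<open>
  The working definition of profinite groups. It is equivalent to total disconnectedness
  (\<open>profinite_groupD\<close> and \<open>profinite_groupI\<close>).
\<close>

locale profinite = compact_group +
  assumes open_normal_basis:
    "\<lbrakk>openin T U; \<one> \<in> U\<rbrakk> \<Longrightarrow> \<exists>N. N \<lhd> G \<and> openin T N \<and> N \<subseteq> U"

text \<open>
  The set \<open>S\<close> of all \<open>x\<close> with \<open>C x \<subseteq> C\<close> is open because \<open>C\<close> is compact, and it is contained in \<open>C\<close>
  because \<open>C\<close> contains the identity. The largest subgroup \<open>H\<close> in \<open>S\<close> is therefore open, and its normal core
  is open because the group is compact.
\<close>

lemma (in compact_group) open_normal_in_clopen:
  assumes C: "closedin T C" "openin T C" "\<one> \<in> C"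
  obtains N where "N \<lhd> G" "openin T N" "N \<subseteq> C"
proof -
  have Cc: "C \<subseteq> carrier G" using closedin_subset[OF C(1)] by (simp add: topspace_eq)
  define S where "S = {x \<in> carrier G. \<forall>c\<in>C. c \<otimes> x \<in> C}"
  define H where "H = S \<inter> {x \<in> carrier G. inv x \<in> S}"
  define N where "N = {x \<in> carrier G. \<forall>g\<in>carrier G. g \<otimes> x \<otimes> inv g \<in> H}"
  have S: "openin T S"
    unfolding S_def using openin_Collect_ball_closed[OF compact continuous_mult C(1,2)]
    by (simp add: topspace_eq)
  have oH: "openin T H"
    unfolding H_def by (intro openin_Int S openin_preimage continuous_intros)
  have Sm: "x \<otimes> y \<in> S" if "x \<in> S" "y \<in> S" for x y
    using that Cc unfolding S_def by (auto simp: m_assoc[symmetric] subset_iff)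
  have "\<one> \<in> S" unfolding S_def using Cc by (auto simp: subset_iff)
  have H: "subgroup H G"
  proof (rule subgroupI)
    show "H \<subseteq> carrier G" unfolding H_def by blast
    show "H \<noteq> {}" unfolding H_def using \<open>\<one> \<in> S\<close> by force
    fix x assume x: "x \<in> H"
    then show "inv x \<in> H" unfolding H_def by auto
    fix y assume y: "y \<in> H"
    then show "x \<otimes> y \<in> H" using x Sm unfolding H_def by (simp add: inv_mult_group)
  qed
  have "continuous_map (prod_topology T T) T (\<lambda>p. fst p \<otimes> snd p \<otimes> inv (fst p))"
    by (intro continuous_intros)
  then have "continuous_map (prod_topology T T) T (\<lambda>(g, x). g \<otimes> x \<otimes> inv g)"
    by (simp add: case_prod_unfold)
  from openin_Collect_ball_closed[OF compact this _ oH, of "carrier G"]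
  have oN: "openin T N" unfolding N_def topspace_eq
    by (metis closedin_topspace topspace_eq)
  have N: "N \<lhd> G"
  proof (rule normal_invI[OF subgroupI])
    show "N \<subseteq> carrier G" unfolding N_def by blast
    show "N \<noteq> {}" unfolding N_def using subgroup.one_closed[OF H] by force
    fix x assume x: "x \<in> N"
    have xc: "x \<in> carrier G" using x unfolding N_def by blast
    have "g \<otimes> inv x \<otimes> inv g \<in> H" if g: "g \<in> carrier G" for g
    proof -
      have "inv (g \<otimes> x \<otimes> inv g) \<in> H"
        using x g unfolding N_def by (intro subgroup.m_inv_closed[OF H]) auto
      then show ?thesis using g xc by (simp add: inv_mult_group m_assoc)
    qed
    then show "inv x \<in> N" unfolding N_def using xc by simp
    fix y assume y: "y \<in> N"
    have yc: "y \<in> carrier G" using y unfolding N_def by blast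
    have "g \<otimes> (x \<otimes> y) \<otimes> inv g \<in> H" if g: "g \<in> carrier G" for g
    proof -
      have "(g \<otimes> x \<otimes> inv g) \<otimes> (g \<otimes> y \<otimes> inv g) \<in> H"
        using x y g unfolding N_def by (intro subgroup.m_closed[OF H, of "g \<otimes> x \<otimes> inv g"]) auto
      then show ?thesis using g xc yc by (simp add: m_assoc)
    qed
    then show "x \<otimes> y \<in> N" unfolding N_def using xc yc by simp
  next
    fix g x assume g: "g \<in> carrier G" and x: "x \<in> N"
    have xc: "x \<in> carrier G" using x unfolding N_def by blast
    have "h \<otimes> (g \<otimes> x \<otimes> inv g) \<otimes> inv h \<in> H" if h: "h \<in> carrier G" for h
    proof -
      have "(h \<otimes> g) \<otimes> x \<otimes> inv (h \<otimes> g) \<in> H" using x g h unfolding N_def by simp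
      then show ?thesis using g h xc by (simp add: inv_mult_group m_assoc)
    qed
    then show "g \<otimes> x \<otimes> inv g \<in> N" unfolding N_def using g xc by simp
  qed
  have "x \<in> C" if "x \<in> N" for x
  proof -
    have xc: "x \<in> carrier G" using that unfolding N_def by blast
    have "\<one> \<otimes> x \<otimes> inv \<one> \<in> H" using that unfolding N_def by blast
    then have "x \<in> S" using xc unfolding H_def by simp
    then show "x \<in> C" using C(3) xc unfolding S_def by force
  qed
  then show thesis using that N oN by blast
qed

text \<open>
  In compact Hausdorff spaces components are intersections of clopen sets, so total disconnectedness
  gives clopen neighbourhoods inside every neighbourhood of the identity.
\<close>

lemma profinite_groupD:
  fixes G (structure)
  assumes "profinite_group G T"
  shows "profinite G T"
proof -
  interpret topological_group G T using assms unfolding profinite_group_def by blast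
  interpret compact_group G T
    by unfold_locales (use assms in \<open>auto simp: profinite_group_def\<close>)
  show ?thesis
  proof
    fix U assume U: "openin T U" "\<one> \<in> U"
    have "quasi_component_of_set T \<one> = connected_component_of_set T \<one>"
      using quasi_eq_connected_component_of[of T \<one>] compact Hausdorff by auto
    then have "quasi_component_of_set T \<one> = {\<one>}"
      using assms unfolding profinite_group_def by (simp add: topspace_eq)
    then have "{\<one>} \<in> quasi_components_of T"
      unfolding quasi_components_of_def by (metis imageI one_closed topspace_eq)
    moreover have "compactin T (topspace T - U)"
      using U by (intro closedin_compact_space[OF compact]) blast
    ultimately have "separated_between T {\<one>} (topspace T - U)"
      using separated_between_quasi_component_compact U(2) by fastforce
    then obtain C where C: "closedin T C" "openin T C" "{\<one>} \<subseteq> C" "topspace T - U \<subseteq> topspace T - C"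
      unfolding separated_between by blast
    then obtain N where "N \<lhd> G" "openin T N" "N \<subseteq> C"
      using open_normal_in_clopen[of C] by blast
    moreover have "C \<subseteq> U" using C(4) closedin_subset[OF C(1)] by blast
    ultimately show "\<exists>N. N \<lhd> G \<and> openin T N \<and> N \<subseteq> U" by blast
  qed
qed

text \<open>
  Conversely, open subgroups are clopen, so their cosets separate components.
\<close>

lemma (in compact_group) profinite_groupI:
  assumes sep: "\<And>x. \<lbrakk>x \<in> carrier G; x \<noteq> \<one>\<rbrakk> \<Longrightarrow> \<exists>H. subgroup H G \<and> openin T H \<and> x \<notin> H"
  shows "profinite_group G T"
  unfolding profinite_group_def
proof (intro conjI ballI)
  show "topological_group G T" by unfold_locales
  fix x assume x: "x \<in> topspace T"
  have xc: "x \<in> carrier G" using x by (simp add: topspace_eq)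
  have "y = x" if y: "connected_component_of T x y" for y
  proof (rule ccontr)
    assume "y \<noteq> x"
    have yc: "y \<in> carrier G" using y connected_component_in_topspace topspace_eq by metis
    then have "y \<otimes> inv x \<noteq> \<one>" using xc \<open>y \<noteq> x\<close> by (metis inv_closed inv_equality inv_inv)
    then obtain H where H: "subgroup H G" "openin T H" "y \<otimes> inv x \<notin> H"
      using sep xc yc by (meson inv_closed m_closed)
    let ?C = "{z \<in> carrier G. z \<otimes> inv x \<in> H}"
    have "openin T ?C" using xc H by (intro openin_preimage continuous_intros) auto
    moreover have "closedin T ?C"
      using xc closedin_open_subgroup[OF H(1,2)] by (intro closedin_preimage continuous_intros) auto
    moreover have "quasi_component_of T x y" using connected_imp_quasi_component_of[OF y] .
    moreover have "x \<in> ?C" using xc subgroup.one_closed[OF H(1)] by simp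
    ultimately have "y \<in> ?C" unfolding quasi_component_of_def by blast
    then show False using H(3) by blast
  qed
  then show "connected_component_of_set T x = {x}" using x by (auto simp: connected_component_of_refl)
qed (simp_all add: compact Hausdorff)

context profinite
begin

lemma profinite_group: "profinite_group G T"
proof (rule profinite_groupI)
  fix x assume x: "x \<in> carrier G" "x \<noteq> \<one>"
  have "openin T (carrier G - {x})"
    using Hausdorff x closedin_Hausdorff_singleton[of T x] by (metis openin_diff openin_topspace topspace_eq)
  then obtain N where "N \<lhd> G" "openin T N" "N \<subseteq> carrier G - {x}"
    using open_normal_basis[of "carrier G - {x}"] x by auto
  then show "\<exists>H. subgroup H G \<and> openin T H \<and> x \<notin> H" using normal_imp_subgroup by blast
qed

lemma open_normal_Int:
  assumes "M \<lhd> G" "openin T M" "N \<lhd> G" "openin T N"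
  shows "M \<inter> N \<lhd> G \<and> openin T (M \<inter> N)"
  using normal_subgroup_intersect assms by blast

lemma separate_closed:
  assumes C: "closedin T C" and x: "x \<in> carrier G" "x \<notin> C"
  obtains N where "N \<lhd> G" "openin T N" "x \<notin> C <#> N"
proof -
  let ?U = "{u \<in> carrier G. x \<otimes> inv u \<in> carrier G - C}"
  have "openin T ?U"
    using C x by (intro openin_preimage continuous_intros) (auto simp: closedin_def topspace_eq)
  moreover have "\<one> \<in> ?U" using x by simp
  ultimately obtain N where N: "N \<lhd> G" "openin T N" "N \<subseteq> ?U" using open_normal_basis by blast
  have Cc: "C \<subseteq> carrier G" using closedin_subset[OF C] by (simp add: topspace_eq)
  have "x \<notin> C <#> N"
  proof
    assume "x \<in> C <#> N"
    then obtain c n where cn: "c \<in> C" "n \<in> N" "x = c \<otimes> n" unfolding set_mult_def by auto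
    have "n \<in> carrier G" "c \<in> carrier G" using cn N(3) Cc by auto
    then have "x \<otimes> inv n = c" using cn by (simp add: m_assoc)
    then show False using N(3) cn by blast
  qed
  then show thesis using that N by blast
qed

lemma mem_closed_set_multI:
  assumes C: "closedin T C" and x: "x \<in> carrier G"
    and "\<And>N. \<lbrakk>N \<lhd> G; openin T N\<rbrakk> \<Longrightarrow> x \<in> C <#> N"
  shows "x \<in> C"
  using separate_closed[OF C x] assms(3) by blast

end

lemma (in profinite) profinite_closed_subgroup:
  assumes H: "subgroup H G" "closedin T H"
  shows "profinite (G\<lparr>carrier := H\<rparr>) (subtopology T H)"
proof -
  interpret K: group "G\<lparr>carrier := H\<rparr>" by (rule subgroup_imp_group[OF H(1)])
  have Hc: "H \<subseteq> carrier G" by (rule subgroup.subset[OF H(1)])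
  have inj: "continuous_map (subtopology T H) T (\<lambda>x. x)"
    using continuous_map_from_subtopology[OF continuous_map_self] .
  interpret K: topological_group "G\<lparr>carrier := H\<rparr>" "subtopology T H"
  proof
    show "topspace (subtopology T H) = carrier (G\<lparr>carrier := H\<rparr>)"
      using Hc by (auto simp: topspace_eq)
    have "continuous_map (prod_topology (subtopology T H) (subtopology T H)) T (\<lambda>(x, y). x \<otimes> y)"
      using continuous_mult by (metis continuous_map_from_subtopology subtopology_Times)
    then show "continuous_map (prod_topology (subtopology T H) (subtopology T H)) (subtopology T H)
        (\<lambda>(x, y). x \<otimes>\<^bsub>G\<lparr>carrier := H\<rparr>\<^esub> y)"
      using Hc subgroup.m_closed[OF H(1)] by (auto simp: continuous_map_in_subtopology topspace_eq)
    have "continuous_map (subtopology T H) (subtopology T H) (\<lambda>x. inv x)"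
      using continuous_map_from_subtopology[OF continuous_inv, of H] subgroup.m_inv_closed[OF H(1)]
      by (auto simp: continuous_map_in_subtopology topspace_eq)
    then show "continuous_map (subtopology T H) (subtopology T H) (\<lambda>x. inv\<^bsub>G\<lparr>carrier := H\<rparr>\<^esub> x)"
      by (rule continuous_map_eq) (auto simp: m_inv_consistent[OF H(1)] topspace_eq)
  qed
  interpret K: compact_group "G\<lparr>carrier := H\<rparr>" "subtopology T H"
  proof
    show "compact_space (subtopology T H)"
      using closedin_compact_space[OF compact H(2)] by (simp add: compactin_subspace)
    show "Hausdorff_space (subtopology T H)" by (rule Hausdorff_space_subtopology[OF Hausdorff])
  qed
  show ?thesis
  proof
    fix U assume "openin (subtopology T H) U" "\<one>\<^bsub>G\<lparr>carrier := H\<rparr>\<^esub> \<in> U"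
    then obtain V where V: "openin T V" "U = V \<inter> H" "\<one> \<in> V" by (auto simp: openin_subtopology)
    then obtain N where N: "N \<lhd> G" "openin T N" "N \<subseteq> V" using open_normal_basis by blast
    have "H \<inter> N \<lhd> G\<lparr>carrier := H\<rparr>"
      using normal_Int_subgroup[OF H(1) N(1)] by (simp add: Int_commute)
    moreover have "openin (subtopology T H) (H \<inter> N)" using N by (simp add: openin_subtopology_Int2)
    ultimately show "\<exists>N. N \<lhd> G\<lparr>carrier := H\<rparr> \<and> openin (subtopology T H) N \<and> N \<subseteq> U"
      using V N by blast
  qed
qed

section \<open>Closed subgroups of finitely generated abelian profinite groups\<close>

context group
begin

lemma r_coset_eq_iff:
  assumes H: "subgroup H G" and x: "x \<in> carrier G" "y \<in> carrier G"
  shows "H #> x = H #> y \<longleftrightarrow> x \<otimes> inv y \<in> H"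
  using subgroup.rcos_module[OF H is_group x(2,1)] rcos_self[OF x(1) H] repr_independence[OF _ x(2) H, of x]
  by auto

lemma subgroup_nat_pow_closed: "\<lbrakk>subgroup H G; h \<in> H\<rbrakk> \<Longrightarrow> h [^] (n::nat) \<in> H"
  using subgroup_int_pow_closed[of H h "int n"] by (simp add: int_pow_int)

text \<open>
  For a subgroup \<open>M\<close> this says that \<open>M\<close> is normal with abelian quotient.
\<close>

definition has_commutators :: "'a set \<Rightarrow> bool" where
  "has_commutators M \<longleftrightarrow> (\<forall>x\<in>carrier G. \<forall>y\<in>carrier G. x \<otimes> y \<otimes> inv x \<otimes> inv y \<in> M)"

lemma has_commutators_normal:
  assumes M: "subgroup M G" and comm: "has_commutators M"
  shows "M \<lhd> G"
proof (rule normal_invI[OF M])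
  fix x h assume x: "x \<in> carrier G" and h: "h \<in> M"
  have hc: "h \<in> carrier G" by (rule subgroup.mem_carrier[OF M h])
  have "(x \<otimes> h \<otimes> inv x \<otimes> inv h) \<otimes> h \<in> M"
    using comm x hc h unfolding has_commutators_def
    by (intro subgroup.m_closed[OF M, of "x \<otimes> h \<otimes> inv x \<otimes> inv h"]) auto
  then show "x \<otimes> h \<otimes> inv x \<in> M" using x hc by (simp add: m_assoc)
qed

lemma has_commutators_comm_group:
  assumes M: "subgroup M G" and comm: "has_commutators M"
  shows "comm_group (G Mod M)"
proof -
  interpret M: normal M G by (rule has_commutators_normal[OF assms])
  show ?thesis
  proof (rule group.group_comm_groupI[OF M.factorgroup_is_group])
    fix C D assume "C \<in> carrier (G Mod M)" "D \<in> carrier (G Mod M)"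
    then obtain x y where x: "x \<in> carrier G" "C = M #> x" and y: "y \<in> carrier G" "D = M #> y"
      unfolding carrier_FactGroup by blast
    have "(x \<otimes> y) \<otimes> inv (y \<otimes> x) \<in> M"
      using comm x y unfolding has_commutators_def by (simp add: inv_mult_group m_assoc)
    then have "M #> (x \<otimes> y) = M #> (y \<otimes> x)"
      using x y by (simp add: r_coset_eq_iff[OF M])
    then show "C \<otimes>\<^bsub>G Mod M\<^esub> D = D \<otimes>\<^bsub>G Mod M\<^esub> C" using x y by (simp add: M.rcos_sum)
  qed
qed

text \<open>
  Subgroups of cyclic groups are cyclic: division with remainder by the least positive exponent \<open>n\<close> with
  \<open>a\<^sup>n \<in> H\<close>.
\<close>

lemma subgroup_of_powers_cyclic:
  assumes a: "a \<in> carrier G" and H: "subgroup H G" "H \<subseteq> range (\<lambda>i::int. a [^] i)"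
  obtains b where "b \<in> H" "H \<subseteq> range (\<lambda>i::int. b [^] i)"
proof (cases "\<exists>n::nat. n > 0 \<and> a [^] n \<in> H")
  case False
  have "h = \<one>" if h: "h \<in> H" for h
  proof -
    obtain i :: int where i: "h = a [^] i" using h H(2) by blast
    have "i = 0"
    proof (rule ccontr)
      assume "i \<noteq> 0"
      then have "nat \<bar>i\<bar> > 0" by simp
      moreover have "a [^] nat \<bar>i\<bar> \<in> H"
      proof (cases "i > 0")
        case True
        then show ?thesis using h i by (simp add: pow_nat)
      next
        case False
        then have "i = - int (nat \<bar>i\<bar>)" by simp
        then have "h = inv (a [^] nat \<bar>i\<bar>)" using i int_pow_neg_int[OF a] by metis
        then have "a [^] nat \<bar>i\<bar> = inv h" using a by simp
        then show ?thesis using subgroup.m_inv_closed[OF H(1) h] by simp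
      qed
      ultimately show False using \<open>\<nexists>n::nat. n > 0 \<and> a [^] n \<in> H\<close> by blast
    qed
    then show ?thesis using i by simp
  qed
  then have "H \<subseteq> range (\<lambda>i::int. \<one> [^] i)" by (intro subsetI range_eqI[of _ _ 0]) simp
  then show thesis by (rule that[OF subgroup.one_closed[OF H(1)]])
next
  case True
  define n where "n = (LEAST n::nat. n > 0 \<and> a [^] n \<in> H)"
  have n: "n > 0" "a [^] n \<in> H" using LeastI_ex[OF True] unfolding n_def by auto
  have min: "n \<le> m" if "m > 0" "a [^] m \<in> H" for m
    unfolding n_def using that by (intro Least_le) auto
  have "h \<in> range (\<lambda>i::int. (a [^] n) [^] i)" if h: "h \<in> H" for h
  proof -
    obtain i :: int where i: "h = a [^] i" using h H(2) by blast
    define r where "r = nat (i mod int n)"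
    have ir: "i = int n * (i div int n) + int r" using n unfolding r_def by simp
    have hr: "h = (a [^] n) [^] (i div int n) \<otimes> a [^] r"
    proof -
      have "h = a [^] (int n * (i div int n)) \<otimes> a [^] int r" using i ir a by (metis int_pow_mult)
      then show ?thesis using a by (simp add: int_pow_int flip: int_pow_pow)
    qed
    have pw: "(a [^] n) [^] (i div int n) \<in> H" by (rule subgroup_int_pow_closed[OF H(1) n(2)])
    then have "inv ((a [^] n) [^] (i div int n)) \<otimes> h \<in> H"
      using h by (intro subgroup.m_closed[OF H(1)] subgroup.m_inv_closed[OF H(1)])
    then have "a [^] r \<in> H" using hr a by simp
    moreover have "r < n" using n unfolding r_def by (simp add: nat_less_iff)
    ultimately have "r = 0" using min[of r] by linarith
    then show ?thesis using hr a by simp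
  qed
  then show thesis using that n(2) by blast
qed

end

text \<open>
  The preimage \<open>E\<close> of the cyclic subgroup generated by the image of \<open>a\<close>; its commutators die in the cyclic
  quotient \<open>E/H\<close>.
\<close>

lemma (in normal) preimage_powers:
  fixes a
  defines "E \<equiv> {x \<in> carrier G. H #> x \<in> range (\<lambda>i::int. (H #> a) [^]\<^bsub>G Mod H\<^esub> i)}"
  assumes a: "a \<in> carrier G"
  shows "subgroup E G" "insert a H \<subseteq> E"
    "\<And>x y. \<lbrakk>x \<in> E; y \<in> E\<rbrakk> \<Longrightarrow> x \<otimes> y \<otimes> inv x \<otimes> inv y \<in> H"
proof -
  interpret Q: group "G Mod H" by (rule factorgroup_is_group)
  interpret pi: group_hom G "G Mod H" "\<lambda>x. H #> x"
    by unfold_locales (rule r_coset_hom_Mod)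
  have aQ: "H #> a \<in> carrier (G Mod H)" using a by (simp add: carrier_FactGroup)
  have aE: "a \<in> E" unfolding E_def using a Q.int_pow_1[OF aQ] by (auto intro: range_eqI[of _ _ 1])
  show "subgroup E G"
  proof (rule subgroupI)
    show "E \<subseteq> carrier G" unfolding E_def by blast
    show "E \<noteq> {}" using aE by blast
    fix x assume x: "x \<in> E"
    then obtain i :: int where i: "x \<in> carrier G" "H #> x = (H #> a) [^]\<^bsub>G Mod H\<^esub> i" unfolding E_def by blast
    have "H #> (inv x) = (H #> a) [^]\<^bsub>G Mod H\<^esub> (- i)"
      using i aQ pi.hom_inv[OF i(1)] by (simp add: Q.int_pow_neg)
    then show "inv x \<in> E" unfolding E_def using i by blast
    fix y assume y: "y \<in> E"
    then obtain j :: int where j: "y \<in> carrier G" "H #> y = (H #> a) [^]\<^bsub>G Mod H\<^esub> j" unfolding E_def by blast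
    have "H #> (x \<otimes> y) = (H #> a) [^]\<^bsub>G Mod H\<^esub> (i + j)"
      unfolding Q.int_pow_mult[OF aQ] i(2)[symmetric] j(2)[symmetric] by (rule pi.hom_mult[OF i(1) j(1)])
    then show "x \<otimes> y \<in> E" unfolding E_def using i j by blast
  qed
  have "x \<in> E" if x: "x \<in> H" for x
  proof -
    have "H #> x = H" using x rcos_const[OF is_group] by blast
    then have "H #> x = (H #> a) [^]\<^bsub>G Mod H\<^esub> (0::int)" by simp
    then show ?thesis unfolding E_def using x subset by blast
  qed
  then show "insert a H \<subseteq> E" using aE by blast
  fix x y assume "x \<in> E" "y \<in> E"
  then obtain i j :: int where x: "x \<in> carrier G" "H #> x = (H #> a) [^]\<^bsub>G Mod H\<^esub> i"
    and y: "y \<in> carrier G" "H #> y = (H #> a) [^]\<^bsub>G Mod H\<^esub> j" unfolding E_def by blast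
  have "H #> (x \<otimes> y) = (H #> a) [^]\<^bsub>G Mod H\<^esub> (i + j)"
    unfolding Q.int_pow_mult[OF aQ] x(2)[symmetric] y(2)[symmetric] by (rule pi.hom_mult[OF x(1) y(1)])
  moreover have "H #> (y \<otimes> x) = (H #> a) [^]\<^bsub>G Mod H\<^esub> (j + i)"
    unfolding Q.int_pow_mult[OF aQ] x(2)[symmetric] y(2)[symmetric] by (rule pi.hom_mult[OF y(1) x(1)])
  ultimately have "H #> (x \<otimes> y) = H #> (y \<otimes> x)" by (simp add: add.commute)
  then have "(x \<otimes> y) \<otimes> inv (y \<otimes> x) \<in> H"
    by (rule iffD1[OF r_coset_eq_iff[OF is_subgroup m_closed[OF x(1) y(1)] m_closed[OF y(1) x(1)]]])
  then show "x \<otimes> y \<otimes> inv x \<otimes> inv y \<in> H" using x(1) y(1) by (simp add: inv_mult_group m_assoc)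
qed

context topological_group
begin

lemma closedin_coset_preimage:
  assumes M: "subgroup M G" "openin T M"
  shows "closedin T {x \<in> carrier G. M #> x \<in> S}"
proof -
  have op: "openin T {x \<in> carrier G. M #> x \<in> S}" for S
  proof (subst openin_subopen, intro ballI)
    fix x assume x: "x \<in> {x \<in> carrier G. M #> x \<in> S}"
    let ?V = "{y \<in> carrier G. y \<otimes> inv x \<in> M}"
    have "openin T ?V" using x M by (intro openin_preimage continuous_intros) auto
    moreover have "x \<in> ?V" using x subgroup.one_closed[OF M(1)] by simp
    moreover have "M #> y = M #> x" if "y \<in> ?V" for y
      using that x r_coset_eq_iff[OF M(1), of y x] by blast
    then have "?V \<subseteq> {x \<in> carrier G. M #> x \<in> S}" using x by auto
    ultimately show "\<exists>V. openin T V \<and> x \<in> V \<and> V \<subseteq> {x \<in> carrier G. M #> x \<in> S}" by blast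
  qed
  have "carrier G - {x \<in> carrier G. M #> x \<in> S} = {x \<in> carrier G. M #> x \<in> - S}" by blast
  then show ?thesis using op[of "- S"] by (auto simp: closedin_def topspace_eq)
qed

end

context profinite
begin

lemma set_mult_open_normal:
  assumes X: "X \<lhd> G" and U: "U \<lhd> G" "openin T U"
  shows "subgroup (X <#> U) G" "openin T (X <#> U)" "X \<subseteq> X <#> U" "U \<subseteq> X <#> U"
proof -
  have Xg: "subgroup X G" and Ug: "subgroup U G" by (rule normal_imp_subgroup[OF X], rule normal_imp_subgroup[OF U(1)])
  have Xc: "X \<subseteq> carrier G" and Uc: "U \<subseteq> carrier G" using subgroup.subset Xg Ug by blast+
  show sub: "subgroup (X <#> U) G"
    by (rule normal_imp_subgroup[OF normal_subgroup_set_mult_closed[OF X U(1)]])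
  show U_le: "U \<subseteq> X <#> U"
  proof
    fix u assume "u \<in> U"
    then have "u = \<one> \<otimes> u" using Uc by auto
    then show "u \<in> X <#> U" unfolding set_mult_def using \<open>u \<in> U\<close> subgroup.one_closed[OF Xg] by blast
  qed
  show "openin T (X <#> U)"
    by (rule openin_subgroup_if_openin[OF sub U(2) subgroup.one_closed[OF Ug] U_le])
  show "X \<subseteq> X <#> U"
  proof
    fix x assume "x \<in> X"
    then have "x = x \<otimes> \<one>" using Xc by auto
    then show "x \<in> X <#> U" unfolding set_mult_def using \<open>x \<in> X\<close> subgroup.one_closed[OF Ug] by blast
  qed
qed

lemma set_mult_open_commutators:
  assumes X: "subgroup X G" and comm: "has_commutators X" and U: "U \<lhd> G" "openin T U"
  shows "subgroup (X <#> U) G" "openin T (X <#> U)" "has_commutators (X <#> U)"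
    "X \<subseteq> X <#> U" "U \<subseteq> X <#> U"
proof -
  note XU = set_mult_open_normal[OF has_commutators_normal[OF X comm] U]
  show "subgroup (X <#> U) G" "openin T (X <#> U)" "X \<subseteq> X <#> U" "U \<subseteq> X <#> U" by (rule XU)+
  show "has_commutators (X <#> U)" using comm XU(3) unfolding has_commutators_def by blast
qed

text \<open>
  A closed subgroup of a procyclic group is procyclic. Modulo the open subgroups \<open>X U\<close>, a
  generator exists because subgroups of cyclic groups are cyclic. The generators modulo \<open>X U\<close> form a nonempty
  closed set \<open>F U\<close>, and these sets are directed, so by compactness some \<open>c\<close> is a generator modulo all \<open>X U\<close>.
\<close>

lemma closed_subgroup_procyclic:
  assumes X: "subgroup X G" "closedin T X" and comm: "has_commutators X" and a: "a \<in> carrier G"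
    and C: "subgroup C G" "closedin T C" "C \<subseteq> topgen (insert a X)"
  obtains c where "c \<in> C" "C = topgen (insert c (C \<inter> X))"
proof -
  have XN: "X \<lhd> G" by (rule has_commutators_normal[OF X(1) comm])
  have Xc: "X \<subseteq> carrier G" by (rule subgroup.subset[OF X(1)])
  have Cc: "C \<subseteq> carrier G" by (rule subgroup.subset[OF C(1)])
  define \<N> where "\<N> = {U. U \<lhd> G \<and> openin T U}"
  have M: "subgroup (X <#> U) G" "openin T (X <#> U)" "has_commutators (X <#> U)"
    "X \<subseteq> X <#> U" "U \<subseteq> X <#> U" if U: "U \<in> \<N>" for U
    using set_mult_open_commutators[OF X(1) comm, of U] U unfolding \<N>_def by blast+
  \<comment> \<open>the elements of \<open>C\<close> that generate it modulo \<open>X U\<close>, written as a preimage of cosets to see that \<open>F U\<close> is closed\<close>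
  define F where "F U = C \<inter> {c \<in> carrier G. (X <#> U) #> c \<in>
    {D \<in> carrier (G Mod (X <#> U)). \<forall>y\<in>C. \<exists>i::int. (X <#> U) #> y = D [^]\<^bsub>G Mod (X <#> U)\<^esub> i}}" for U
  have Fmem: "c \<in> F U \<longleftrightarrow> c \<in> C \<and> (\<forall>y\<in>C. \<exists>i::int. y \<otimes> inv (c [^] i) \<in> X <#> U)" if U: "U \<in> \<N>" for c U
  proof -
    interpret MU: normal "X <#> U" G by (rule has_commutators_normal[OF M(1,3)[OF U]])
    have "(X <#> U) #> y = ((X <#> U) #> c) [^]\<^bsub>G Mod (X <#> U)\<^esub> i \<longleftrightarrow> y \<otimes> inv (c [^] i) \<in> X <#> U"
      if "y \<in> carrier G" "c \<in> carrier G" for y and i :: int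
      using that by (simp add: MU.FactGroup_int_pow r_coset_eq_iff[OF M(1)[OF U]])
    then show ?thesis unfolding F_def carrier_FactGroup using Cc by blast
  qed
  have "\<Inter>(F ` \<N>) \<noteq> {}"
  proof (rule directed_closed_Inter_nonempty[OF compact])
    have carr: "carrier G \<in> \<N>" unfolding \<N>_def using normal_self by (metis mem_Collect_eq openin_topspace topspace_eq)
    then show "F ` \<N> \<noteq> {}" by blast
    show "closedin T B" if B: "B \<in> F ` \<N>" for B
    proof -
      obtain U where U: "U \<in> \<N>" "B = F U" using B by blast
      show ?thesis unfolding U(2) F_def by (rule closedin_Int[OF C(2) closedin_coset_preimage[OF M(1,2)[OF U(1)]]])
    qed
    show "B \<noteq> {}" if B: "B \<in> F ` \<N>" for B
    proof -
      obtain U where U: "U \<in> \<N>" "B = F U" using B by blast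
      let ?M = "X <#> U" and ?Q = "G Mod (X <#> U)"
      interpret MU: normal ?M G by (rule has_commutators_normal[OF M(1,3)[OF U(1)]])
      interpret Q: group ?Q by (rule MU.factorgroup_is_group)
      interpret pi: group_hom G ?Q "\<lambda>x. ?M #> x"
        by unfold_locales (rule MU.r_coset_hom_Mod)
      \<comment> \<open>the closed subgroup of elements that are powers of \<open>a\<close> modulo \<open>X U\<close>; it contains \<open>C\<close>\<close>
      define E where "E = {y \<in> carrier G. ?M #> y \<in> range (\<lambda>i::int. (?M #> a) [^]\<^bsub>?Q\<^esub> i)}"
      note E = MU.preimage_powers[OF a, folded E_def]
      have aQ: "?M #> a \<in> carrier ?Q" using a by (simp add: carrier_FactGroup)
      have "subgroup E G" by (rule E(1))
      moreover have "insert a X \<subseteq> E" using E(2) M(4)[OF U(1)] by blast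
      moreover have "closedin T E"
        unfolding E_def by (rule closedin_coset_preimage[OF M(1,2)[OF U(1)]])
      ultimately have CE: "C \<subseteq> E" using topgen_minimal C(3) by blast
      have "subgroup ((\<lambda>x. ?M #> x) ` C) ?Q" by (rule pi.subgroup_img_is_subgroup[OF C(1)])
      moreover have "(\<lambda>x. ?M #> x) ` C \<subseteq> range (\<lambda>i::int. (?M #> a) [^]\<^bsub>?Q\<^esub> i)"
        using CE unfolding E_def by blast
      ultimately obtain b where b: "b \<in> (\<lambda>x. ?M #> x) ` C"
        "(\<lambda>x. ?M #> x) ` C \<subseteq> range (\<lambda>i::int. b [^]\<^bsub>?Q\<^esub> i)"
        using Q.subgroup_of_powers_cyclic[OF aQ] by metis
      then obtain c where c: "c \<in> C" "b = ?M #> c" by blast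
      have "c \<in> F U" unfolding F_def carrier_FactGroup using b(2) c Cc by blast
      then show ?thesis using U(2) by blast
    qed
    show "\<exists>E\<in>F ` \<N>. E \<subseteq> B \<inter> D" if BD: "B \<in> F ` \<N>" "D \<in> F ` \<N>" for B D
    proof -
      obtain U V where UV: "U \<in> \<N>" "V \<in> \<N>" "B = F U" "D = F V" using BD by blast
      have W: "U \<inter> V \<in> \<N>" using UV open_normal_Int unfolding \<N>_def by blast
      have "X <#> (U \<inter> V) \<subseteq> X <#> U" "X <#> (U \<inter> V) \<subseteq> X <#> V"
        by (rule mono_set_mult; blast)+
      then have "F (U \<inter> V) \<subseteq> F U" "F (U \<inter> V) \<subseteq> F V"
        unfolding subset_iff Fmem[OF W] Fmem[OF UV(1)] Fmem[OF UV(2)] by blast+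
      then show ?thesis using W UV by blast
    qed
  qed
  then obtain c where c: "\<And>U. U \<in> \<N> \<Longrightarrow> c \<in> F U" by blast
  have "carrier G \<in> \<N>" unfolding \<N>_def using normal_self by (metis mem_Collect_eq openin_topspace topspace_eq)
  then have cC: "c \<in> C" using c unfolding F_def by blast
  have cc: "c \<in> carrier G" using cC Cc by blast
  define A where "A = topgen {c}"
  have A: "subgroup A G" "closedin T A" "c \<in> A"
    unfolding A_def using subgroup_topgen[of "{c}"] closedin_topgen topgen_incl[of "{c}"] cc by auto
  have AC: "A \<subseteq> C" unfolding A_def using cC C by (intro topgen_minimal) auto
  have Ac: "A \<subseteq> carrier G" by (rule subgroup.subset[OF A(1)])
  have yAX: "y \<in> A <#> X" if y: "y \<in> C" for y
  proof (rule mem_closed_set_multI[OF closedin_set_mult[OF A(2) X(2)]])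
    show "y \<in> carrier G" using y Cc by blast
    fix U assume "U \<lhd> G" "openin T U"
    then have U: "U \<in> \<N>" unfolding \<N>_def by blast
    interpret MU: normal "X <#> U" G by (rule has_commutators_normal[OF M(1,3)[OF U]])
    obtain i :: int where i: "y \<otimes> inv (c [^] i) \<in> X <#> U" using c[OF U] y unfolding Fmem[OF U] by blast
    let ?k = "c [^] i"
    have yc: "y \<in> carrier G" using y Cc by blast
    have "inv ?k \<otimes> (y \<otimes> inv ?k) \<otimes> ?k \<in> X <#> U"
      using MU.inv_op_closed1[OF int_pow_closed[OF cc] i] .
    then have "inv ?k \<otimes> y \<in> X <#> U" using cc yc by (simp add: m_assoc)
    then have "?k \<otimes> (inv ?k \<otimes> y) \<in> A <#> (X <#> U)"
      using subgroup_int_pow_closed[OF A(1,3), of i] unfolding set_mult_def[of _ A] by blast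
    then have "y \<in> A <#> (X <#> U)" using cc yc by simp
    moreover have "U \<subseteq> carrier G" using U normal_imp_subgroup subgroup.subset unfolding \<N>_def by blast
    ultimately show "y \<in> A <#> X <#> U" using set_mult_assoc[OF Ac Xc, of U] by simp
  qed
  have sub: "insert c (C \<inter> X) \<subseteq> carrier G" using cc Xc by blast
  have AG: "A \<subseteq> topgen (insert c (C \<inter> X))" unfolding A_def by (rule topgen_mono) blast
  have "C \<subseteq> topgen (insert c (C \<inter> X))"
  proof
    fix y assume y: "y \<in> C"
    obtain k x where kx: "k \<in> A" "x \<in> X" "y = k \<otimes> x" using yAX[OF y] unfolding set_mult_def by blast
    have "k \<in> carrier G" "x \<in> carrier G" using kx(1,2) Ac Xc by blast+
    then have "x = inv k \<otimes> y" using kx(3) by simp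
    also have "\<dots> \<in> C" using kx(1) AC y by (intro subgroup.m_closed[OF C(1)] subgroup.m_inv_closed[OF C(1)]) auto
    finally have "x \<in> topgen (insert c (C \<inter> X))" using kx(2) topgen_incl[OF sub] by blast
    then show "y \<in> topgen (insert c (C \<inter> X))"
      unfolding kx(3) using kx(1) AG by (intro subgroup.m_closed[OF subgroup_topgen[OF sub]]) auto
  qed
  moreover have "topgen (insert c (C \<inter> X)) \<subseteq> C" using cC C by (intro topgen_minimal) auto
  ultimately show thesis using that cC by blast
qed

text \<open>
  Hence closed subgroups of finitely generated abelian profinite groups are finitely generated, by
  induction on the number of generators: each new generator contributes a procyclic layer, which \<open>C\<close>
  meets in a procyclic group. The statement is relative to a closed subgroup \<open>X\<close> with abelian
  quotient, so that it applies to quotients without forming them.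
\<close>

lemma closed_subgroup_fg:
  assumes X: "subgroup X G" "closedin T X" and comm: "has_commutators X"
    and S: "finite S" "S \<subseteq> carrier G" and C: "subgroup C G" "closedin T C"
  obtains S' where "finite S'" "S' \<subseteq> C" "C \<inter> topgen (X \<union> S) = topgen ((C \<inter> X) \<union> S')"
proof -
  have Xc: "X \<subseteq> carrier G" by (rule subgroup.subset[OF X(1)])
  have Cc: "C \<subseteq> carrier G" by (rule subgroup.subset[OF C(1)])
  have "\<exists>S'. finite S' \<and> S' \<subseteq> C \<and> C \<inter> topgen (X \<union> S) = topgen ((C \<inter> X) \<union> S')"
    using S
  proof (induction rule: finite_induct)
    case empty
    have "topgen X = X" using topgen_minimal[OF _ X] topgen_incl[OF Xc] by blast
    moreover have "topgen (C \<inter> X) = C \<inter> X"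
      using topgen_minimal[of "C \<inter> X" "C \<inter> X"] topgen_incl[of "C \<inter> X"] Xc
        subgroups_Inter_pair[OF C(1) X(1)] closedin_Int[OF C(2) X(2)] by blast
    ultimately show ?case by (intro exI[of _ "{}"]) simp
  next
    case (insert a S)
    have XS: "X \<union> S \<subseteq> carrier G" and a: "a \<in> carrier G" using insert.prems Xc by auto
    obtain S' where S': "finite S'" "S' \<subseteq> C" "C \<inter> topgen (X \<union> S) = topgen ((C \<inter> X) \<union> S')"
      using insert.IH insert.prems by blast
    define Y where "Y = topgen (X \<union> S)"
    have Y: "subgroup Y G" "closedin T Y" unfolding Y_def by (rule subgroup_topgen[OF XS], rule closedin_topgen)
    have "X \<subseteq> Y" unfolding Y_def using topgen_incl[OF XS] by blast
    then have commY: "has_commutators Y" using comm unfolding has_commutators_def by blast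
    have YY: "topgen (X \<union> insert a S) = topgen (insert a Y)"
      using topgen_Un_topgen[OF XS, of "{a}"] a unfolding Y_def by simp
    have aY: "insert a Y \<subseteq> carrier G" using a subgroup.subset[OF Y(1)] by blast
    let ?C = "C \<inter> topgen (insert a Y)"
    have C': "subgroup ?C G" "closedin T ?C" "?C \<subseteq> topgen (insert a Y)"
      using subgroups_Inter_pair[OF C(1) subgroup_topgen[OF aY]] closedin_Int[OF C(2) closedin_topgen] by auto
    obtain c where c: "c \<in> ?C" "?C = topgen (insert c (?C \<inter> Y))"
      using closed_subgroup_procyclic[OF Y commY a C'] by blast
    have "?C \<inter> Y = C \<inter> Y" using topgen_incl[OF aY] by blast
    then have "?C = topgen (topgen ((C \<inter> X) \<union> S') \<union> {c})"
      using c(2) S'(3) unfolding Y_def by simp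
    also have "\<dots> = topgen (((C \<inter> X) \<union> S') \<union> {c})"
      using c(1) S'(2) Cc by (intro topgen_Un_topgen) auto
    finally have "C \<inter> topgen (X \<union> insert a S) = topgen ((C \<inter> X) \<union> insert c S')"
      unfolding YY by simp
    then show ?case using S' c(1) by (intro exI[of _ "insert c S'"]) auto
  qed
  then show thesis using that by blast
qed

end

section \<open>Characters and p-adic homomorphisms\<close>

text \<open>
  Since \<open>p\<^bsup>n+1\<^esup> > n\<close>, at most \<open>n\<close> of the factors \<open>p\<close> can be absorbed by \<open>n\<close>. This crude bound
  is all that torsion freeness of the \<open>p\<close>-adic integers requires.
\<close>

lemma prime_power_dvd_multiple_cancel:
  assumes p: "prime (p::nat)" and n: "n > 0" and dvd: "int p ^ Suc (n + k) dvd int n * t"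
  shows "int p ^ Suc k dvd t"
proof -
  have "prime_elem (int p)" using p by simp
  moreover have "Suc n + Suc k = Suc (Suc (n + k))" by simp
  ultimately consider "int p ^ Suc n dvd int n" | "int p ^ Suc k dvd t"
    using prime_elem_power_dvd_cases[OF dvd] by blast
  then show ?thesis
  proof cases
    case 1
    then have "p ^ Suc n dvd n" by (metis of_nat_dvd_iff of_nat_power)
    then have "p ^ Suc n \<le> n" using n by (rule dvd_imp_le)
    moreover have "Suc n < 2 ^ Suc n" by (rule less_exp)
    moreover have "2 ^ Suc n \<le> p ^ Suc n" using prime_gt_1_nat[OF p] by (intro power_mono) auto
    ultimately show ?thesis by simp
  qed
qed

context profinite
begin

definition comm_closure :: "'a set" where
  "comm_closure = T closure_of (derived G (carrier G))"

lemma derived_le_comm_closure: "derived G (carrier G) \<subseteq> comm_closure"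
  unfolding comm_closure_def using derived_in_carrier[of "carrier G"]
  by (intro closure_of_subset) (simp add: topspace_eq)

lemma comm_closure: "subgroup comm_closure G" "closedin T comm_closure" "has_commutators comm_closure"
proof -
  show "subgroup comm_closure G"
    unfolding comm_closure_def by (rule closure_of_subgroup[OF derived_is_subgroup]) simp
  show "closedin T comm_closure" unfolding comm_closure_def by simp
  have "x \<otimes> y \<otimes> inv x \<otimes> inv y \<in> derived G (carrier G)" if "x \<in> carrier G" "y \<in> carrier G" for x y
    unfolding derived_def using that by (intro generate.incl) blast
  then show "has_commutators comm_closure"
    unfolding has_commutators_def using derived_le_comm_closure by blast
qed

lemma comm_closure_minimal:
  assumes "subgroup X G" "closedin T X" "has_commutators X"
  shows "comm_closure \<subseteq> X"
proof -
  have "derived_set G (carrier G) \<subseteq> X" using assms(3) unfolding has_commutators_def by blast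
  then have "derived G (carrier G) \<subseteq> X"
    unfolding derived_def by (rule generate_subgroup_incl[OF _ assms(1)])
  then show ?thesis unfolding comm_closure_def by (rule closure_of_minimal[OF _ assms(2)])
qed

definition torsion_free_mod :: "'a set \<Rightarrow> bool" where
  "torsion_free_mod X \<longleftrightarrow> (\<forall>x\<in>carrier G. \<forall>n::nat. n > 0 \<and> x [^] n \<in> X \<longrightarrow> x \<in> X)"

text \<open>Continuous homomorphisms to the discrete group \<open>\<int>/q\<close>: continuity means that the kernel is open.\<close>

definition character_mod :: "int \<Rightarrow> ('a \<Rightarrow> int) \<Rightarrow> bool" where
  "character_mod q f \<longleftrightarrow> additive_mod q G (carrier G) f \<and>
     (\<exists>U. U \<lhd> G \<and> openin T U \<and> (\<forall>u\<in>U. q dvd f u))"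

definition kernel_mod :: "int \<Rightarrow> ('a \<Rightarrow> int) \<Rightarrow> 'a set" where
  "kernel_mod q f = {x \<in> carrier G. q dvd f x}"

lemma kernel_mod:
  assumes f: "character_mod q f"
  shows "subgroup (kernel_mod q f) G" "openin T (kernel_mod q f)" "closedin T (kernel_mod q f)"
    "has_commutators (kernel_mod q f)"
proof -
  have add: "additive_mod q G (carrier G) f" using f unfolding character_mod_def by blast
  have mult: "[f (x \<otimes> y) = f x + f y] (mod q)" if "x \<in> carrier G" "y \<in> carrier G" for x y
    using add that unfolding additive_mod_def by blast
  have inv: "[f (inv x) = - f x] (mod q)" if "x \<in> carrier G" for x
    by (rule additive_mod_inv[OF add subgroup_self that])
  show sub: "subgroup (kernel_mod q f) G"
  proof (rule subgroupI)
    show "kernel_mod q f \<subseteq> carrier G" unfolding kernel_mod_def by blast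
    have "\<one> \<in> kernel_mod q f"
      using additive_mod_one[OF add subgroup_self] unfolding kernel_mod_def by (simp add: cong_0_iff)
    then show "kernel_mod q f \<noteq> {}" by blast
    fix x assume x: "x \<in> kernel_mod q f"
    then show "inv x \<in> kernel_mod q f" using inv[of x] unfolding kernel_mod_def by (simp add: cong_dvd_iff)
    fix y assume y: "y \<in> kernel_mod q f"
    then show "x \<otimes> y \<in> kernel_mod q f" using x mult[of x y] unfolding kernel_mod_def by (simp add: cong_dvd_iff)
  qed
  obtain U where U: "U \<lhd> G" "openin T U" "\<forall>u\<in>U. q dvd f u" using f unfolding character_mod_def by blast
  then have "U \<subseteq> kernel_mod q f"
    using subgroup.subset[OF normal_imp_subgroup[OF U(1)]] unfolding kernel_mod_def by blast
  then show op: "openin T (kernel_mod q f)"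
    using openin_subgroup_if_openin[OF sub U(2)] subgroup.one_closed[OF normal_imp_subgroup[OF U(1)]] by blast
  show "closedin T (kernel_mod q f)" by (rule closedin_open_subgroup[OF sub op])
  show "has_commutators (kernel_mod q f)"
    unfolding has_commutators_def
  proof (intro ballI)
    fix x y assume x: "x \<in> carrier G" and y: "y \<in> carrier G"
    have "[f (x \<otimes> y \<otimes> inv x \<otimes> inv y) = f (x \<otimes> y \<otimes> inv x) + f (inv y)] (mod q)"
      using x y by (intro mult) auto
    also have "[f (x \<otimes> y \<otimes> inv x) + f (inv y) = (f (x \<otimes> y) + f (inv x)) + - f y] (mod q)"
      using x y by (intro cong_add mult inv) auto
    also have "[(f (x \<otimes> y) + f (inv x)) + - f y = ((f x + f y) + - f x) + - f y] (mod q)"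
      using x y by (intro cong_add mult inv cong_refl) auto
    finally have "[f (x \<otimes> y \<otimes> inv x \<otimes> inv y) = 0] (mod q)" by simp
    then show "x \<otimes> y \<otimes> inv x \<otimes> inv y \<in> kernel_mod q f"
      using x y unfolding kernel_mod_def by (simp add: cong_0_iff)
  qed
qed

lemma character_mod_pullback:
  assumes E: "subgroup E G" "openin T E" "has_commutators E"
    and f: "additive_mod q (G Mod E) (carrier (G Mod E)) f"
  shows "character_mod q (\<lambda>x. f (E #> x))"
proof -
  interpret E: normal E G by (rule has_commutators_normal[OF E(1,3)])
  interpret Q: group "G Mod E" by (rule E.factorgroup_is_group)
  have "additive_mod q G (carrier G) (\<lambda>x. f (E #> x))"
    unfolding additive_mod_def
  proof (intro ballI)
    fix x y assume xy: "x \<in> carrier G" "y \<in> carrier G"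
    then have "[f ((E #> x) \<otimes>\<^bsub>G Mod E\<^esub> (E #> y)) = f (E #> x) + f (E #> y)] (mod q)"
      using f unfolding additive_mod_def carrier_FactGroup by blast
    then show "[f (E #> (x \<otimes> y)) = f (E #> x) + f (E #> y)] (mod q)" using xy by (simp add: E.rcos_sum)
  qed
  moreover have "q dvd f (E #> u)" if u: "u \<in> E" for u
  proof -
    have "E #> u = \<one>\<^bsub>G Mod E\<^esub>" using E.rcos_const[OF is_group u] by simp
    then show ?thesis using Q.additive_mod_one[OF f Q.subgroup_self] by (simp add: cong_0_iff)
  qed
  ultimately show ?thesis unfolding character_mod_def using E.normal_axioms E(2) by blast
qed

lemma finite_Mod_open:
  assumes "subgroup E G" "openin T E"
  shows "finite (carrier (G Mod E))"
  using finite_rcosets_open[OF assms] by (simp add: FactGroup_def)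

text \<open>
  Divisibility of the character group. Let \<open>W\<close> be the kernel of \<open>chi\<close>. Since the
  abelianization is torsion free, \<open>x\<^sup>p \<notin> comm_closure\<close> for \<open>x \<notin> W\<close>. By compactness there is even an
  open normal subgroup \<open>E\<close> above \<open>comm_closure\<close> with \<open>x\<^sup>p \<notin> E\<close> for all \<open>x \<notin> W\<close>. So \<open>chi\<close> vanishes on
  the \<open>p\<close>-torsion of the finite abelian group \<open>G/E\<close> and lifts there.
\<close>

lemma character_mod_lift:
  assumes tf: "torsion_free_mod comm_closure" and p: "prime (p::nat)"
    and chi: "character_mod (int p ^ k) chi"
  obtains psi where "character_mod (int p ^ Suc k) psi"
    "\<And>x. x \<in> carrier G \<Longrightarrow> [psi x = chi x] (mod int p ^ k)"
proof -
  define W where "W = kernel_mod (int p ^ k) chi"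
  note W = kernel_mod[OF chi, folded W_def]
  let ?D = comm_closure
  have Dc: "?D \<subseteq> carrier G" by (rule subgroup.subset[OF comm_closure(1)])
  have DW: "?D \<subseteq> W" by (rule comm_closure_minimal[OF W(1,3,4)])
  \<comment> \<open>the products \<open>d x\<^sup>p\<close> with \<open>x \<notin> W\<close>; the group \<open>U\<close> below has to avoid them\<close>
  define Z where "Z = ?D <#> ((\<lambda>x. x [^] p) ` (carrier G - W))"
  have "closedin T Z"
    unfolding Z_def
    using W(2) by (intro closedin_set_mult comm_closure closedin_image continuous_intros)
      (metis closedin_def closedin_topspace openin_closedin_eq closedin_diff topspace_eq)
  moreover have "\<one> \<notin> Z"
  proof
    assume "\<one> \<in> Z"
    then obtain d x where dx: "d \<in> ?D" "x \<in> carrier G" "x \<notin> W" "\<one> = d \<otimes> x [^] p"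
      unfolding Z_def set_mult_def by blast
    have dc: "d \<in> carrier G" using dx(1) Dc by blast
    have "inv (x [^] p) = d" by (rule inv_equality) (use dx dc in auto)
    then have "x [^] p = inv d" using dx(2) by auto
    then have "x [^] p \<in> ?D" using subgroup.m_inv_closed[OF comm_closure(1) dx(1)] by simp
    then have "x \<in> ?D" using tf dx(2) prime_gt_0_nat[OF p] unfolding torsion_free_mod_def by blast
    then show False using DW dx(3) by blast
  qed
  ultimately have "openin T ((carrier G - Z) \<inter> W)" "\<one> \<in> (carrier G - Z) \<inter> W"
    using W(2) subgroup.one_closed[OF W(1)] by (auto simp: closedin_def topspace_eq)
  then obtain U where U: "U \<lhd> G" "openin T U" "U \<subseteq> (carrier G - Z) \<inter> W"
    using open_normal_basis by blast
  define E where "E = ?D <#> U"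
  note E = set_mult_open_commutators[OF comm_closure(1,3) U(1,2), folded E_def]
  have EW: "E \<subseteq> W"
    unfolding E_def set_mult_def using DW U(3) subgroup.m_closed[OF W(1)] by blast
  interpret E: normal E G by (rule has_commutators_normal[OF E(1,3)])
  interpret Q: comm_group "G Mod E" by (rule has_commutators_comm_group[OF E(1,3)])
  define chi' where "chi' C = chi (SOME x. x \<in> carrier G \<and> E #> x = C)" for C
  have add: "additive_mod (int p ^ k) G (carrier G) chi" using chi unfolding character_mod_def by blast
  have chi': "[chi' (E #> x) = chi x] (mod int p ^ k)" if x: "x \<in> carrier G" for x
  proof -
    define y where "y = (SOME y. y \<in> carrier G \<and> E #> y = E #> x)"
    have y: "y \<in> carrier G" "E #> y = E #> x"
      using someI[of "\<lambda>y. y \<in> carrier G \<and> E #> y = E #> x" x] x unfolding y_def by auto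
    then have "y \<otimes> inv x \<in> W" using x EW by (auto simp: r_coset_eq_iff[OF E(1)])
    then have "[chi (y \<otimes> inv x) = 0] (mod int p ^ k)"
      unfolding W_def kernel_mod_def by (simp add: cong_0_iff)
    from cong_trans[OF cong_sym[OF additive_mod_diff[OF add subgroup_self y(1) x]] this]
    show ?thesis unfolding chi'_def y_def[symmetric] by (simp add: cong_diff_iff_cong_0)
  qed
  have "additive_mod (int p ^ k) (G Mod E) (carrier (G Mod E)) chi'"
    unfolding additive_mod_def carrier_FactGroup
  proof (clarify)
    fix x y assume xy: "x \<in> carrier G" "y \<in> carrier G"
    have "[chi' (E #> (x \<otimes> y)) = chi (x \<otimes> y)] (mod int p ^ k)" using xy by (intro chi') simp
    also have "[chi (x \<otimes> y) = chi x + chi y] (mod int p ^ k)"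
      using add xy unfolding additive_mod_def by blast
    also have "[chi x + chi y = chi' (E #> x) + chi' (E #> y)] (mod int p ^ k)"
      using xy by (intro cong_add cong_sym[OF chi'])
    finally show "[chi' ((E #> x) \<otimes>\<^bsub>G Mod E\<^esub> (E #> y)) = chi' (E #> x) + chi' (E #> y)] (mod int p ^ k)"
      using xy by (simp add: E.rcos_sum)
  qed
  moreover have "int p ^ k dvd chi' C"
    if C: "C \<in> carrier (G Mod E)" "C [^]\<^bsub>G Mod E\<^esub> p = \<one>\<^bsub>G Mod E\<^esub>" for C
  proof -
    obtain x where x: "x \<in> carrier G" "C = E #> x" using C(1) unfolding carrier_FactGroup by blast
    have "E #> x [^] p = E" using C(2) x by (simp add: E.FactGroup_pow)
    then have "x [^] p \<in> E" using rcos_self[OF nat_pow_closed[OF x(1)] E(1)] by metis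
    then obtain d u where du: "d \<in> ?D" "u \<in> U" "x [^] p = d \<otimes> u" unfolding E_def set_mult_def by blast
    have dc: "d \<in> carrier G" "u \<in> carrier G" using du Dc U(3) by auto
    have "x \<in> W"
    proof (rule ccontr)
      assume "x \<notin> W"
      have "u = inv d \<otimes> x [^] p" using du(3) dc by simp
      then have "u \<in> Z"
        unfolding Z_def set_mult_def
        using \<open>x \<notin> W\<close> x(1) subgroup.m_inv_closed[OF comm_closure(1) du(1)] by blast
      then show False using U(3) du(2) by blast
    qed
    then have "int p ^ k dvd chi x" unfolding W_def kernel_mod_def by blast
    then show ?thesis using chi'[OF x(1)] x(2) by (simp add: cong_dvd_iff)
  qed
  ultimately obtain psi where psi: "additive_mod (int p ^ Suc k) (G Mod E) (carrier (G Mod E)) psi"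
    "\<And>C. C \<in> carrier (G Mod E) \<Longrightarrow> [psi C = chi' C] (mod int p ^ k)"
    using Q.additive_mod_lift[OF finite_Mod_open[OF E(1,2)] p] by blast
  have "[psi (E #> x) = chi x] (mod int p ^ k)" if "x \<in> carrier G" for x
    using cong_trans[OF psi(2) chi'[OF that]] that unfolding carrier_FactGroup by blast
  then show thesis using that character_mod_pullback[OF E(1-3) psi(1)] by blast
qed

text \<open>
  The \<open>p\<close>-th powers modulo \<open>comm_closure\<close> form a closed set by compactness, so \<open>z\<close> is not even a \<open>p\<close>-th power
  modulo a suitable open subgroup, and a finite abelian quotient provides the character.
\<close>

lemma character_mod_separate:
  assumes p: "prime (p::nat)" and z: "z \<in> carrier G"
    and not_power: "\<And>x. x \<in> carrier G \<Longrightarrow> comm_closure #> z \<noteq> comm_closure #> x [^] p"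
  obtains psi where "character_mod (int p) psi" "\<not> int p dvd psi z"
proof -
  let ?D = comm_closure
  have Dc: "?D \<subseteq> carrier G" by (rule subgroup.subset[OF comm_closure(1)])
  define P where "P = ?D <#> ((\<lambda>x. x [^] p) ` carrier G)"
  have "closedin T P"
    unfolding P_def
    by (intro closedin_set_mult comm_closure closedin_image continuous_intros) (metis closedin_topspace topspace_eq)
  moreover have "z \<notin> P"
  proof
    assume "z \<in> P"
    then obtain d x where dx: "d \<in> ?D" "x \<in> carrier G" "z = d \<otimes> x [^] p"
      unfolding P_def set_mult_def by blast
    then have "z \<otimes> inv (x [^] p) \<in> ?D" using Dc by (auto simp: m_assoc)
    then show False using not_power[OF dx(2)] z dx(2) r_coset_eq_iff[OF comm_closure(1)] by simp
  qed
  ultimately obtain U where U: "U \<lhd> G" "openin T U" "z \<notin> P <#> U" using separate_closed z by blast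
  define E where "E = ?D <#> U"
  note E = set_mult_open_commutators[OF comm_closure(1,3) U(1,2), folded E_def]
  interpret E: normal E G by (rule has_commutators_normal[OF E(1,3)])
  interpret U: normal U G by (rule U(1))
  interpret Q: comm_group "G Mod E" by (rule has_commutators_comm_group[OF E(1,3)])
  have "C [^]\<^bsub>G Mod E\<^esub> p \<noteq> E #> z" if C: "C \<in> carrier (G Mod E)" for C
  proof
    obtain x where x: "x \<in> carrier G" "C = E #> x" using C unfolding carrier_FactGroup by blast
    assume "C [^]\<^bsub>G Mod E\<^esub> p = E #> z"
    then have "E #> z = E #> x [^] p" using x by (simp add: E.FactGroup_pow)
    then have "z \<otimes> inv (x [^] p) \<in> E" using r_coset_eq_iff[OF E(1) z] x by simp
    then obtain d u where du: "d \<in> ?D" "u \<in> U" "z \<otimes> inv (x [^] p) = d \<otimes> u"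
      unfolding E_def set_mult_def by blast
    let ?y = "x [^] p"
    have c: "d \<in> carrier G" "u \<in> carrier G" "?y \<in> carrier G" using du Dc x U.subset by auto
    have "z = (z \<otimes> inv ?y) \<otimes> ?y" using z c by (simp add: m_assoc)
    also have "\<dots> = (d \<otimes> ?y) \<otimes> (inv ?y \<otimes> u \<otimes> ?y)" using du(3) c by (simp add: m_assoc)
    finally have "z = (d \<otimes> ?y) \<otimes> (inv ?y \<otimes> u \<otimes> ?y)" .
    moreover have "d \<otimes> ?y \<in> P" unfolding P_def set_mult_def using du(1) x(1) by blast
    moreover have "inv ?y \<otimes> u \<otimes> ?y \<in> U" using U.inv_op_closed1[OF c(3) du(2)] .
    ultimately show False using U(3) unfolding set_mult_def[of _ P] by blast
  qed
  then obtain psi where psi: "additive_mod (int p) (G Mod E) (carrier (G Mod E)) psi" "\<not> int p dvd psi (E #> z)"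
    using Q.additive_mod_separate[OF finite_Mod_open[OF E(1,2)] p, of "E #> z"] z
    unfolding carrier_FactGroup by blast
  then show thesis using that character_mod_pullback[OF E(1-3) psi(1)] by blast
qed

definition fg_over :: "'a set \<Rightarrow> bool" where
  "fg_over X \<longleftrightarrow> (\<exists>S. finite S \<and> S \<subseteq> carrier G \<and> topgen (X \<union> S) = carrier G)"

text \<open>
  The kernels of continuous homomorphisms onto torsion free, finitely generated abelian profinite groups.
\<close>

definition tf_fg_kernel :: "'a set \<Rightarrow> bool" where
  "tf_fg_kernel X \<longleftrightarrow> subgroup X G \<and> closedin T X \<and> has_commutators X \<and> torsion_free_mod X \<and> fg_over X"

text \<open>
  A compatible sequence of characters modulo \<open>p, p\<^sup>2, p\<^sup>3, \<dots>\<close> is a homomorphism \<open>f\<close> to the \<open>p\<close>-adic integers,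
  and its kernel \<open>X\<close> is the intersection of the kernels. The quotient is torsion free like the \<open>p\<close>-adic
  integers. It is procyclic: if \<open>f\<close> is divisible by \<open>p\<^sup>k\<close> and \<open>f a\<close> is not divisible by \<open>p\<^bsup>k+1\<^esup>\<close>, then modulo
  every power of \<open>p\<close> each value of \<open>f\<close> is a multiple of \<open>f a\<close>.
\<close>

lemma padic_kernel:
  assumes p: "prime (p::nat)" and f: "\<And>k. character_mod (int p ^ Suc k) (f k)"
    and comp: "\<And>k x. x \<in> carrier G \<Longrightarrow> [f (Suc k) x = f k x] (mod int p ^ Suc k)"
  shows "tf_fg_kernel (\<Inter>k. kernel_mod (int p ^ Suc k) (f k))"
proof -
  define W where "W k = kernel_mod (int p ^ Suc k) (f k)" for k
  define X where "X = (\<Inter>k. W k)"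
  note W = kernel_mod[OF f, folded W_def]
  have comp': "[f (k + m) x = f k x] (mod int p ^ Suc k)" if x: "x \<in> carrier G" for k m x
  proof (induction m)
    case 0
    then show ?case by simp
  next
    case (Suc m)
    have "[f (k + Suc m) x = f (k + m) x] (mod int p ^ Suc (k + m))" using comp[OF x, of "k + m"] by simp
    then have "[f (k + Suc m) x = f (k + m) x] (mod int p ^ Suc k)"
      by (rule cong_dvd_modulus) (rule le_imp_power_dvd, simp)
    from cong_trans[OF this Suc] show ?case .
  qed
  have anti: "W (k + m) \<subseteq> W k" for k m
  proof
    fix x assume x: "x \<in> W (k + m)"
    then have "x \<in> carrier G" "int p ^ Suc (k + m) dvd f (k + m) x" unfolding W_def kernel_mod_def by auto
    then have "int p ^ Suc k dvd f (k + m) x" by (meson dvd_trans le_imp_power_dvd le_add1 Suc_le_mono)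
    then show "x \<in> W k" using comp'[OF \<open>x \<in> carrier G\<close>, of k m] \<open>x \<in> carrier G\<close>
      unfolding W_def kernel_mod_def by (simp add: cong_dvd_iff)
  qed
  have X: "subgroup X G" "closedin T X" "has_commutators X"
  proof -
    show "subgroup X G" unfolding X_def using W(1) by (intro subgroups_Inter) auto
    show "closedin T X" unfolding X_def using W(3) by (intro closedin_Inter) auto
    show "has_commutators X" unfolding X_def has_commutators_def
      using W(4) unfolding has_commutators_def by blast
  qed
  have tf: "torsion_free_mod X"
    unfolding torsion_free_mod_def
  proof (intro ballI allI impI)
    fix x and n :: nat assume x: "x \<in> carrier G" and n: "n > 0 \<and> x [^] n \<in> X"
    have "x \<in> W k" for k
    proof -
      have "additive_mod (int p ^ Suc (n + k)) G (carrier G) (f (n + k))"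
        using f unfolding character_mod_def by blast
      from additive_mod_nat_pow[OF this subgroup_self x, of n]
      have "[f (n + k) (x [^] n) = int n * f (n + k) x] (mod int p ^ Suc (n + k))" .
      moreover have "int p ^ Suc (n + k) dvd f (n + k) (x [^] n)"
        using n unfolding X_def W_def kernel_mod_def by blast
      ultimately have "int p ^ Suc (n + k) dvd int n * f (n + k) x" using cong_dvd_iff by blast
      then have "int p ^ Suc k dvd f (n + k) x" using prime_power_dvd_multiple_cancel[OF p] n by blast
      then show ?thesis using comp'[OF x, of k n] x unfolding W_def kernel_mod_def
        by (simp add: cong_dvd_iff add.commute)
    qed
    then show "x \<in> X" unfolding X_def by blast
  qed
  have fg: "fg_over X"
  proof (cases "X = carrier G")
    case True
    then have "topgen (X \<union> {}) = carrier G"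
      using topgen_incl[of "carrier G"] subgroup.subset[OF subgroup_topgen[of "carrier G"]] by auto
    then show ?thesis unfolding fg_over_def by blast
  next
    case False
    have Wc: "W k \<subseteq> carrier G" for k unfolding W_def kernel_mod_def by blast
    have ex: "\<exists>k. W k \<noteq> carrier G"
    proof (rule ccontr)
      assume "\<nexists>k. W k \<noteq> carrier G"
      then show False using False unfolding X_def by blast
    qed
    define k where "k = (LEAST k. W k \<noteq> carrier G)"
    have k: "W k \<noteq> carrier G" unfolding k_def using LeastI_ex[OF ex] .
    have less: "W i = carrier G" if "i < k" for i
      using not_less_Least[of i "\<lambda>k. W k \<noteq> carrier G"] that unfolding k_def by blast
    obtain a where a: "a \<in> carrier G" "a \<notin> W k" using k Wc by blast
    have dvd_all: "int p ^ k dvd f (k + m) x" if x: "x \<in> carrier G" for x m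
    proof (cases k)
      case 0
      then show ?thesis by simp
    next
      case (Suc i)
      then have "x \<in> W i" using less[of i] x by simp
      then have "int p ^ Suc i dvd f i x" unfolding W_def kernel_mod_def by blast
      then show ?thesis using comp'[OF x, of i "Suc m"] Suc by (simp add: cong_dvd_iff)
    qed
    define A where "A = topgen {a}"
    have A: "subgroup A G" "closedin T A" "a \<in> A"
      unfolding A_def using subgroup_topgen[of "{a}"] closedin_topgen topgen_incl[of "{a}"] a by auto
    have Ac: "A \<subseteq> carrier G" by (rule subgroup.subset[OF A(1)])
    have yAX: "y \<in> A <#> X" if y: "y \<in> carrier G" for y
    proof -
      have yW: "y \<in> A <#> W (k + m)" for m
      proof -
        let ?j = "k + m"
        have add: "additive_mod (int p ^ Suc ?j) G (carrier G) (f ?j)"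
          using f unfolding character_mod_def by blast
        obtain u where u: "f ?j a = int p ^ k * u" using dvd_all[OF a(1)] by blast
        obtain w where w: "f ?j y = int p ^ k * w" using dvd_all[OF y] by blast
        have "\<not> int p dvd u"
        proof
          assume "int p dvd u"
          then have "int p ^ Suc k dvd f ?j a" unfolding u by (simp add: mult.commute mult_dvd_mono)
          then have "int p ^ Suc k dvd f k a" using comp'[OF a(1), of k m] by (simp add: cong_dvd_iff)
          then show False using a unfolding W_def kernel_mod_def by blast
        qed
        then have "coprime u (int p ^ Suc ?j)"
          using p prime_imp_coprime[of "int p" u] by (simp add: coprime_commute)
        \<comment> \<open>the value at \<open>y\<close> is \<open>w v\<close> times the value at \<open>a\<close>, as \<open>v\<close> inverts \<open>u\<close>\<close>
        then obtain v where "[u * v = 1] (mod int p ^ Suc ?j)" using cong_solve_coprime_int by blast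
        then have "[int p ^ k * w * (u * v) = int p ^ k * w * 1] (mod int p ^ Suc ?j)"
          by (rule cong_scalar_left)
        then have i: "[(w * v) * f ?j a = f ?j y] (mod int p ^ Suc ?j)"
          unfolding u w by (simp add: algebra_simps)
        let ?b = "a [^] (w * v)"
        have b: "?b \<in> carrier G" "?b \<in> A" using a subgroup_int_pow_closed[OF A(1,3)] by auto
        have "[f ?j (inv ?b \<otimes> y) = f ?j (inv ?b) + f ?j y] (mod int p ^ Suc ?j)"
          using add b y unfolding additive_mod_def by simp
        also have "[f ?j (inv ?b) + f ?j y = - f ?j ?b + f ?j y] (mod int p ^ Suc ?j)"
          by (rule cong_add[OF additive_mod_inv[OF add subgroup_self b(1)] cong_refl])
        also have "[- f ?j ?b + f ?j y = - f ?j ?b + (w * v) * f ?j a] (mod int p ^ Suc ?j)"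
          by (rule cong_add[OF cong_refl cong_sym[OF i]])
        also have "[- f ?j ?b + (w * v) * f ?j a = - f ?j ?b + f ?j ?b] (mod int p ^ Suc ?j)"
          by (rule cong_add[OF cong_refl cong_sym[OF additive_mod_int_pow[OF add subgroup_self a(1)]]])
        finally have "inv ?b \<otimes> y \<in> W ?j"
          unfolding W_def kernel_mod_def using b y by (simp add: cong_0_iff)
        moreover have "y = ?b \<otimes> (inv ?b \<otimes> y)" using b y by simp
        ultimately show ?thesis unfolding set_mult_def using b by blast
      qed
      have "y \<in> A <#> \<Inter>(range (\<lambda>m. W (k + m)))"
      proof (rule mem_set_mult_Inter[OF A(2)])
        show "\<exists>V\<in>range (\<lambda>m. W (k + m)). V \<subseteq> V1 \<inter> V2"
          if V12: "V1 \<in> range (\<lambda>m. W (k + m))" "V2 \<in> range (\<lambda>m. W (k + m))" for V1 V2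
        proof -
          obtain m n where mn: "V1 = W (k + m)" "V2 = W (k + n)" using V12 by blast
          have "W (k + (m + n)) \<subseteq> V1 \<inter> V2"
            using anti[of "k + m" n] anti[of "k + n" m] unfolding mn by (simp add: ac_simps)
          then show ?thesis by blast
        qed
      qed (use W(3) yW in auto)
      also have "\<Inter>(range (\<lambda>m. W (k + m))) = X"
      proof
        show "\<Inter>(range (\<lambda>m. W (k + m))) \<subseteq> X"
          unfolding X_def using anti[of _ k] by (auto simp: add.commute)
        show "X \<subseteq> \<Inter>(range (\<lambda>m. W (k + m)))" unfolding X_def by blast
      qed
      finally show ?thesis .
    qed
    have sub: "X \<union> {a} \<subseteq> carrier G" using a subgroup.subset[OF X(1)] by blast
    have AG: "A \<subseteq> topgen (X \<union> {a})" unfolding A_def by (rule topgen_mono) blast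
    have "y \<in> topgen (X \<union> {a})" if y: "y \<in> carrier G" for y
    proof -
      obtain b x where bx: "b \<in> A" "x \<in> X" "y = b \<otimes> x" using yAX[OF y] unfolding set_mult_def by blast
      then show ?thesis unfolding bx(3) using AG topgen_incl[OF sub]
        by (intro subgroup.m_closed[OF subgroup_topgen[OF sub]]) auto
    qed
    then have "topgen (X \<union> {a}) = carrier G" using subgroup.subset[OF subgroup_topgen[OF sub]] by blast
    then show ?thesis unfolding fg_over_def using a by (intro exI[of _ "{a}"]) auto
  qed
  show ?thesis using X tf fg unfolding tf_fg_kernel_def X_def W_def by blast
qed

lemma ex_padic_kernel:
  assumes tf: "torsion_free_mod comm_closure" and p: "prime (p::nat)" and z: "z \<in> carrier G"
    and not_power: "\<And>x. x \<in> carrier G \<Longrightarrow> comm_closure #> z \<noteq> comm_closure #> x [^] p"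
  shows "\<exists>X. tf_fg_kernel X \<and> z \<notin> X"
proof -
  obtain psi where psi: "character_mod (int p) psi" "\<not> int p dvd psi z"
    using character_mod_separate[OF p z not_power] by blast
  have "\<exists>f. \<forall>k. (character_mod (int p ^ Suc k) (f k) \<and> (k = 0 \<longrightarrow> f k = psi)) \<and>
    (\<forall>x\<in>carrier G. [f (Suc k) x = f k x] (mod int p ^ Suc k))"
  proof (rule dependent_nat_choice)
    show "\<exists>x. character_mod (int p ^ Suc 0) x \<and> (0 = (0::nat) \<longrightarrow> x = psi)" using psi(1) by auto
    fix f :: "'a \<Rightarrow> int" and k :: nat
    assume "character_mod (int p ^ Suc k) f \<and> (k = 0 \<longrightarrow> f = psi)"
    then obtain g where "character_mod (int p ^ Suc (Suc k)) g"
      "\<And>x. x \<in> carrier G \<Longrightarrow> [g x = f x] (mod int p ^ Suc k)"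
      using character_mod_lift[OF tf p] by blast
    then show "\<exists>g. (character_mod (int p ^ Suc (Suc k)) g \<and> (Suc k = 0 \<longrightarrow> g = psi)) \<and>
      (\<forall>x\<in>carrier G. [g x = f x] (mod int p ^ Suc k))" by blast
  qed
  then obtain f where f: "\<And>k. character_mod (int p ^ Suc k) (f k)" "f 0 = psi"
    "\<And>k x. x \<in> carrier G \<Longrightarrow> [f (Suc k) x = f k x] (mod int p ^ Suc k)" by blast
  have "tf_fg_kernel (\<Inter>k. kernel_mod (int p ^ Suc k) (f k))" by (rule padic_kernel[OF p f(1,3)])
  moreover have "z \<notin> kernel_mod (int p ^ Suc 0) (f 0)" using psi(2) f(2) unfolding kernel_mod_def by simp
  ultimately show ?thesis by blast
qed

text \<open>
  Choose a prime \<open>p\<close> that divides \<open>M\<close>. Either \<open>z\<close> is not a \<open>p\<close>-th power in the abelianization, and then a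
  character modulo \<open>p\<close> is nonzero at \<open>z\<close> and lifts to the \<open>p\<close>-adic integers; or \<open>z\<close> is the \<open>p\<close>-th power of an element that is not an
  \<open>M/p\<close>-th power. As the quotients are torsion free, a kernel that avoids this element also avoids \<open>z\<close>.
\<close>

lemma ex_tf_fg_kernel_not_power:
  assumes tf: "torsion_free_mod comm_closure" and "M > 0" and "z \<in> carrier G"
    and "\<And>x. x \<in> carrier G \<Longrightarrow> comm_closure #> z \<noteq> comm_closure #> x [^] (M::nat)"
  shows "\<exists>X. tf_fg_kernel X \<and> z \<notin> X"
  using assms(2-)
proof (induction M arbitrary: z rule: less_induct)
  case (less M)
  let ?D = comm_closure
  interpret D: normal ?D G by (rule has_commutators_normal[OF comm_closure(1,3)])
  show ?case
  proof (cases "M = 1")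
    case True
    then show ?thesis using less.prems(3)[OF less.prems(2)] less.prems(2) by simp
  next
    case False
    then obtain p where p: "prime p" "p dvd M" using prime_factor_nat by blast
    then obtain M' where M': "M = p * M'" by blast
    have "M' > 0" "M' < M" using M' less.prems(1) prime_gt_1_nat[OF p(1)] by auto
    show ?thesis
    proof (cases "\<exists>x\<in>carrier G. ?D #> z = ?D #> x [^] p")
      case False
      then show ?thesis using ex_padic_kernel[OF tf p(1) less.prems(2)] by blast
    next
      case True
      then obtain x where x: "x \<in> carrier G" "?D #> z = ?D #> x [^] p" by blast
      have "?D #> x \<noteq> ?D #> y [^] M'" if y: "y \<in> carrier G" for y
      proof
        assume "?D #> x = ?D #> y [^] M'"
        then have "?D #> z = (?D #> y [^] M') [^]\<^bsub>G Mod ?D\<^esub> p"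
          using x by (simp flip: D.FactGroup_pow)
        also have "\<dots> = ?D #> y [^] M"
          using y by (simp add: D.FactGroup_pow nat_pow_pow M' mult.commute)
        finally show False using less.prems(3)[OF y] by blast
      qed
      then obtain X where X: "tf_fg_kernel X" "x \<notin> X"
        using less.IH[OF \<open>M' < M\<close> \<open>M' > 0\<close> x(1)] by blast
      have Xs: "subgroup X G" using X(1) unfolding tf_fg_kernel_def by blast
      have "?D \<subseteq> X" using X(1) comm_closure_minimal unfolding tf_fg_kernel_def by blast
      have "z \<notin> X"
      proof
        assume z: "z \<in> X"
        have zx: "z \<otimes> inv (x [^] p) \<in> X"
          using x less.prems(2) r_coset_eq_iff[OF comm_closure(1)] \<open>?D \<subseteq> X\<close> by auto
        have "inv (z \<otimes> inv (x [^] p)) \<otimes> z \<in> X"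
          by (rule subgroup.m_closed[OF Xs subgroup.m_inv_closed[OF Xs zx] z])
        then have "x [^] p \<in> X" using x(1) less.prems(2) by (simp add: inv_mult_group m_assoc)
        then show False
          using X x(1) prime_gt_0_nat[OF p(1)] unfolding tf_fg_kernel_def torsion_free_mod_def by blast
      qed
      then show ?thesis using X by blast
    qed
  qed
qed

text \<open>
  An element outside \<open>comm_closure\<close> is nontrivial in a finite abelian quotient, say of order \<open>M\<close>; there
  all \<open>M\<close>-th powers are trivial, so the element is not an \<open>M\<close>-th power.
\<close>

lemma ex_tf_fg_kernel:
  assumes tf: "torsion_free_mod comm_closure" and z: "z \<in> carrier G" "z \<notin> comm_closure"
  shows "\<exists>X. tf_fg_kernel X \<and> z \<notin> X"
proof -
  obtain U where U: "U \<lhd> G" "openin T U" "z \<notin> comm_closure <#> U"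
    using separate_closed[OF comm_closure(2) z] by blast
  define E where "E = comm_closure <#> U"
  note E = set_mult_open_commutators[OF comm_closure(1,3) U(1,2), folded E_def]
  interpret E: normal E G by (rule has_commutators_normal[OF E(1,3)])
  interpret Q: comm_group "G Mod E" by (rule has_commutators_comm_group[OF E(1,3)])
  let ?M = "order (G Mod E)"
  have "?M > 0" using finite_Mod_open[OF E(1,2)] Q.order_gt_0_iff_finite by blast
  moreover have "comm_closure #> z \<noteq> comm_closure #> x [^] ?M" if x: "x \<in> carrier G" for x
  proof
    assume "comm_closure #> z = comm_closure #> x [^] ?M"
    then have zx: "z \<otimes> inv (x [^] ?M) \<in> E"
      using x z(1) r_coset_eq_iff[OF comm_closure(1)] E(4) by auto
    have "E #> x [^] ?M = E"
      using Q.pow_order_eq_1[of "E #> x"] x by (simp add: E.FactGroup_pow carrier_FactGroup)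
    then have "x [^] ?M \<in> E" using rcos_self[OF nat_pow_closed[OF x] E(1)] by metis
    then have "(z \<otimes> inv (x [^] ?M)) \<otimes> x [^] ?M \<in> E" by (rule E.m_closed[OF zx])
    then show False using U(3) x z(1) unfolding E_def[symmetric] by (simp add: m_assoc)
  qed
  ultimately show ?thesis using ex_tf_fg_kernel_not_power[OF tf _ z(1)] by blast
qed

end

section \<open>Torsion free, virtually finitely generated abelian quotients\<close>

context profinite
begin

lemma tf_fg_kernel_Int:
  assumes "tf_fg_kernel X" "tf_fg_kernel Y"
  shows "tf_fg_kernel (X \<inter> Y)"
proof -
  have X: "subgroup X G" "closedin T X" "has_commutators X" "torsion_free_mod X" "fg_over X"
    and Y: "subgroup Y G" "closedin T Y" "has_commutators Y" "torsion_free_mod Y" "fg_over Y"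
    using assms unfolding tf_fg_kernel_def by blast+
  obtain S where S: "finite S" "S \<subseteq> carrier G" "topgen (X \<union> S) = carrier G" using X(5) unfolding fg_over_def by blast
  obtain R where R: "finite R" "R \<subseteq> carrier G" "topgen (Y \<union> R) = carrier G" using Y(5) unfolding fg_over_def by blast
  have Xc: "X \<subseteq> carrier G" by (rule subgroup.subset[OF X(1)])
  obtain S' where S': "finite S'" "S' \<subseteq> X" "X \<inter> topgen (Y \<union> R) = topgen ((X \<inter> Y) \<union> S')"
    using closed_subgroup_fg[OF Y(1-3) R(1,2) X(1,2)] by blast
  have "X = topgen ((X \<inter> Y) \<union> S')" using S'(3) R(3) Xc by auto
  then have "carrier G = topgen (topgen ((X \<inter> Y) \<union> S') \<union> S)" using S(3) by simp
  also have "\<dots> = topgen (((X \<inter> Y) \<union> S') \<union> S)"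
    using S'(2) S(2) Xc by (intro topgen_Un_topgen) auto
  finally have "topgen ((X \<inter> Y) \<union> (S' \<union> S)) = carrier G" by (simp add: Un_assoc)
  then have "fg_over (X \<inter> Y)"
    unfolding fg_over_def using S' S Xc by (intro exI[of _ "S' \<union> S"]) auto
  moreover have "subgroup (X \<inter> Y) G" by (rule subgroups_Inter_pair[OF X(1) Y(1)])
  moreover have "has_commutators (X \<inter> Y)" using X(3) Y(3) unfolding has_commutators_def by blast
  moreover have "torsion_free_mod (X \<inter> Y)" using X(4) Y(4) unfolding torsion_free_mod_def by (meson Int_iff)
  ultimately show ?thesis
    using closedin_Int[OF X(2) Y(2)] unfolding tf_fg_kernel_def by (intro conjI)
qed

lemma tf_fg_kernel_carrier: "tf_fg_kernel (carrier G)"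
proof -
  have "topgen (carrier G \<union> {}) = carrier G"
    using topgen_incl[of "carrier G"] subgroup.subset[OF subgroup_topgen[of "carrier G"]] by auto
  moreover have "closedin T (carrier G)" using closedin_topspace[of T] by (simp add: topspace_eq)
  ultimately show ?thesis
    unfolding tf_fg_kernel_def has_commutators_def torsion_free_mod_def fg_over_def
    using subgroup_self by (intro conjI exI[of _ "{}"]) simp_all
qed

lemma tf_fg_kernel_Inter:
  assumes "finite \<X>" "\<And>X. X \<in> \<X> \<Longrightarrow> tf_fg_kernel X"
  shows "tf_fg_kernel (carrier G \<inter> \<Inter>\<X>)"
  using assms
proof (induction rule: finite_induct)
  case empty
  then show ?case using tf_fg_kernel_carrier by simp
next
  case (insert X \<X>)
  have "carrier G \<inter> \<Inter>(insert X \<X>) = X \<inter> (carrier G \<inter> \<Inter>\<X>)" by blast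
  then show ?case using tf_fg_kernel_Int[of X "carrier G \<inter> \<Inter>\<X>"] insert by simp
qed

lemma tf_fg_kernel_image:
  assumes phi: "phi \<in> iso G G" and cont: "continuous_map T T phi" and X: "tf_fg_kernel X"
  shows "tf_fg_kernel (phi ` X)"
proof -
  interpret phi: group_hom G G phi
    by unfold_locales (use phi in \<open>auto simp: iso_def\<close>)
  have bij: "bij_betw phi (carrier G) (carrier G)" using phi by (simp add: iso_def)
  have X': "subgroup X G" "closedin T X" "has_commutators X" "torsion_free_mod X" "fg_over X"
    using X unfolding tf_fg_kernel_def by blast+
  have Xc: "X \<subseteq> carrier G" by (rule subgroup.subset[OF X'(1)])
  have mem: "phi x \<in> phi ` X \<longleftrightarrow> x \<in> X" if "x \<in> carrier G" for x
    using inj_on_image_mem_iff[OF bij_betw_imp_inj_on[OF bij] that Xc] .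
  have surj: "\<exists>x\<in>carrier G. y = phi x" if "y \<in> carrier G" for y
    using bij_betw_imp_surj_on[OF bij] that by blast
  have "has_commutators (phi ` X)"
    unfolding has_commutators_def
  proof (intro ballI)
    fix x y assume "x \<in> carrier G" "y \<in> carrier G"
    then obtain x' y' where x: "x' \<in> carrier G" "x = phi x'" and y: "y' \<in> carrier G" "y = phi y'"
      using surj[of x] surj[of y] by metis
    have "x \<otimes> y \<otimes> inv x \<otimes> inv y = phi (x' \<otimes> y' \<otimes> inv x' \<otimes> inv y')" using x y by simp
    then show "x \<otimes> y \<otimes> inv x \<otimes> inv y \<in> phi ` X" using X'(3) x y unfolding has_commutators_def by blast
  qed
  moreover have "torsion_free_mod (phi ` X)"
    unfolding torsion_free_mod_def
  proof (intro ballI allI impI)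
    fix x and n :: nat assume x: "x \<in> carrier G" and n: "n > 0 \<and> x [^] n \<in> phi ` X"
    obtain x' where x': "x' \<in> carrier G" "x = phi x'" using surj[OF x] by blast
    have "x [^] n = phi (x' [^] n)" using x' by (simp add: phi.hom_nat_pow)
    then have "x' [^] n \<in> X" using n mem[of "x' [^] n"] x' by simp
    then show "x \<in> phi ` X" using X'(4) n x' unfolding torsion_free_mod_def by blast
  qed
  moreover have "fg_over (phi ` X)"
  proof -
    obtain S where S: "finite S" "S \<subseteq> carrier G" "topgen (X \<union> S) = carrier G"
      using X'(5) unfolding fg_over_def by blast
    let ?P = "topgen (phi ` X \<union> phi ` S)"
    have sub: "phi ` X \<union> phi ` S \<subseteq> carrier G" using Xc S(2) by auto
    have P: "subgroup ?P G" by (rule subgroup_topgen[OF sub])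
    have "X \<union> S \<subseteq> {x \<in> carrier G. phi x \<in> ?P}" using topgen_incl[OF sub] Xc S(2) by blast
    moreover have "subgroup {x \<in> carrier G. phi x \<in> ?P} G"
    proof (rule subgroupI)
      show "{x \<in> carrier G. phi x \<in> ?P} \<noteq> {}" using subgroup.one_closed[OF P] phi.hom_one by force
    qed (use subgroup.m_closed[OF P] subgroup.m_inv_closed[OF P] in auto)
    moreover have "closedin T {x \<in> carrier G. phi x \<in> ?P}"
      by (rule closedin_preimage[OF cont closedin_topgen])
    ultimately have "topgen (X \<union> S) \<subseteq> {x \<in> carrier G. phi x \<in> ?P}" by (rule topgen_minimal)
    then have "carrier G \<subseteq> ?P" using S(3) surj by blast
    then have "?P = carrier G" using subgroup.subset[OF P] by blast
    then show ?thesis unfolding fg_over_def using S(1,2) by (intro exI[of _ "phi ` S"]) auto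
  qed
  ultimately show ?thesis
    unfolding tf_fg_kernel_def
    using phi.subgroup_img_is_subgroup[OF X'(1)] closedin_image[OF cont X'(2)] by blast
qed

lemma torsion_free_Mod_iff:
  assumes M: "M \<lhd> G"
  shows "torsion_free (G Mod M) \<longleftrightarrow> torsion_free_mod M"
proof -
  interpret M: normal M G by (rule M)
  have eq: "M #> x = M \<longleftrightarrow> x \<in> M" if "x \<in> carrier G" for x
    using rcos_self[OF that M.is_subgroup] M.rcos_const[OF is_group, of x] by blast
  show ?thesis
    unfolding torsion_free_def torsion_free_mod_def carrier_FactGroup
    by (simp add: M.FactGroup_pow eq)
qed

text \<open>
  The hypothesis speaks of closed subgroups as topological groups of their own, whereas \<open>frakV\<close> is
  about the ambient group. Closures agree in both because \<open>H\<close> is closed.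
\<close>

lemma topgen_consistent:
  assumes H: "subgroup H G" "closedin T H" and S: "S \<subseteq> H"
  shows "topological_group.topgen (G\<lparr>carrier := H\<rparr>) (subtopology T H) S = topgen S"
proof -
  interpret K: profinite "G\<lparr>carrier := H\<rparr>" "subtopology T H" by (rule profinite_closed_subgroup[OF H])
  have "generate G S \<subseteq> H" by (rule generate_subgroup_incl[OF S H(1)])
  then have "subtopology T H closure_of generate G S = H \<inter> T closure_of generate G S"
    by (simp add: closure_of_subtopology Int_absorb1)
  also have "\<dots> = topgen S" using topgen_minimal[OF S H] unfolding topgen_def by blast
  finally show ?thesis unfolding K.topgen_def generate_consistent[OF S H(1)] .
qed

lemma comm_closure_consistent:
  assumes H: "subgroup H G" "closedin T H"
  shows "profinite.comm_closure (G\<lparr>carrier := H\<rparr>) (subtopology T H) = T closure_of (derived G H)"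
proof -
  interpret K: profinite "G\<lparr>carrier := H\<rparr>" "subtopology T H" by (rule profinite_closed_subgroup[OF H])
  have le: "derived G H \<subseteq> H" by (rule derived_incl[OF subset_refl H(1)])
  have "subtopology T H closure_of derived G H = H \<inter> T closure_of derived G H"
    using le by (simp add: closure_of_subtopology Int_absorb1)
  also have "\<dots> = T closure_of derived G H" using closure_of_minimal[OF le H(2)] by blast
  finally show ?thesis unfolding K.comm_closure_def using derived_consistent[OF subset_refl H(1)] by simp
qed

lemma has_commutators_consistent:
  assumes "subgroup H G"
  shows "group.has_commutators (G\<lparr>carrier := H\<rparr>) M \<longleftrightarrow> (\<forall>x\<in>H. \<forall>y\<in>H. x \<otimes> y \<otimes> inv x \<otimes> inv y \<in> M)"
  by (simp add: group.has_commutators_def[OF subgroup_imp_group[OF assms]] m_inv_consistent[OF assms])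

lemma torsion_free_mod_consistent:
  assumes H: "subgroup H G" "closedin T H"
  shows "profinite.torsion_free_mod (G\<lparr>carrier := H\<rparr>) M \<longleftrightarrow> (\<forall>x\<in>H. \<forall>n::nat. n > 0 \<and> x [^] n \<in> M \<longrightarrow> x \<in> M)"
proof -
  interpret K: profinite "G\<lparr>carrier := H\<rparr>" "subtopology T H" by (rule profinite_closed_subgroup[OF H])
  show ?thesis unfolding K.torsion_free_mod_def by (simp flip: nat_pow_consistent)
qed

lemma weakly_ttf_torsion_free_mod:
  assumes wt: "weakly_totally_torsion_free G T" and N: "subgroup N G" "openin T N"
  shows "profinite.torsion_free_mod (G\<lparr>carrier := N\<rparr>) (profinite.comm_closure (G\<lparr>carrier := N\<rparr>) (subtopology T N))"
proof -
  have Nc: "closedin T N" by (rule closedin_open_subgroup[OF N])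
  interpret K: profinite "G\<lparr>carrier := N\<rparr>" "subtopology T N" by (rule profinite_closed_subgroup[OF N(1) Nc])
  have "closed_subgroup N G T" using N(1) Nc unfolding closed_subgroup_def by blast
  moreover have "finite_index N G" using finite_rcosets_open[OF N] unfolding finite_index_def .
  ultimately have "torsion_free (top_abelianization (G\<lparr>carrier := N\<rparr>) (subtopology T N))"
    using wt unfolding weakly_totally_torsion_free_def by blast
  then show ?thesis
    using K.torsion_free_Mod_iff[OF K.has_commutators_normal[OF K.comm_closure(1,3)]]
    unfolding top_abelianization_def K.comm_closure_def by simp
qed

text \<open>
  If \<open>y\<^sup>n\<close> is a limit of products of commutators of \<open>N\<close>, then \<open>y\<close> is torsion, and therefore trivial,
  in the abelianization of the open subgroup \<open>H\<close> generated by \<open>y\<close> and \<open>N\<close>. As \<open>H/N\<close> is cyclic, the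
  commutators of \<open>H\<close> lie in \<open>N\<close>, so \<open>y \<in> N\<close>.
\<close>

lemma weakly_ttf_pow_not_in_comm_closure:
  assumes wt: "weakly_totally_torsion_free G T" and N: "N \<lhd> G" "openin T N"
    and y: "y \<in> carrier G" "y \<notin> N" and n: "n > 0"
  shows "y [^] (n::nat) \<notin> T closure_of (derived G N)"
proof
  assume yn: "y [^] n \<in> T closure_of (derived G N)"
  interpret N: normal N G by (rule N(1))
  define H where "H = {x \<in> carrier G. N #> x \<in> range (\<lambda>i::int. (N #> y) [^]\<^bsub>G Mod N\<^esub> i)}"
  note H = N.preimage_powers[OF y(1), folded H_def]
  have Ho: "openin T H" using openin_subgroup_if_openin[OF H(1) N(2) N.one_closed] H(2) by blast
  have Hc: "closedin T H" by (rule closedin_open_subgroup[OF H(1) Ho])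
  have Nc: "closedin T N" by (rule closedin_open_subgroup[OF N.is_subgroup N(2)])
  interpret K: profinite "G\<lparr>carrier := H\<rparr>" "subtopology T H" by (rule profinite_closed_subgroup[OF H(1) Hc])
  have "K.torsion_free_mod K.comm_closure" by (rule weakly_ttf_torsion_free_mod[OF wt H(1) Ho])
  moreover have "y [^] n \<in> K.comm_closure"
    unfolding comm_closure_consistent[OF H(1) Hc]
    using yn closure_of_mono[OF mono_derived[of N H]] H(2) by blast
  ultimately have "y \<in> K.comm_closure"
    using torsion_free_mod_consistent[OF H(1) Hc] H(2) n by blast
  moreover have "K.comm_closure \<subseteq> N"
  proof (rule K.comm_closure_minimal)
    show "subgroup N (G\<lparr>carrier := H\<rparr>)" using H(2) by (intro subgroup_incl[OF N.is_subgroup H(1)]) blast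
    show "closedin (subtopology T H) N" using Nc H(2) by (intro closedin_subset_topspace) auto
    show "K.has_commutators N" unfolding has_commutators_consistent[OF H(1)] using H(3) by blast
  qed
  ultimately show False using y(2) by blast
qed

text \<open>
  Membership in \<open>frakV\<close>, expressed by subgroups of \<open>G\<close> (see \<open>frakV_iff\<close>): \<open>B\<close> is the preimage of a
  finitely generated abelian subgroup of finite index in \<open>G/K\<close>, and \<open>S\<close> represents generators.
\<close>

definition virtual_kernel :: "'a set \<Rightarrow> bool" where
  "virtual_kernel K \<longleftrightarrow> K \<lhd> G \<and> closedin T K \<and> torsion_free_mod K \<and>
     (\<exists>B S. subgroup B G \<and> closedin T B \<and> finite_index B G \<and> K \<subseteq> B \<and>
        (\<forall>x\<in>B. \<forall>y\<in>B. x \<otimes> y \<otimes> inv x \<otimes> inv y \<in> K) \<and>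
        finite S \<and> S \<subseteq> B \<and> topgen (K \<union> S) = B)"

text \<open>
  Since \<open>N/X\<close> is abelian, \<open>N\<close> normalizes \<open>X\<close>. So \<open>X\<close> has only finitely many conjugates, and its normal core
  is a finite intersection of kernels of the same kind.
\<close>

lemma tf_fg_kernel_core:
  assumes N: "N \<lhd> G" "openin T N"
    and X: "profinite.tf_fg_kernel (G\<lparr>carrier := N\<rparr>) (subtopology T N) X"
  obtains K where "K \<lhd> G" "K \<subseteq> X" "profinite.tf_fg_kernel (G\<lparr>carrier := N\<rparr>) (subtopology T N) K"
proof -
  interpret N: normal N G by (rule N(1))
  have Nc: "closedin T N" by (rule closedin_open_subgroup[OF N.is_subgroup N(2)])
  interpret L: profinite "G\<lparr>carrier := N\<rparr>" "subtopology T N" by (rule profinite_closed_subgroup[OF N.is_subgroup Nc])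
  define conj where "conj g x = g \<otimes> x \<otimes> inv g" for g x
  have XN: "X \<subseteq> N" using X subgroup.subset unfolding L.tf_fg_kernel_def by fastforce
  have Xc: "X \<subseteq> carrier G" using XN N.subset by blast
  have X_normal: "X \<lhd> G\<lparr>carrier := N\<rparr>"
    using X L.has_commutators_normal unfolding L.tf_fg_kernel_def by blast
  have conj_N: "conj g x \<in> N" if "g \<in> carrier G" "x \<in> N" for g x
    unfolding conj_def by (rule N.inv_op_closed2[OF that])
  have conj_conj: "conj g (conj h x) = conj (g \<otimes> h) x" if "g \<in> carrier G" "h \<in> carrier G" "x \<in> carrier G" for g h x
    unfolding conj_def using that by (simp add: inv_mult_group m_assoc)
  have conj_one: "conj \<one> x = x" if "x \<in> carrier G" for x unfolding conj_def using that by simp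
  have conj_cok: "L.tf_fg_kernel (conj g ` Y)" if g: "g \<in> carrier G" and Y: "L.tf_fg_kernel Y" for g Y
  proof (rule L.tf_fg_kernel_image[OF _ _ Y])
    have "bij_betw (conj g) N N"
    proof (rule bij_betw_byWitness[of _ "conj (inv g)"])
      show "\<forall>x\<in>N. conj (inv g) (conj g x) = x" "\<forall>x\<in>N. conj g (conj (inv g) x) = x"
        using g N.subset by (auto simp: conj_conj conj_one subset_iff)
    qed (use conj_N g in auto)
    moreover have "conj g (x \<otimes> y) = conj g x \<otimes> conj g y" if "x \<in> N" "y \<in> N" for x y
      unfolding conj_def using g that by (simp add: m_assoc)
    ultimately show "conj g \<in> iso (G\<lparr>carrier := N\<rparr>) (G\<lparr>carrier := N\<rparr>)"
      unfolding iso_def hom_def using conj_N[OF g] by auto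
    have "continuous_map T T (conj g)" unfolding conj_def using g by (intro continuous_intros) auto
    then show "continuous_map (subtopology T N) (subtopology T N) (conj g)"
      using conj_N[OF g] by (auto simp: continuous_map_in_subtopology continuous_map_from_subtopology)
  qed
  have conj_n: "conj n ` X = X" if n: "n \<in> N" for n
  proof
    have le: "conj m ` X \<subseteq> X" if m: "m \<in> N" for m
    proof
      fix x assume "x \<in> conj m ` X"
      then obtain x' where x': "x' \<in> X" "x = m \<otimes> x' \<otimes> inv m" unfolding conj_def by blast
      then show "x \<in> X" using normal.inv_op_closed2[OF X_normal, of m x'] m
        by (simp add: m_inv_consistent[OF N.is_subgroup])
    qed
    show "conj n ` X \<subseteq> X" by (rule le[OF n])
    show "X \<subseteq> conj n ` X"
    proof
      fix x assume x: "x \<in> X"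
      have "conj (inv n) x \<in> X" using le[of "inv n"] n x by auto
      moreover have "x = conj n (conj (inv n) x)" using x Xc n by (auto simp: conj_conj conj_one)
      ultimately show "x \<in> conj n ` X" by blast
    qed
  qed
  \<comment> \<open>a conjugate of \<open>X\<close> depends only on the coset of the conjugating element, by \<open>conj_n\<close>\<close>
  define \<X> where "\<X> = (\<lambda>g. conj g ` X) ` carrier G"
  have "\<X> \<subseteq> (\<lambda>C. conj (SOME g. g \<in> C) ` X) ` (rcosets (N))"
  proof
    fix Y assume "Y \<in> \<X>"
    then obtain g where g: "g \<in> carrier G" "Y = conj g ` X" unfolding \<X>_def by blast
    have ig: "inv g \<in> carrier G" using g by simp
    have "g \<in> N #> g" by (rule rcos_self[OF g(1) N.is_subgroup])
    then have "(SOME h. h \<in> N #> g) \<in> N #> g" by (rule someI)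
    then obtain n where n: "n \<in> N" "(SOME h. h \<in> N #> g) = n \<otimes> g" unfolding r_coset_def by blast
    have "n \<otimes> g = g \<otimes> (inv g \<otimes> n \<otimes> g)" using n g by (simp add: m_assoc)
    moreover have n': "inv g \<otimes> n \<otimes> g \<in> N" using N.inv_op_closed1[OF g(1) n(1)] .
    ultimately have "conj (n \<otimes> g) ` X = conj g ` (conj (inv g \<otimes> n \<otimes> g) ` X)"
      using g(1) Xc N.subset by (auto simp: image_image conj_conj subset_iff intro!: image_cong)
    also have "\<dots> = Y" using conj_n[OF n'] g(2) by simp
    finally show "Y \<in> (\<lambda>C. conj (SOME g. g \<in> C) ` X) ` (rcosets N)"
      unfolding n(2)[symmetric] by (intro image_eqI[OF _ rcosetsI[OF N.subset g(1)]]) simp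
  qed
  then have fin: "finite \<X>" using finite_rcosets_open[OF N.is_subgroup N(2)] finite_surj by blast
  define K where "K = N \<inter> \<Inter>\<X>"
  have cok: "L.tf_fg_kernel K"
    using L.tf_fg_kernel_Inter[OF fin] conj_cok X unfolding K_def \<X>_def by auto
  have "K \<subseteq> X"
  proof
    fix x assume "x \<in> K"
    then have "x \<in> conj \<one> ` X" unfolding K_def \<X>_def by blast
    then show "x \<in> X" using Xc conj_one by auto
  qed
  moreover have "K \<lhd> G"
  proof (rule normal_invI)
    have "subgroup K (G\<lparr>carrier := N\<rparr>)" using cok unfolding L.tf_fg_kernel_def by blast
    then show "subgroup K G" by (rule incl_subgroup[OF N.is_subgroup])
    fix g x assume g: "g \<in> carrier G" and x: "x \<in> K"
    have xN: "x \<in> N" using x unfolding K_def by blast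
    have "conj g x \<in> conj h ` X" if h: "h \<in> carrier G" for h
    proof -
      have "x \<in> conj (inv g \<otimes> h) ` X" using x g h unfolding K_def \<X>_def by blast
      then obtain x' where x': "x' \<in> X" "x = conj (inv g \<otimes> h) x'" by blast
      then have "conj g x = conj h x'" using g h Xc by (auto simp: conj_conj subset_iff)
      then show ?thesis using x' by blast
    qed
    then show "g \<otimes> x \<otimes> inv g \<in> K" using conj_N[OF g xN] unfolding K_def \<X>_def conj_def by blast
  qed
  ultimately show thesis using that cok by blast
qed

text \<open>
  For the index \<open>m\<close> of \<open>N\<close>, the \<open>m\<close>-th powers of the elements outside \<open>N\<close> form a compact subset \<open>Z\<close> of \<open>N\<close>.
  It is disjoint from the closure of the commutator subgroup of \<open>N\<close>, so a finite intersection of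
  kernels avoids it. An element outside \<open>N\<close> then cannot be torsion modulo \<open>K\<close>, since its \<open>m\<close>-th power is not.
\<close>

lemma ex_virtual_kernel:
  assumes wt: "weakly_totally_torsion_free G T" and N: "N \<lhd> G" "openin T N"
  shows "\<exists>K\<subseteq>N. virtual_kernel K"
proof -
  interpret N: normal N G by (rule N(1))
  have Nc: "closedin T N" by (rule closedin_open_subgroup[OF N.is_subgroup N(2)])
  interpret L: profinite "G\<lparr>carrier := N\<rparr>" "subtopology T N" by (rule profinite_closed_subgroup[OF N.is_subgroup Nc])
  interpret Q: group "G Mod N" by (rule N.factorgroup_is_group)
  define m where "m = order (G Mod N)"
  have m: "m > 0" unfolding m_def using finite_Mod_open[OF N.is_subgroup N(2)] Q.order_gt_0_iff_finite by blast
  have pow_N: "x [^] m \<in> N" if x: "x \<in> carrier G" for x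
  proof -
    have "N #> x [^] m = N"
      using Q.pow_order_eq_1[of "N #> x"] x unfolding m_def by (simp add: N.FactGroup_pow carrier_FactGroup)
    then show ?thesis using rcos_self[OF nat_pow_closed[OF x] N.is_subgroup] by metis
  qed
  define Z where "Z = (\<lambda>x. x [^] m) ` (carrier G - N)"
  have "closedin T (carrier G - N)" using N(2) by (metis openin_closedin_eq topspace_eq)
  then have "closedin T Z" unfolding Z_def by (intro closedin_image continuous_intros)
  then have cZ: "compactin T Z" by (rule closedin_compact_space[OF compact])
  have ex: "\<exists>X. L.tf_fg_kernel X \<and> z \<notin> X" if z: "z \<in> Z" for z
  proof (rule L.ex_tf_fg_kernel[OF weakly_ttf_torsion_free_mod[OF wt N.is_subgroup N(2)]])
    obtain y where y: "y \<in> carrier G" "y \<notin> N" "z = y [^] m" using z unfolding Z_def by blast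
    show "z \<in> carrier (G\<lparr>carrier := N\<rparr>)" using pow_N y by simp
    show "z \<notin> L.comm_closure"
      unfolding comm_closure_consistent[OF N.is_subgroup Nc] y(3)
      by (rule weakly_ttf_pow_not_in_comm_closure[OF wt N y(1,2) m])
  qed
  define \<U> where "\<U> = {carrier G - X |X. L.tf_fg_kernel X}"
  have closedX: "closedin T X" if "L.tf_fg_kernel X" for X
    using that closedin_trans_full[OF _ Nc] unfolding L.tf_fg_kernel_def by blast
  have "Z \<subseteq> \<Union>\<U>"
  proof
    fix z assume z: "z \<in> Z"
    then obtain X where "L.tf_fg_kernel X" "z \<notin> X" using ex by blast
    moreover have "z \<in> carrier G" using z compactin_subset_topspace[OF cZ] topspace_eq by auto
    ultimately show "z \<in> \<Union>\<U>" unfolding \<U>_def by blast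
  qed
  moreover have "openin T U" if "U \<in> \<U>" for U
    using that closedX unfolding \<U>_def by (auto simp: closedin_def topspace_eq)
  ultimately obtain \<F> where \<F>: "finite \<F>" "\<F> \<subseteq> \<U>" "Z \<subseteq> \<Union>\<F>" using compactinD[OF cZ, of \<U>] by blast
  define \<X> where "\<X> = (\<lambda>U. carrier G - U) ` \<F>"
  have \<X>: "L.tf_fg_kernel X" if X: "X \<in> \<X>" for X
  proof -
    obtain Y where Y: "L.tf_fg_kernel Y" "X = carrier G - (carrier G - Y)"
      using X \<F>(2) unfolding \<X>_def \<U>_def by blast
    moreover have "Y \<subseteq> carrier G" using closedin_subset[OF closedX[OF Y(1)]] topspace_eq by simp
    ultimately show ?thesis by (simp add: double_diff)
  qed
  have "finite \<X>" unfolding \<X>_def using \<F>(1) by blast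
  from L.tf_fg_kernel_Inter[OF this \<X>]
  have "L.tf_fg_kernel (N \<inter> \<Inter>\<X>)" by simp
  then obtain K where K: "K \<lhd> G" "K \<subseteq> N \<inter> \<Inter>\<X>" "L.tf_fg_kernel K"
    using tf_fg_kernel_core[OF N] by blast
  have ZK: "z \<notin> K" if "z \<in> Z" for z using that \<F>(3) K(2) unfolding \<X>_def by blast
  have L: "K \<subseteq> N" "L.has_commutators K" "L.torsion_free_mod K" "L.fg_over K"
    using K unfolding L.tf_fg_kernel_def by blast+
  have "torsion_free_mod K"
    unfolding torsion_free_mod_def
  proof (intro ballI allI impI)
    fix x and n :: nat assume x: "x \<in> carrier G" and n: "n > 0 \<and> x [^] n \<in> K"
    have tfN: "w \<in> K" if "w \<in> N" "w [^] n \<in> K" for w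
      using L(3) that n torsion_free_mod_consistent[OF N.is_subgroup Nc] by blast
    show "x \<in> K"
    proof (cases "x \<in> N")
      case True
      then show ?thesis using tfN n by blast
    next
      case False
      then have "x [^] m \<in> Z" unfolding Z_def using x by blast
      moreover have "(x [^] m) [^] n = (x [^] n) [^] m" using x by (simp add: nat_pow_pow mult.commute)
      then have "(x [^] m) [^] n \<in> K"
        using n subgroup_nat_pow_closed[OF normal_imp_subgroup[OF K(1)]] by simp
      then have "x [^] m \<in> K" using tfN pow_N[OF x] by blast
      ultimately show ?thesis using ZK by blast
    qed
  qed
  moreover obtain S where S: "finite S" "S \<subseteq> N" "L.topgen (K \<union> S) = N"
    using L(4) unfolding L.fg_over_def by auto
  have "topgen (K \<union> S) = N" using S topgen_consistent[OF N.is_subgroup Nc, of "K \<union> S"] L(1) by simp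
  moreover have "finite_index N G" using finite_rcosets_open[OF N.is_subgroup N(2)] unfolding finite_index_def .
  moreover have "\<forall>x\<in>N. \<forall>y\<in>N. x \<otimes> y \<otimes> inv x \<otimes> inv y \<in> K"
    using L(2) unfolding has_commutators_consistent[OF N.is_subgroup] .
  ultimately have "virtual_kernel K"
    unfolding virtual_kernel_def
    using K(1) closedX[OF K(3)] N.is_subgroup Nc L(1) S(1,2) by blast
  then show ?thesis using L(1) by blast
qed

lemma finite_rcosets_Int:
  assumes B: "subgroup B G" and C: "subgroup C G" and fin: "finite (rcosets B)" "finite (rcosets C)"
  shows "finite (rcosets (B \<inter> C))"
proof (rule finite_subset)
  show "rcosets (B \<inter> C) \<subseteq> (\<lambda>(D, E). D \<inter> E) ` ((rcosets B) \<times> (rcosets C))"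
  proof
    fix D assume "D \<in> rcosets (B \<inter> C)"
    then obtain x where x: "x \<in> carrier G" "D = (B \<inter> C) #> x" unfolding RCOSETS_def by blast
    have "(B \<inter> C) #> x = (B #> x) \<inter> (C #> x)"
    proof (intro equalityI subsetI IntI)
      fix y assume y: "y \<in> (B #> x) \<inter> (C #> x)"
      then obtain b c where bc: "b \<in> B" "c \<in> C" "y = b \<otimes> x" "y = c \<otimes> x" unfolding r_coset_def by blast
      then have "b = c" using x(1) subgroup.mem_carrier[OF B] subgroup.mem_carrier[OF C] by (metis right_cancel)
      then show "y \<in> (B \<inter> C) #> x" using bc unfolding r_coset_def by blast
    qed (auto simp: r_coset_def)
    then show "D \<in> (\<lambda>(D, E). D \<inter> E) ` ((rcosets B) \<times> (rcosets C))"
      using x rcosetsI[OF subgroup.subset[OF B] x(1)] rcosetsI[OF subgroup.subset[OF C] x(1)] by auto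
  qed
qed (use fin in auto)

text \<open>
  Let \<open>B/K\<close> and \<open>C/L\<close> be finitely generated abelian. The group \<open>B \<inter> C\<close> is finitely generated modulo \<open>K \<inter> L\<close>
  in two layers: modulo \<open>K \<inter> C\<close> as a closed subgroup of \<open>B/K\<close>, and \<open>K \<inter> C\<close> modulo \<open>K \<inter> L\<close> as
  a closed subgroup of \<open>C/L\<close>.
\<close>

lemma virtual_kernel_Int:
  assumes "virtual_kernel K" "virtual_kernel L"
  shows "virtual_kernel (K \<inter> L)"
proof -
  obtain B S where K: "K \<lhd> G" "closedin T K" "torsion_free_mod K"
    and B: "subgroup B G" "closedin T B" "finite_index B G" "K \<subseteq> B"
      "\<And>x y. \<lbrakk>x \<in> B; y \<in> B\<rbrakk> \<Longrightarrow> x \<otimes> y \<otimes> inv x \<otimes> inv y \<in> K"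
    and S: "finite S" "S \<subseteq> B" "topgen (K \<union> S) = B"
    using assms(1) unfolding virtual_kernel_def by auto
  obtain C R where L: "L \<lhd> G" "closedin T L" "torsion_free_mod L"
    and C: "subgroup C G" "closedin T C" "finite_index C G" "L \<subseteq> C"
      "\<And>x y. \<lbrakk>x \<in> C; y \<in> C\<rbrakk> \<Longrightarrow> x \<otimes> y \<otimes> inv x \<otimes> inv y \<in> L"
    and R: "finite R" "R \<subseteq> C" "topgen (L \<union> R) = C"
    using assms(2) unfolding virtual_kernel_def by auto
  have Bc: "B \<subseteq> carrier G" and Cc: "C \<subseteq> carrier G" using subgroup.subset B(1) C(1) by blast+
  have fg: "\<exists>S'. finite S' \<and> S' \<subseteq> Y \<and> Y \<inter> B = topgen ((Y \<inter> K) \<union> S')"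
    if B: "subgroup B G" "closedin T B" "K \<subseteq> B" "\<And>x y. \<lbrakk>x \<in> B; y \<in> B\<rbrakk> \<Longrightarrow> x \<otimes> y \<otimes> inv x \<otimes> inv y \<in> K"
      and S: "finite S" "S \<subseteq> B" "topgen (K \<union> S) = B" and K: "subgroup K G" "closedin T K"
      and Y: "subgroup Y G" "closedin T Y" for B K S Y
  proof -
    interpret H: profinite "G\<lparr>carrier := B\<rparr>" "subtopology T B" by (rule profinite_closed_subgroup[OF B(1,2)])
    have "subgroup K (G\<lparr>carrier := B\<rparr>)" by (rule subgroup_incl[OF K(1) B(1,3)])
    moreover have "closedin (subtopology T B) K" using K(2) B(3) by (intro closedin_subset_topspace) auto
    moreover have "H.has_commutators K" unfolding has_commutators_consistent[OF B(1)] using B(4) by blast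
    moreover have "S \<subseteq> carrier (G\<lparr>carrier := B\<rparr>)" using S(2) by simp
    moreover have "subgroup (Y \<inter> B) (G\<lparr>carrier := B\<rparr>)"
      by (rule subgroup_incl[OF subgroups_Inter_pair[OF Y(1) B(1)] B(1)]) blast
    moreover have "closedin (subtopology T B) (Y \<inter> B)"
      using closedin_Int[OF Y(2) B(2)] by (intro closedin_subset_topspace) auto
    ultimately obtain S' where S': "finite S'" "S' \<subseteq> Y \<inter> B"
      "(Y \<inter> B) \<inter> H.topgen (K \<union> S) = H.topgen (((Y \<inter> B) \<inter> K) \<union> S')"
      using H.closed_subgroup_fg[of K S "Y \<inter> B"] S(1) by blast
    have "(Y \<inter> B) \<inter> K = Y \<inter> K" using B(3) by blast
    moreover have "H.topgen (K \<union> S) = B" using topgen_consistent[OF B(1,2), of "K \<union> S"] B(3) S by simp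
    moreover have "H.topgen ((Y \<inter> K) \<union> S') = topgen ((Y \<inter> K) \<union> S')"
      using S'(2) B(3) by (intro topgen_consistent[OF B(1,2)]) auto
    ultimately show ?thesis using S' by auto
  qed
  obtain S1 where S1: "finite S1" "S1 \<subseteq> C" "C \<inter> B = topgen ((C \<inter> K) \<union> S1)"
    using fg[OF B(1,2,4,5) S normal_imp_subgroup[OF K(1)] K(2) C(1,2)] by blast
  obtain S2 where S2: "finite S2" "S2 \<subseteq> K" "K \<inter> C = topgen ((K \<inter> L) \<union> S2)"
    using fg[OF C(1,2,4,5) R normal_imp_subgroup[OF L(1)] L(2) normal_imp_subgroup[OF K(1)] K(2)] by blast
  have Kc: "K \<subseteq> carrier G" using B(4) Bc by blast
  have "B \<inter> C = topgen (topgen ((K \<inter> L) \<union> S2) \<union> S1)" using S1(3) S2(3) by (simp add: Int_commute)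
  also have "\<dots> = topgen (((K \<inter> L) \<union> S2) \<union> S1)"
    using S1(2) S2(2) Kc Cc by (intro topgen_Un_topgen) auto
  finally have eq: "topgen ((K \<inter> L) \<union> (S2 \<union> S1)) = B \<inter> C" by (simp add: Un_assoc)
  have "(K \<inter> L) \<union> (S2 \<union> S1) \<subseteq> topgen ((K \<inter> L) \<union> (S2 \<union> S1))"
    using S1(2) S2(2) Kc Cc by (intro topgen_incl) auto
  then have sub: "S2 \<union> S1 \<subseteq> B \<inter> C" unfolding eq by blast
  have "finite_index (B \<inter> C) G"
    using B(3) C(3) unfolding finite_index_def by (rule finite_rcosets_Int[OF B(1) C(1)])
  moreover have "torsion_free_mod (K \<inter> L)" using K(3) L(3) unfolding torsion_free_mod_def by blast
  moreover have "\<forall>x\<in>B \<inter> C. \<forall>y\<in>B \<inter> C. x \<otimes> y \<otimes> inv x \<otimes> inv y \<in> K \<inter> L" using B(5) C(5) by blast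
  moreover have "K \<inter> L \<lhd> G" by (rule normal_subgroup_intersect[OF K(1) L(1)])
  moreover have "subgroup (B \<inter> C) G" by (rule subgroups_Inter_pair[OF B(1) C(1)])
  moreover have "closedin T (K \<inter> L)" "closedin T (B \<inter> C)" using K L B C by (auto intro: closedin_Int)
  moreover have "K \<inter> L \<subseteq> B \<inter> C" using B(4) C(4) by blast
  moreover have "finite (S2 \<union> S1)" using S1(1) S2(1) by blast
  ultimately show ?thesis unfolding virtual_kernel_def using eq sub by blast
qed

end

section \<open>Quotients of profinite groups\<close>

context profinite
begin

lemma quotient_map_Mod: "quotient_map T (quotient_group_topology G T K) (\<lambda>x. K #> x)"
  unfolding quotient_group_topology_def by (rule quotient_map_quotient_topology)

lemma topspace_Mod: "topspace (quotient_group_topology G T K) = carrier (G Mod K)"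
  unfolding quotient_group_topology_def by (simp add: topspace_eq carrier_FactGroup)

lemma open_map_Mod:
  assumes K: "K \<lhd> G"
  shows "open_map T (quotient_group_topology G T K) (\<lambda>x. K #> x)"
  unfolding open_map_def
proof (intro allI impI)
  fix U assume U: "openin T U"
  interpret K: normal K G by (rule K)
  have Uc: "U \<subseteq> carrier G" using openin_subset[OF U] by (simp add: topspace_eq)
  have "{x \<in> topspace T. K #> x \<in> (\<lambda>x. K #> x) ` U} = (\<Union>k\<in>K. {x \<in> carrier G. k \<otimes> x \<in> U})"
  proof (intro equalityI subsetI)
    fix x assume "x \<in> {x \<in> topspace T. K #> x \<in> (\<lambda>x. K #> x) ` U}"
    then obtain u where u: "u \<in> U" "K #> u = K #> x" "x \<in> carrier G" by (auto simp: topspace_eq)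
    then have "u \<otimes> inv x \<in> K" using Uc r_coset_eq_iff[OF K.is_subgroup, of u x] by blast
    moreover have "(u \<otimes> inv x) \<otimes> x = u" using u Uc by (auto simp: m_assoc)
    ultimately show "x \<in> (\<Union>k\<in>K. {x \<in> carrier G. k \<otimes> x \<in> U})" using u by force
  next
    fix x assume "x \<in> (\<Union>k\<in>K. {x \<in> carrier G. k \<otimes> x \<in> U})"
    then obtain k where k: "k \<in> K" "x \<in> carrier G" "k \<otimes> x \<in> U" by blast
    have "(k \<otimes> x) \<otimes> inv x \<in> K" using k K.mem_carrier by (simp add: m_assoc)
    then have "K #> (k \<otimes> x) = K #> x"
      using k K.mem_carrier r_coset_eq_iff[OF K.is_subgroup, of "k \<otimes> x" x] by simp
    then have "K #> x \<in> (\<lambda>x. K #> x) ` U" using k(3) by (metis imageI)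
    then show "x \<in> {x \<in> topspace T. K #> x \<in> (\<lambda>x. K #> x) ` U}" using k(2) by (simp add: topspace_eq)
  qed
  moreover have "openin T (\<Union>k\<in>K. {x \<in> carrier G. k \<otimes> x \<in> U})"
    using U K.subset by (intro openin_Union ballI) (auto intro!: openin_preimage continuous_intros)
  ultimately have "openin T {x \<in> topspace T. K #> x \<in> (\<lambda>x. K #> x) ` U}" by simp
  moreover have "(\<lambda>x. K #> x) ` U \<subseteq> topspace (quotient_group_topology G T K)"
    using Uc unfolding topspace_Mod carrier_FactGroup by blast
  ultimately show "openin (quotient_group_topology G T K) ((\<lambda>x. K #> x) ` U)"
    using quotient_map_Mod unfolding quotient_map_def by blast
qed

text \<open>
  Multiplication is continuous on \<open>G/K\<close> because \<open>G \<times> G \<rightarrow> G/K \<times> G/K\<close> is a quotient map, being a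
  continuous surjection from a compact space to a Hausdorff space.
\<close>

lemma profinite_Mod:
  assumes K: "K \<lhd> G" "closedin T K"
  shows "profinite (G Mod K) (quotient_group_topology G T K)"
proof -
  let ?Q = "G Mod K" and ?TQ = "quotient_group_topology G T K"
  interpret K: normal K G by (rule K(1))
  interpret Q: group ?Q by (rule K.factorgroup_is_group)
  interpret pi: group_hom G ?Q "\<lambda>x. K #> x" by unfold_locales (rule K.r_coset_hom_Mod)
  have qm: "quotient_map T ?TQ (\<lambda>x. K #> x)" by (rule quotient_map_Mod)
  have cont: "continuous_map T ?TQ (\<lambda>x. K #> x)" by (rule quotient_imp_continuous_map[OF qm])
  have sep: "\<exists>M. subgroup M G \<and> openin T M \<and> K \<subseteq> M \<and> x \<notin> M" if x: "x \<in> carrier G" "x \<notin> K" for x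
  proof -
    obtain U where U: "U \<lhd> G" "openin T U" "x \<notin> K <#> U" using separate_closed[OF K(2) x] by blast
    then show ?thesis using set_mult_open_normal[OF K(1) U(1,2)] by blast
  qed
  have compQ: "compact_space ?TQ"
    using image_compactin[OF _ cont, of "topspace T"] compact quotient_imp_surjective_map[OF qm]
    by (simp add: compact_space_def)
  have HausQ: "Hausdorff_space ?TQ"
    unfolding Hausdorff_space_def
  proof (intro allI impI)
    fix C D assume CD: "C \<in> topspace ?TQ \<and> D \<in> topspace ?TQ \<and> C \<noteq> D"
    then obtain x y where x: "x \<in> carrier G" "C = K #> x" and y: "y \<in> carrier G" "D = K #> y"
      unfolding topspace_Mod carrier_FactGroup by blast
    have "x \<otimes> inv y \<notin> K" using CD x y r_coset_eq_iff[OF K.is_subgroup x(1) y(1)] by blast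
    then obtain M where M: "subgroup M G" "openin T M" "K \<subseteq> M" "x \<otimes> inv y \<notin> M"
      using sep[of "x \<otimes> inv y"] x y by auto
    define V where "V a = {z \<in> carrier G. z \<otimes> inv a \<in> M}" for a
    have V: "openin ?TQ ((\<lambda>x. K #> x) ` V a)" "a \<in> V a" if "a \<in> carrier G" for a
    proof -
      have "openin T (V a)" unfolding V_def using that M(2) by (intro openin_preimage continuous_intros) auto
      then show "openin ?TQ ((\<lambda>x. K #> x) ` V a)" using open_map_Mod[OF K(1)] unfolding open_map_def by blast
      show "a \<in> V a" unfolding V_def using that subgroup.one_closed[OF M(1)] by simp
    qed
    have "disjnt ((\<lambda>x. K #> x) ` V x) ((\<lambda>x. K #> x) ` V y)"
      unfolding disjnt_iff
    proof (intro allI notI, elim conjE imageE)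
      fix E v w assume vw: "v \<in> V x" "w \<in> V y" "E = K #> v" "E = K #> w"
      have c: "v \<in> carrier G" "w \<in> carrier G" "v \<otimes> inv x \<in> M" "w \<otimes> inv y \<in> M"
        using vw unfolding V_def by auto
      then have "v \<otimes> inv w \<in> M" using vw(3,4) M(3) r_coset_eq_iff[OF K.is_subgroup, of v w] by auto
      then have "inv (v \<otimes> inv x) \<otimes> ((v \<otimes> inv w) \<otimes> (w \<otimes> inv y)) \<in> M"
        using subgroup.m_closed[OF M(1) subgroup.m_inv_closed[OF M(1) c(3)] subgroup.m_closed[OF M(1) _ c(4)]] by blast
      then show False using M(4) x(1) y(1) c(1,2) by (simp add: inv_mult_group m_assoc)
    qed
    then show "\<exists>U V. openin ?TQ U \<and> openin ?TQ V \<and> C \<in> U \<and> D \<in> V \<and> disjnt U V"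
      using V[OF x(1)] V[OF y(1)] x(2) y(2) by blast
  qed
  interpret Q: topological_group ?Q ?TQ
  proof
    show "topspace ?TQ = carrier ?Q" by (rule topspace_Mod)
    have "continuous_map ?TQ ?TQ (\<lambda>C. inv\<^bsub>?Q\<^esub> C) \<longleftrightarrow> continuous_map T ?TQ ((\<lambda>C. inv\<^bsub>?Q\<^esub> C) \<circ> (\<lambda>x. K #> x))"
      by (rule continuous_compose_quotient_map_eq[OF qm, symmetric])
    moreover have "continuous_map T ?TQ (\<lambda>x. K #> inv x)"
      using continuous_map_compose[OF continuous_inv cont] by (simp add: o_def)
    then have "continuous_map T ?TQ ((\<lambda>C. inv\<^bsub>?Q\<^esub> C) \<circ> (\<lambda>x. K #> x))"
      by (rule continuous_map_eq) (simp add: topspace_eq pi.hom_inv)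
    ultimately show "continuous_map ?TQ ?TQ (\<lambda>C. inv\<^bsub>?Q\<^esub> C)" by simp
    let ?pp = "\<lambda>(x, y). (K #> x, K #> y)"
    have cpp: "continuous_map (prod_topology T T) (prod_topology ?TQ ?TQ) ?pp"
      using cont by (simp add: continuous_map_prod_top)
    have qpp: "quotient_map (prod_topology T T) (prod_topology ?TQ ?TQ) ?pp"
    proof (rule continuous_closed_imp_quotient_map[OF cpp])
      show "closed_map (prod_topology T T) (prod_topology ?TQ ?TQ) ?pp"
        by (rule continuous_imp_closed_map[OF cpp])
          (simp_all add: compact_space_prod_topology Hausdorff_space_prod_topology compact HausQ)
      show "?pp ` topspace (prod_topology T T) = topspace (prod_topology ?TQ ?TQ)"
        unfolding topspace_prod_topology topspace_Mod carrier_FactGroup topspace_eq by force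
    qed
    have "continuous_map (prod_topology T T) ?TQ (\<lambda>p. K #> (fst p \<otimes> snd p))"
      using continuous_map_compose[OF continuous_mult cont] by (simp add: o_def case_prod_unfold)
    then have "continuous_map (prod_topology T T) ?TQ ((\<lambda>(C, D). C \<otimes>\<^bsub>?Q\<^esub> D) \<circ> ?pp)"
    proof (rule continuous_map_eq)
      fix p assume "p \<in> topspace (prod_topology T T)"
      then obtain x y where "p = (x, y)" "x \<in> carrier G" "y \<in> carrier G"
        by (cases p) (simp add: topspace_eq)
      then show "K #> (fst p \<otimes> snd p) = ((\<lambda>(C, D). C \<otimes>\<^bsub>?Q\<^esub> D) \<circ> ?pp) p"
        by simp
    qed
    then show "continuous_map (prod_topology ?TQ ?TQ) ?TQ (\<lambda>(C, D). C \<otimes>\<^bsub>?Q\<^esub> D)"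
      using continuous_compose_quotient_map_eq[OF qpp] by blast
  qed
  interpret Q: compact_group ?Q ?TQ by unfold_locales (rule compQ, rule HausQ)
  have "profinite_group ?Q ?TQ"
  proof (rule Q.profinite_groupI)
    fix C assume C: "C \<in> carrier ?Q" "C \<noteq> \<one>\<^bsub>?Q\<^esub>"
    then obtain x where x: "x \<in> carrier G" "C = K #> x" unfolding carrier_FactGroup by blast
    then have "x \<notin> K" using C(2) K.rcos_const[OF is_group] by auto
    then obtain M where M: "subgroup M G" "openin T M" "K \<subseteq> M" "x \<notin> M" using sep x(1) by blast
    have "C \<notin> (\<lambda>x. K #> x) ` M"
    proof
      assume "C \<in> (\<lambda>x. K #> x) ` M"
      then obtain m where m: "m \<in> M" "K #> x = K #> m" using x(2) by blast
      have mc: "m \<in> carrier G" using m(1) subgroup.mem_carrier[OF M(1)] by blast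
      have "x \<otimes> inv m \<in> M" using m(2) M(3) r_coset_eq_iff[OF K.is_subgroup x(1) mc] by blast
      from subgroup.m_closed[OF M(1) this m(1)] show False using M(4) x(1) mc by (simp add: m_assoc)
    qed
    moreover have "openin ?TQ ((\<lambda>x. K #> x) ` M)"
      using open_map_Mod[OF K(1)] M(2) unfolding open_map_def by blast
    ultimately show "\<exists>H. subgroup H ?Q \<and> openin ?TQ H \<and> C \<notin> H"
      using pi.subgroup_img_is_subgroup[OF M(1)] by blast
  qed
  then show ?thesis by (rule profinite_groupD)
qed

text \<open>
  Closed subgroups of \<open>G/K\<close> correspond to closed subgroups of \<open>G\<close> that contain \<open>K\<close>; the index, commutativity
  and generators are transported along this correspondence.
\<close>

lemma virtually_fg_abelian_Mod_iff:
  assumes K: "K \<lhd> G" "closedin T K"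
  shows "virtually_fg_abelian (G Mod K) (quotient_group_topology G T K) \<longleftrightarrow>
    (\<exists>B S. subgroup B G \<and> closedin T B \<and> finite_index B G \<and> K \<subseteq> B \<and>
        (\<forall>x\<in>B. \<forall>y\<in>B. x \<otimes> y \<otimes> inv x \<otimes> inv y \<in> K) \<and>
        finite S \<and> S \<subseteq> B \<and> topgen (K \<union> S) = B)" (is "?lhs \<longleftrightarrow> ?rhs")
proof -
  let ?Q = "G Mod K" and ?TQ = "quotient_group_topology G T K" and ?pi = "\<lambda>x. K #> x"
  interpret K: normal K G by (rule K(1))
  interpret Q: profinite ?Q ?TQ by (rule profinite_Mod[OF K])
  interpret pi: group_hom G ?Q ?pi by unfold_locales (rule K.r_coset_hom_Mod)
  have cont: "continuous_map T ?TQ ?pi" by (rule quotient_imp_continuous_map[OF quotient_map_Mod])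
  have closed: "closedin ?TQ (?pi ` A)" if "closedin T A" for A
    using continuous_imp_closed_map[OF cont compact Q.Hausdorff] that unfolding closed_map_def by blast
  have preimage: "subgroup {x \<in> carrier G. ?pi x \<in> P} G" "closedin T {x \<in> carrier G. ?pi x \<in> P}"
      "K \<subseteq> {x \<in> carrier G. ?pi x \<in> P}" if P: "subgroup P ?Q" "closedin ?TQ P" for P
  proof -
    have one: "K \<in> P" using subgroup.one_closed[OF P(1)] by simp
    show sub: "subgroup {x \<in> carrier G. ?pi x \<in> P} G"
    proof (rule subgroupI)
      show "{x \<in> carrier G. ?pi x \<in> P} \<noteq> {}" using one coset_mult_one[OF K.subset] by force
    next
      fix x assume x: "x \<in> {x \<in> carrier G. ?pi x \<in> P}"
      then show "inv x \<in> {x \<in> carrier G. ?pi x \<in> P}"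
        using subgroup.m_inv_closed[OF P(1), of "?pi x"] pi.hom_inv[of x] by simp
      fix y assume y: "y \<in> {x \<in> carrier G. ?pi x \<in> P}"
      then show "x \<otimes> y \<in> {x \<in> carrier G. ?pi x \<in> P}"
        using x subgroup.m_closed[OF P(1), of "?pi x" "?pi y"] pi.hom_mult[of x y] by simp
    qed blast
    show "closedin T {x \<in> carrier G. ?pi x \<in> P}"
      using closedin_continuous_map_preimage[OF cont P(2)] by (simp add: topspace_eq)
    show "K \<subseteq> {x \<in> carrier G. ?pi x \<in> P}" using one K.rcos_const[OF is_group] K.subset by auto
  qed
  have saturated: "x \<in> B" if B: "subgroup B G" "K \<subseteq> B" and x: "x \<in> carrier G" "?pi x \<in> ?pi ` B" for B x
  proof -
    obtain b where b: "b \<in> B" "?pi x = ?pi b" using x(2) by blast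
    have bc: "b \<in> carrier G" by (rule subgroup.mem_carrier[OF B(1) b(1)])
    have "x \<otimes> inv b \<in> B" using b(2) B(2) r_coset_eq_iff[OF K.is_subgroup x(1) bc] by blast
    from subgroup.m_closed[OF B(1) this b(1)] show ?thesis using x(1) bc by (simp add: m_assoc)
  qed
  show ?thesis
  proof
    assume ?lhs
    then obtain H where H: "subgroup H ?Q" "closedin ?TQ H" "finite_index H ?Q"
      "comm_group (?Q\<lparr>carrier := H\<rparr>)" "top_finitely_generated (?Q\<lparr>carrier := H\<rparr>) (subtopology ?TQ H)"
      unfolding virtually_fg_abelian_def closed_subgroup_def by blast
    define B where "B = {x \<in> carrier G. ?pi x \<in> H}"
    note B = preimage[OF H(1,2), folded B_def]
    have Hc: "H \<subseteq> ?pi ` carrier G" using subgroup.subset[OF H(1)] unfolding carrier_FactGroup .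
    have piB: "?pi ` B = H" unfolding B_def using Hc by blast
    have "rcosets B \<subseteq> (\<lambda>D. {z \<in> carrier G. ?pi z \<in> D}) ` (rcosets\<^bsub>?Q\<^esub> H)"
    proof
      fix D assume "D \<in> rcosets B"
      then obtain x where x: "x \<in> carrier G" "D = B #> x" unfolding RCOSETS_def by blast
      have xQ: "?pi x \<in> carrier ?Q" using x(1) unfolding carrier_FactGroup by blast
      have "z \<in> B #> x \<longleftrightarrow> ?pi z \<in> H #>\<^bsub>?Q\<^esub> ?pi x" if z: "z \<in> carrier G" for z
      proof -
        have zQ: "?pi z \<in> carrier ?Q" using z unfolding carrier_FactGroup by blast
        have "?pi z \<in> H #>\<^bsub>?Q\<^esub> ?pi x \<longleftrightarrow> ?pi z \<otimes>\<^bsub>?Q\<^esub> inv\<^bsub>?Q\<^esub> ?pi x \<in> H"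
          by (rule subgroup.rcos_module[OF H(1) Q.is_group xQ zQ])
        also have "?pi z \<otimes>\<^bsub>?Q\<^esub> inv\<^bsub>?Q\<^esub> ?pi x = ?pi (z \<otimes> inv x)" using z x(1) by (simp only: pi.hom_mult pi.hom_inv inv_closed)
        also have "?pi (z \<otimes> inv x) \<in> H \<longleftrightarrow> z \<otimes> inv x \<in> B" unfolding B_def using z x(1) by simp
        also have "\<dots> \<longleftrightarrow> z \<in> B #> x" by (rule subgroup.rcos_module[OF B(1) is_group x(1) z, symmetric])
        finally show ?thesis by simp
      qed
      then have "D = {z \<in> carrier G. ?pi z \<in> H #>\<^bsub>?Q\<^esub> ?pi x}"
        using r_coset_subset_G[OF subgroup.subset[OF B(1)] x(1)] x(2) by blast
      then show "D \<in> (\<lambda>D. {z \<in> carrier G. ?pi z \<in> D}) ` (rcosets\<^bsub>?Q\<^esub> H)"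
        using Q.rcosetsI[OF subgroup.subset[OF H(1)] xQ] by blast
    qed
    then have fi: "finite_index B G" using H(3) unfolding finite_index_def by (rule finite_surj[rotated])
    have comm: "x \<otimes> y \<otimes> inv x \<otimes> inv y \<in> K" if "x \<in> B" "y \<in> B" for x y
    proof -
      have c: "x \<in> carrier G" "y \<in> carrier G" "?pi x \<in> H" "?pi y \<in> H" using that unfolding B_def by auto
      interpret C: comm_group "?Q\<lparr>carrier := H\<rparr>" by (rule H(4))
      have "?pi x \<otimes>\<^bsub>?Q\<^esub> ?pi y = ?pi y \<otimes>\<^bsub>?Q\<^esub> ?pi x" using C.m_comm[of "?pi x" "?pi y"] c by simp
      then have "?pi (x \<otimes> y) = ?pi (y \<otimes> x)" using c by (simp only: pi.hom_mult)
      then have "(x \<otimes> y) \<otimes> inv (y \<otimes> x) \<in> K"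
        using c r_coset_eq_iff[OF K.is_subgroup, of "x \<otimes> y" "y \<otimes> x"] by simp
      then show ?thesis using c by (simp add: inv_mult_group m_assoc)
    qed
    obtain S' where S': "S' \<subseteq> H" "finite S'" "Q.topgen S' = H"
      using H(5) Q.topgen_consistent[OF H(1,2)]
      unfolding top_finitely_generated_def
      using topological_group.topgen_def[OF profinite.axioms(1)[THEN compact_group.axioms(1), OF Q.profinite_closed_subgroup[OF H(1,2)]]]
      by auto
    obtain S where S: "S \<subseteq> B" "finite S" "S' = ?pi ` S"
      using finite_subset_image[of S' ?pi B] S' piB by blast
    have sub: "K \<union> S \<subseteq> carrier G" using S(1) K.subset subgroup.subset[OF B(1)] by blast
    let ?P = "topgen (K \<union> S)"
    have P: "subgroup ?P G" "closedin T ?P" "K \<union> S \<subseteq> ?P"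
      using subgroup_topgen[OF sub] closedin_topgen topgen_incl[OF sub] by blast+
    have "H \<subseteq> ?pi ` ?P"
      unfolding S'(3)[symmetric]
      by (rule Q.topgen_minimal[OF _ pi.subgroup_img_is_subgroup[OF P(1)] closed[OF P(2)]]) (use S(3) P(3) in blast)
    then have "B \<subseteq> ?P" using saturated[OF P(1)] P(3) unfolding B_def by blast
    moreover have "?P \<subseteq> B" using S(1) B(3) by (intro topgen_minimal B) blast
    ultimately have "?P = B" by blast
    then show ?rhs using B fi comm S(1,2) by blast
  next
    assume ?rhs
    then obtain B S where BS: "subgroup B G \<and> closedin T B \<and> finite_index B G \<and> K \<subseteq> B \<and>
        (\<forall>x\<in>B. \<forall>y\<in>B. x \<otimes> y \<otimes> inv x \<otimes> inv y \<in> K) \<and>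
        finite S \<and> S \<subseteq> B \<and> topgen (K \<union> S) = B" by (elim exE)
    then have B: "subgroup B G" "closedin T B" "finite_index B G" "K \<subseteq> B"
      and comm: "\<forall>x\<in>B. \<forall>y\<in>B. x \<otimes> y \<otimes> inv x \<otimes> inv y \<in> K"
      and S: "finite S" "S \<subseteq> B" "topgen (K \<union> S) = B" by simp_all
    have Bc: "B \<subseteq> carrier G" by (rule subgroup.subset[OF B(1)])
    define H where "H = ?pi ` B"
    have H: "subgroup H ?Q" "closedin ?TQ H"
      unfolding H_def by (rule pi.subgroup_img_is_subgroup[OF B(1)], rule closed[OF B(2)])
    have "rcosets\<^bsub>?Q\<^esub> H \<subseteq> (\<lambda>D. ?pi ` D) ` (rcosets B)"
    proof
      fix D assume "D \<in> rcosets\<^bsub>?Q\<^esub> H"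
      then obtain x where x: "x \<in> carrier G" "D = H #>\<^bsub>?Q\<^esub> ?pi x" unfolding RCOSETS_def carrier_FactGroup by blast
      have "D = ?pi ` (B #> x)"
        unfolding x(2) H_def r_coset_def[of ?Q] r_coset_def[of G B] using Bc x(1) pi.hom_mult
        by (auto simp: subset_iff image_UN)
      then show "D \<in> (\<lambda>D. ?pi ` D) ` (rcosets B)" using rcosetsI[OF Bc x(1)] by blast
    qed
    then have fi: "finite_index H ?Q" using B(3) unfolding finite_index_def by (rule finite_surj[rotated])
    have "comm_group (?Q\<lparr>carrier := H\<rparr>)"
    proof (rule group.group_comm_groupI[OF Q.subgroup_imp_group[OF H(1)]])
      fix C D assume "C \<in> carrier (?Q\<lparr>carrier := H\<rparr>)" "D \<in> carrier (?Q\<lparr>carrier := H\<rparr>)"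
      then obtain x y where x: "x \<in> B" "C = ?pi x" and y: "y \<in> B" "D = ?pi y" unfolding H_def by auto
      have c: "x \<in> carrier G" "y \<in> carrier G" using x y Bc by auto
      have "x \<otimes> y \<otimes> inv x \<otimes> inv y \<in> K" using comm x(1) y(1) by blast
      then have "(x \<otimes> y) \<otimes> inv (y \<otimes> x) \<in> K" using c by (simp add: inv_mult_group m_assoc)
      then have "?pi (x \<otimes> y) = ?pi (y \<otimes> x)"
        using c r_coset_eq_iff[OF K.is_subgroup, of "x \<otimes> y" "y \<otimes> x"] by simp
      then show "C \<otimes>\<^bsub>?Q\<lparr>carrier := H\<rparr>\<^esub> D = D \<otimes>\<^bsub>?Q\<lparr>carrier := H\<rparr>\<^esub> C" using x y c by simp
    qed
    moreover have "top_finitely_generated (?Q\<lparr>carrier := H\<rparr>) (subtopology ?TQ H)"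
    proof -
      have SH: "?pi ` S \<subseteq> H" unfolding H_def using S(2) by blast
      have SQ: "?pi ` S \<subseteq> carrier ?Q" using SH subgroup.subset[OF H(1)] by blast
      let ?P = "Q.topgen (?pi ` S)"
      have P: "subgroup ?P ?Q" "closedin ?TQ ?P" "?pi ` S \<subseteq> ?P"
        using Q.subgroup_topgen[OF SQ] Q.closedin_topgen Q.topgen_incl[OF SQ] by blast+
      have "topgen (K \<union> S) \<subseteq> {x \<in> carrier G. ?pi x \<in> ?P}"
        by (rule topgen_minimal[OF _ preimage(1,2)[OF P(1,2)]])
          (use preimage(3)[OF P(1,2)] P(3) S(2) Bc in blast)
      then have "H \<subseteq> ?P" unfolding S(3) H_def by blast
      moreover have "?P \<subseteq> H" by (rule Q.topgen_minimal[OF SH H])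
      ultimately have "?P = H" by blast
      then have "topological_group.topgen (?Q\<lparr>carrier := H\<rparr>) (subtopology ?TQ H) (?pi ` S) = H"
        using Q.topgen_consistent[OF H SH] by simp
      then show ?thesis
        unfolding top_finitely_generated_def
        using topological_group.topgen_def[OF profinite.axioms(1)[THEN compact_group.axioms(1), OF Q.profinite_closed_subgroup[OF H]]]
          SH S(1) by (intro exI[of _ "?pi ` S"]) simp
    qed
    ultimately show ?lhs unfolding virtually_fg_abelian_def closed_subgroup_def using H fi by blast
  qed
qed

lemma frakV_iff: "K \<in> frakV G T \<longleftrightarrow> virtual_kernel K"
proof (cases "K \<lhd> G \<and> closedin T K")
  case True
  then have K: "K \<lhd> G" "closedin T K" by blast+
  have "profinite_group (G Mod K) (quotient_group_topology G T K)"
    by (rule profinite.profinite_group[OF profinite_Mod[OF K]])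
  then show ?thesis
    unfolding frakV_def in_frakB_def virtual_kernel_def
    using K torsion_free_Mod_iff[OF K(1)] virtually_fg_abelian_Mod_iff[OF K] by simp
next
  case False
  then show ?thesis unfolding frakV_def virtual_kernel_def by blast
qed

section \<open>The natural map\<close>

lemma frakV_nonempty:
  assumes "weakly_totally_torsion_free G T"
  shows "frakV G T \<noteq> {}"
proof -
  have "openin T (carrier G)" using openin_topspace[of T] by (simp add: topspace_eq)
  then show ?thesis using ex_virtual_kernel[OF assms normal_self] frakV_iff by blast
qed

lemma frakV_Int: "\<lbrakk>K \<in> frakV G T; L \<in> frakV G T\<rbrakk> \<Longrightarrow> K \<inter> L \<in> frakV G T"
  unfolding frakV_iff by (rule virtual_kernel_Int)

lemma natural_hom_hom: "natural_hom G T \<in> hom G (frakV_product G T)"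
proof (rule homI)
  show "natural_hom G T x \<in> carrier (frakV_product G T)" if "x \<in> carrier G" for x
    using that unfolding natural_hom_def frakV_product_def by (auto simp: carrier_FactGroup)
  fix x y assume xy: "x \<in> carrier G" "y \<in> carrier G"
  have "K #> (x \<otimes> y) = (K #> x) <#> (K #> y)" if "K \<in> frakV G T" for K
    using normal.rcos_sum[of K G x y] that xy unfolding frakV_def by simp
  then show "natural_hom G T (x \<otimes> y) = natural_hom G T x \<otimes>\<^bsub>frakV_product G T\<^esub> natural_hom G T y"
    unfolding natural_hom_def frakV_product_def by (auto simp: fun_eq_iff)
qed

lemma natural_hom_inj:
  assumes wt: "weakly_totally_torsion_free G T"
  shows "inj_on (natural_hom G T) (carrier G)"
proof (rule inj_onI, rule ccontr)
  fix x y assume x: "x \<in> carrier G" and y: "y \<in> carrier G" and eq: "natural_hom G T x = natural_hom G T y"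
    and "x \<noteq> y"
  have "x \<otimes> inv y \<noteq> \<one>" using x y \<open>x \<noteq> y\<close> by (metis inv_closed inv_equality inv_inv)
  then obtain N where N: "N \<lhd> G" "openin T N" "x \<otimes> inv y \<notin> {\<one>} <#> N"
    using separate_closed[OF closedin_one, of "x \<otimes> inv y"] x y by auto
  obtain K where K: "K \<subseteq> N" "K \<in> frakV G T" using ex_virtual_kernel[OF wt N(1,2)] frakV_iff by blast
  have "K #> x = K #> y" using fun_cong[OF eq, of K] K(2) unfolding natural_hom_def by simp
  moreover have "subgroup K G" using K(2) normal_imp_subgroup unfolding frakV_def by blast
  ultimately have "x \<otimes> inv y \<in> N" using r_coset_eq_iff x y K(1) by blast
  moreover have "N \<subseteq> {\<one>} <#> N"
    using subgroup.subset[OF normal_imp_subgroup[OF N(1)]] unfolding set_mult_def by force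
  ultimately show False using N(3) by blast
qed

lemma natural_hom_homeomorphic:
  assumes wt: "weakly_totally_torsion_free G T"
  shows "homeomorphic_map T (subtopology (frakV_product_topology G T) (natural_hom G T ` carrier G)) (natural_hom G T)"
proof (rule continuous_imp_homeomorphic_map[OF _ compact])
  let ?TP = "frakV_product_topology G T"
  have "continuous_map T ?TP (natural_hom G T)"
    unfolding frakV_product_topology_def continuous_map_componentwise
  proof (intro conjI ballI)
    show "natural_hom G T ` topspace T \<subseteq> extensional (frakV G T)" unfolding natural_hom_def by auto
    fix K assume K: "K \<in> frakV G T"
    then have "(\<lambda>x. natural_hom G T x K) = (\<lambda>x. K #> x)" unfolding natural_hom_def by auto
    then show "continuous_map T (quotient_group_topology G T K) (\<lambda>x. natural_hom G T x K)"
      using quotient_imp_continuous_map[OF quotient_map_Mod] by simp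
  qed
  then show "continuous_map T (subtopology ?TP (natural_hom G T ` carrier G)) (natural_hom G T)"
    by (auto simp: continuous_map_in_subtopology topspace_eq)
  have "Hausdorff_space (quotient_group_topology G T K)" if "K \<in> frakV G T" for K
    using that unfolding frakV_def in_frakB_def profinite_group_def by blast
  then have "Hausdorff_space ?TP"
    unfolding frakV_product_topology_def Hausdorff_space_product_topology by blast
  then show "Hausdorff_space (subtopology ?TP (natural_hom G T ` carrier G))" by (rule Hausdorff_space_subtopology)
  have "natural_hom G T ` carrier G \<subseteq> topspace ?TP"
    using \<open>continuous_map T ?TP (natural_hom G T)\<close> by (metis continuous_map_image_subset_topspace topspace_eq)
  then show "natural_hom G T ` topspace T = topspace (subtopology ?TP (natural_hom G T ` carrier G))"
    by (auto simp: topspace_eq)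
  show "inj_on (natural_hom G T) (topspace T)" using natural_hom_inj[OF wt] by (simp add: topspace_eq)
qed

text \<open>
  A compatible family of cosets is directed, since \<open>frakV G T\<close> is closed under intersections. By
  compactness the cosets have a common element, and every coset is determined by any of its elements.
\<close>

lemma frakV_inverse_limit_carrier_eq:
  assumes wt: "weakly_totally_torsion_free G T"
  shows "frakV_inverse_limit_carrier G T = natural_hom G T ` carrier G"
proof
  have V: "K \<lhd> G" "subgroup K G" "closedin T K" if "K \<in> frakV G T" for K
    using that normal_imp_subgroup unfolding frakV_def by blast+
  show "natural_hom G T ` carrier G \<subseteq> frakV_inverse_limit_carrier G T"
  proof clarify
    fix x assume x: "x \<in> carrier G"
    have "natural_hom G T x \<in> carrier (frakV_product G T)"
      using natural_hom_hom x unfolding hom_def by blast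
    then show "natural_hom G T x \<in> frakV_inverse_limit_carrier G T"
      unfolding frakV_inverse_limit_carrier_def natural_hom_def
      using quotient_projection_coset V(2) x by auto
  qed
  show "frakV_inverse_limit_carrier G T \<subseteq> natural_hom G T ` carrier G"
  proof
    fix f assume f: "f \<in> frakV_inverse_limit_carrier G T"
    have coset: "\<exists>x\<in>carrier G. f K = K #> x" if "K \<in> frakV G T" for K
    proof -
      have "f K \<in> carrier (G Mod K)"
        using f that unfolding frakV_inverse_limit_carrier_def frakV_product_def by (auto simp: PiE_iff)
      then show ?thesis unfolding carrier_FactGroup by blast
    qed
    have proj: "L <#> f K = f L" if "K \<in> frakV G T" "L \<in> frakV G T" "K \<subseteq> L" for K L
      using f that unfolding frakV_inverse_limit_carrier_def quotient_projection_def by blast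
    have mono: "f K \<subseteq> f L" if KL: "K \<in> frakV G T" "L \<in> frakV G T" "K \<subseteq> L" for K L
    proof
      fix z assume z: "z \<in> f K"
      obtain x where "x \<in> carrier G" "f K = K #> x" using coset[OF KL(1)] by blast
      then have "z \<in> carrier G" using z r_coset_subset_G[OF subgroup.subset[OF V(2)[OF KL(1)]]] by blast
      then have "z = \<one> \<otimes> z" by simp
      then have "z \<in> L <#> f K" using z subgroup.one_closed[OF V(2)[OF KL(2)]] unfolding set_mult_def by blast
      then show "z \<in> f L" using proj[OF KL] by simp
    qed
    have "\<Inter>(f ` frakV G T) \<noteq> {}"
    proof (rule directed_closed_Inter_nonempty[OF compact])
      show "f ` frakV G T \<noteq> {}" using frakV_nonempty[OF wt] by blast
      show "closedin T C" if C: "C \<in> f ` frakV G T" for C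
      proof -
        obtain K where K: "K \<in> frakV G T" "C = f K" using C by blast
        obtain x where x: "x \<in> carrier G" "f K = K #> x" using coset[OF K(1)] by blast
        have "K #> x = {z \<in> carrier G. z \<otimes> inv x \<in> K}"
          using subgroup.rcos_module[OF V(2)[OF K(1)] is_group x(1)]
            r_coset_subset_G[OF subgroup.subset[OF V(2)[OF K(1)]] x(1)] by blast
        moreover have "closedin T {z \<in> carrier G. z \<otimes> inv x \<in> K}"
          using x V(3)[OF K(1)] by (intro closedin_preimage continuous_intros) auto
        ultimately show ?thesis using K x by simp
      qed
      show "C \<noteq> {}" if C: "C \<in> f ` frakV G T" for C
      proof -
        obtain K where K: "K \<in> frakV G T" "C = f K" using C by blast
        obtain x where x: "x \<in> carrier G" "f K = K #> x" using coset[OF K(1)] by blast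
        show ?thesis using rcos_self[OF x(1) V(2)[OF K(1)]] K x by blast
      qed
      show "\<exists>E\<in>f ` frakV G T. E \<subseteq> C \<inter> D" if CD: "C \<in> f ` frakV G T" "D \<in> f ` frakV G T" for C D
      proof -
        obtain K L where KL: "K \<in> frakV G T" "L \<in> frakV G T" "C = f K" "D = f L" using CD by blast
        have KL': "K \<inter> L \<in> frakV G T" by (rule frakV_Int[OF KL(1,2)])
        show ?thesis using mono[OF KL' KL(1)] mono[OF KL' KL(2)] KL KL' by blast
      qed
    qed
    then obtain x where x: "\<And>K. K \<in> frakV G T \<Longrightarrow> x \<in> f K" by blast
    have xf: "x \<in> carrier G \<and> f K = K #> x" if K: "K \<in> frakV G T" for K
    proof -
      obtain y where y: "y \<in> carrier G" "f K = K #> y" using coset[OF K] by blast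
      have "x \<in> K #> y" using x[OF K] y(2) by simp
      then show ?thesis
        using y repr_independence[OF _ y(1) V(2)[OF K], of x]
          r_coset_subset_G[OF subgroup.subset[OF V(2)[OF K]] y(1)] by blast
    qed
    have "f \<in> extensional (frakV G T)"
      using f unfolding frakV_inverse_limit_carrier_def frakV_product_def by (auto simp: PiE_iff)
    then have "f = natural_hom G T x"
      unfolding natural_hom_def using xf by (intro extensionalityI[of _ "frakV G T"]) auto
    moreover have "x \<in> carrier G" using xf frakV_nonempty[OF wt] by blast
    ultimately show "f \<in> natural_hom G T ` carrier G" by blast
  qed
qed

end

theorem theorem3p2:
  fixes \<Gamma> :: "('a, 'b) monoid_scheme" and T :: "'a topology"
  assumes "profinite_group \<Gamma> T"
    and "weakly_totally_torsion_free \<Gamma> T"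
  shows "natural_hom \<Gamma> T \<in> hom \<Gamma> (frakV_product \<Gamma> T)
    \<and> inj_on (natural_hom \<Gamma> T) (carrier \<Gamma>)
    \<and> top_group_iso \<Gamma> T
        ((frakV_product \<Gamma> T)\<lparr>carrier := natural_hom \<Gamma> T ` carrier \<Gamma>\<rparr>)
        (subtopology (frakV_product_topology \<Gamma> T) (natural_hom \<Gamma> T ` carrier \<Gamma>))
        (natural_hom \<Gamma> T)
    \<and> top_group_iso \<Gamma> T
        (frakV_inverse_limit \<Gamma> T) (frakV_inverse_limit_topology \<Gamma> T)
        (natural_hom \<Gamma> T)"
proof -
  interpret profinite \<Gamma> T by (rule profinite_groupD[OF assms(1)])
  have hom: "natural_hom \<Gamma> T \<in> hom \<Gamma> (frakV_product \<Gamma> T)" by (rule natural_hom_hom)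
  have inj: "inj_on (natural_hom \<Gamma> T) (carrier \<Gamma>)" by (rule natural_hom_inj[OF assms(2)])
  have "natural_hom \<Gamma> T \<in> iso \<Gamma> ((frakV_product \<Gamma> T)\<lparr>carrier := natural_hom \<Gamma> T ` carrier \<Gamma>\<rparr>)"
    using hom inj by (auto simp: iso_def hom_def bij_betw_def)
  then have iso: "top_group_iso \<Gamma> T
      ((frakV_product \<Gamma> T)\<lparr>carrier := natural_hom \<Gamma> T ` carrier \<Gamma>\<rparr>)
      (subtopology (frakV_product_topology \<Gamma> T) (natural_hom \<Gamma> T ` carrier \<Gamma>))
      (natural_hom \<Gamma> T)"
    unfolding top_group_iso_def using natural_hom_homeomorphic[OF assms(2)] by blast
  then show ?thesis
    using hom inj
    unfolding frakV_inverse_limit_def frakV_inverse_limit_topology_def frakV_inverse_limit_carrier_eq[OF assms(2)]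
    by blast
qed

end
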